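(* Let $\Gamma=(\mathcal{C},\mathcal{X},H,I,\eta,\epsilon,\mathcal{E},\mathcal{F})$ be an admissible Galois structure on a finitely complete pointed category $\mathcal{C}$, with $H$ the inclusion of a full reflective subcategory $\mathcal{X}$, such that monadic extensions are pullback-stable, every object of $\mathcal{C}$ admits a weakly universal normal extension into it, and for every object $E$ of $\mathcal{C}$ the morphism $I(E)\to 0$ is in $\mathcal{F}$. Suppose moreover that the inclusion functor $\mathsf{NExt}_\Gamma(\mathcal{C})\to\mathsf{Ext}_\Gamma(\mathcal{C})$ admits a left adjoint $I_1\colon\mathsf{Ext}_\Gamma(\mathcal{C})\to\mathsf{NExt}_\Gamma(\mathcal{C})$. Then $\pi_1(-,I)\colon\mathcal{C}\to\mathcal{X}$ together with the natural transformation $\delta_{I_1}\colon\pi_1(-,I)\circ\mathrm{Cod}\Rightarrow\mathrm{Ker}\circ I_1$ is a (right) Kan extension of $\mathrm{Ker}\circ I_1\colon\mathsf{Ext}_\Gamma(\mathcal{C})\to\mathcal{X}$ along $\mathrm{Cod}\colon\mathsf{Ext}_\Gamma(\mathcal{C})\to\mathcal{C}$; that is, for every functor $F\colon\mathcal{C}\to\mathcal{X}$ and every natural transformation $\gamma\colon F\circ\mathrm{Cod}\Rightarrow\mathrm{Ker}\circ I_1$ there is a unique natural transformation $\alpha\colon F\Rightarrow\pi_1(-,I)$ with $\delta_{I_1}\circ\alpha_{\mathrm{Cod}}=\gamma$.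
   Context: **Galois structures.** A Galois structure $\Gamma=(\mathcal{C},\mathcal{X},H,I,\eta,\epsilon,\mathcal{E},\mathcal{F})$ on a category $\mathcal{C}$ is an adjunction $I\dashv H$, $I\colon\mathcal{C}\to\mathcal{X}$, $H\colon\mathcal{X}\to\mathcal{C}$, with unit $\eta\colon 1_{\mathcal{C}}\Rightarrow HI$ and counit $\epsilon\colon IH\Rightarrow 1_{\mathcal{X}}$, together with classes of morphisms $\mathcal{E}$ in $\mathcal{C}$ and $\mathcal{F}$ in $\mathcal{X}$ such that: (i) both contain all isomorphisms; (ii) both are pullback-stable (the pullback of a morphism in the class along any morphism exists and is in the class); (iii) both are closed under composition; (iv) $H(\mathcal{F})\subseteq\mathcal{E}$; (v) $I(\mathcal{E})\subseteq\mathcal{F}$. Morphisms in $\mathcal{E}$ are called fibrations. $(\mathcal{E}\downarrow B)$ denotes the full subcategory of the slice category $(\mathcal{C}\downarrow B)$ on morphisms in $\mathcal{E}$, and similarly $(\mathcal{F}\downarrow X)$. For $B\in\mathcal{C}$ let $H^B\colon(\mathcal{F}\downarrow I(B))\to(\mathcal{E}\downarrow B)$ send $g$ to the pullback of $H(g)$ along $\eta_B\colon B\to HI(B)$; $\Gamma$ is admissible when all $H^B$ are full and faithful. A trivial covering is a fibration $f\colon A\to B$ for which the naturality square of $\eta$ at $f$ (i.e. $HI(f)\circ\eta_A=\eta_B\circ f$) is a pullback. A monadic extension is a fibration $p\colon E\to B$ such that the pullback functor $p^*\colon(\mathcal{E}\downarrow B)\to(\mathcal{E}\downarrow E)$ is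 monadic. A normal extension is a monadic extension $p$ such that $p^*(p)$ is a trivial covering, i.e. a monadic extension whose kernel pair projections are trivial coverings. $\mathsf{Ext}_\Gamma(\mathcal{C})$ and $\mathsf{NExt}_\Gamma(\mathcal{C})$ are the full subcategories of the category of arrows of $\mathcal{C}$ on the monadic extensions and on the normal extensions, respectively; a morphism $p\to p'$ is a pair $(f,b)$ with $p'f=bp$. $\mathrm{Cod}$ is the codomain functor (on either category), and $\mathrm{Ker}\colon\mathsf{NExt}_\Gamma(\mathcal{C})\to\mathcal{X}$ is the kernel functor; the kernel of a normal extension lies in $\mathcal{X}$. As $H$ is a full inclusion, it is suppressed from notation, so $\eta_E\colon E\to I(E)$. **Convention on $I_1$.** The left adjoint $I_1$ leaves codomains intact (it may be chosen, up to natural isomorphism, with the unit having identity codomain components), so that $\mathrm{Cod}\circ I_1=\mathrm{Cod}$; this is how $\delta_{I_1}$, with components $(\delta_{I_1})_p=\delta_{I_1(p)}$, is a natural transformation $\pi_1(-,I)\circ\mathrm{Cod}\Rightarrow\mathrm{Ker}\circ I_1$. **Galois group.** For a normal extension $p\colon E\to B$ with kernel pair $d,c\colon\mathrm{Eq}(p)\rightrightarrows E$, the image under $I$ of the groupoid $\mathrm{Eq}(p)$ is an internal groupoid in $\mathcal{X}$ (by admissibility $I$ preserves pullbacks along trivial coverings). The Galois group $\mathrm{Gal}_\Gamma(p,0)$ is the internal group in $\mathcal{X}$ with underlying object $\mathrm{Ker}(I(d))\cap\mathrm{Ker}(I(c))\subseteq I(\mathrm{Eq}(p))$, with the induced multiplication;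 it is functorial in $p\in\mathsf{NExt}_\Gamma(\mathcal{C})$. It is known that its underlying object is canonically isomorphic to $\mathrm{Ker}(p)\cap\mathrm{Ker}(\eta_E)$ (via the restriction of $\eta_{\mathrm{Eq}(p)}\circ\langle 0,\ker p\rangle\colon\mathrm{Ker}(p)\to I(\mathrm{Eq}(p))$). The inclusions $\mathrm{Ker}(p)\cap\mathrm{Ker}(\eta_E)\to\mathrm{Ker}(p)$ thus give a natural transformation $\iota$ from the underlying object functor of $\mathrm{Gal}_\Gamma(-,0)$ to $\mathrm{Ker}$. **Fundamental group and $\delta$.** A normal extension $u\colon U\to B$ is weakly universal if for every normal extension $p\colon E\to B$ there is $e\colon U\to E$ with $p\circ e=u$. Morphisms of normal extensions with the same codomain component induce the same morphism of Galois groups. $\pi_1(B,I)$ is the underlying object of $\mathrm{Gal}_\Gamma(u,0)$ for a (chosen) weakly universal normal extension $u$ of $B$; on $f\colon A\to B$, $\pi_1(f,I)=\mathrm{Gal}_\Gamma((g,f),0)$ for any morphism $(g,f)\colon v\to u$ between the weakly universal normal extensions $v$ of $A$ and $u$ of $B$. Let $\kappa_p=\mathrm{Gal}_\Gamma((h,1_B),0)\colon\pi_1(B,I)\to\mathrm{Gal}_\Gamma(p,0)$ for $p\colon E\to B$ normal, $u\colon U\to B$ the weakly universal normal extension of $B$, and any $h\colon U\to E$ with $ph=u$. Then $\delta=\iota\circ\kappa\colon\pi_1(-,I)\circ\mathrm{Cod}\Rightarrow\mathrm{Ker}$ on $\mathsf{NExt}_\Gamma(\mathcal{C})$. *)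

theory Defs
  imports "HOL-Library.FuncSet"
begin

section \<open>Categories, functors, natural transformations\<close>

record ('o, 'a) cat =
  Obj :: "'o set"
  Arr :: "'a set"
  Dom :: "'a \<Rightarrow> 'o"
  Cod :: "'a \<Rightarrow> 'o"
  Id :: "'o \<Rightarrow> 'a"
  Comp :: "'a \<Rightarrow> 'a \<Rightarrow> 'a" (infixr "\<cdot>\<index>" 75)

definition hom :: "('o, 'a) cat \<Rightarrow> 'o \<Rightarrow> 'o \<Rightarrow> 'a set" where
  "hom C A B = {f \<in> Arr C. Dom C f = A \<and> Cod C f = B}"

locale category =
  fixes C :: "('o, 'a) cat"
  assumes dom_obj: "f \<in> Arr C \<Longrightarrow> Dom C f \<in> Obj C"
    and cod_obj: "f \<in> Arr C \<Longrightarrow> Cod C f \<in> Obj C"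
    and id_hom: "A \<in> Obj C \<Longrightarrow> Id C A \<in> hom C A A"
    and comp_hom: "f \<in> hom C A B \<Longrightarrow> g \<in> hom C B D \<Longrightarrow> g \<cdot>\<^bsub>C\<^esub> f \<in> hom C A D"
    and id_left: "f \<in> hom C A B \<Longrightarrow> Id C B \<cdot>\<^bsub>C\<^esub> f = f"
    and id_right: "f \<in> hom C A B \<Longrightarrow> f \<cdot>\<^bsub>C\<^esub> Id C A = f"
    and assoc: "f \<in> hom C A B \<Longrightarrow> g \<in> hom C B D \<Longrightarrow> h \<in> hom C D E \<Longrightarrow>
                  (h \<cdot>\<^bsub>C\<^esub> g) \<cdot>\<^bsub>C\<^esub> f = h \<cdot>\<^bsub>C\<^esub> (g \<cdot>\<^bsub>C\<^esub> f)"

definition is_inverse :: "('o, 'a) cat \<Rightarrow> 'a \<Rightarrow> 'a \<Rightarrow> bool" where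
  "is_inverse C f g \<longleftrightarrow> f \<in> Arr C \<and> g \<in> hom C (Cod C f) (Dom C f) \<and>
     g \<cdot>\<^bsub>C\<^esub> f = Id C (Dom C f) \<and> f \<cdot>\<^bsub>C\<^esub> g = Id C (Cod C f)"

definition is_iso :: "('o, 'a) cat \<Rightarrow> 'a \<Rightarrow> bool" where
  "is_iso C f \<longleftrightarrow> (\<exists>g. is_inverse C f g)"

definition inverse_arr :: "('o, 'a) cat \<Rightarrow> 'a \<Rightarrow> 'a" where
  "inverse_arr C f = (THE g. is_inverse C f g)"

definition full_sub :: "('o, 'a) cat \<Rightarrow> 'o set \<Rightarrow> ('o, 'a) cat" where
  "full_sub C S = C\<lparr>Obj := Obj C \<inter> S, Arr := {f \<in> Arr C. Dom C f \<in> S \<and> Cod C f \<in> S}\<rparr>"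

record ('o1, 'a1, 'o2, 'a2) fctr =
  FO :: "'o1 \<Rightarrow> 'o2"
  FA :: "'a1 \<Rightarrow> 'a2"

locale cat_functor =
  fixes A :: "('o1, 'a1) cat" and B :: "('o2, 'a2) cat" and F :: "('o1, 'a1, 'o2, 'a2) fctr"
  assumes cat_source: "category A"
    and cat_target: "category B"
    and FO_obj: "x \<in> Obj A \<Longrightarrow> FO F x \<in> Obj B"
    and FA_hom: "f \<in> hom A x y \<Longrightarrow> FA F f \<in> hom B (FO F x) (FO F y)"
    and FA_id: "x \<in> Obj A \<Longrightarrow> FA F (Id A x) = Id B (FO F x)"
    and FA_comp: "f \<in> hom A x y \<Longrightarrow> g \<in> hom A y z \<Longrightarrow> FA F (g \<cdot>\<^bsub>A\<^esub> f) = FA F g \<cdot>\<^bsub>B\<^esub> FA F f"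

text \<open>Also used as the inclusion functor of a full subcategory.\<close>

definition id_fctr :: "('o, 'a, 'o, 'a) fctr" where
  "id_fctr = \<lparr>FO = (\<lambda>x. x), FA = (\<lambda>f. f)\<rparr>"

definition comp_fctr ::
    "('o2, 'a2, 'o3, 'a3) fctr \<Rightarrow> ('o1, 'a1, 'o2, 'a2) fctr \<Rightarrow> ('o1, 'a1, 'o3, 'a3) fctr"
    (infixr "\<circ>\<^sub>F" 75) where
  "G \<circ>\<^sub>F F = \<lparr>FO = (\<lambda>x. FO G (FO F x)), FA = (\<lambda>f. FA G (FA F f))\<rparr>"

locale nat_trans =
  fixes A :: "('o1, 'a1) cat" and B :: "('o2, 'a2) cat"
    and F G :: "('o1, 'a1, 'o2, 'a2) fctr" and \<tau> :: "'o1 \<Rightarrow> 'a2"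
  assumes source_functor: "cat_functor A B F"
    and target_functor: "cat_functor A B G"
    and component: "x \<in> Obj A \<Longrightarrow> \<tau> x \<in> hom B (FO F x) (FO G x)"
    and naturality: "f \<in> hom A x y \<Longrightarrow> FA G f \<cdot>\<^bsub>B\<^esub> \<tau> x = \<tau> y \<cdot>\<^bsub>B\<^esub> FA F f"

definition full_functor ::
    "('o1, 'a1) cat \<Rightarrow> ('o2, 'a2) cat \<Rightarrow> ('o1, 'a1, 'o2, 'a2) fctr \<Rightarrow> bool" where
  "full_functor A B F \<longleftrightarrow>
     (\<forall>x \<in> Obj A. \<forall>y \<in> Obj A. \<forall>g \<in> hom B (FO F x) (FO F y). \<exists>f \<in> hom A x y. FA F f = g)"

definition faithful_functor :: "('o1, 'a1) cat \<Rightarrow> ('o1, 'a1, 'o2, 'a2) fctr \<Rightarrow> bool" where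
  "faithful_functor A F \<longleftrightarrow> (\<forall>x \<in> Obj A. \<forall>y \<in> Obj A. inj_on (FA F) (hom A x y))"

definition equivalence_functor ::
    "('o1, 'a1) cat \<Rightarrow> ('o2, 'a2) cat \<Rightarrow> ('o1, 'a1, 'o2, 'a2) fctr \<Rightarrow> bool" where
  "equivalence_functor A B F \<longleftrightarrow> cat_functor A B F \<and>
     (\<exists>G \<sigma> \<tau>. cat_functor B A G \<and>
        nat_trans A A id_fctr (G \<circ>\<^sub>F F) \<sigma> \<and> (\<forall>x \<in> Obj A. is_iso A (\<sigma> x)) \<and>
        nat_trans B B (F \<circ>\<^sub>F G) id_fctr \<tau> \<and> (\<forall>y \<in> Obj B. is_iso B (\<tau> y)))"

text \<open>\<open>adjunction A B L R \<eta> \<epsilon>\<close>: the functor \<open>L : A \<rightarrow> B\<close> is left adjoint to \<open>R : B \<rightarrow> A\<close>.\<close>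

locale adjunction =
  fixes A :: "('o1, 'a1) cat" and B :: "('o2, 'a2) cat"
    and L :: "('o1, 'a1, 'o2, 'a2) fctr" and R :: "('o2, 'a2, 'o1, 'a1) fctr"
    and \<eta> :: "'o1 \<Rightarrow> 'a1" and \<epsilon> :: "'o2 \<Rightarrow> 'a2"
  assumes left_functor: "cat_functor A B L"
    and right_functor: "cat_functor B A R"
    and unit_natural: "nat_trans A A id_fctr (R \<circ>\<^sub>F L) \<eta>"
    and counit_natural: "nat_trans B B (L \<circ>\<^sub>F R) id_fctr \<epsilon>"
    and triangle_left: "x \<in> Obj A \<Longrightarrow> \<epsilon> (FO L x) \<cdot>\<^bsub>B\<^esub> FA L (\<eta> x) = Id B (FO L x)"
    and triangle_right: "y \<in> Obj B \<Longrightarrow> FA R (\<epsilon> y) \<cdot>\<^bsub>A\<^esub> \<eta> (FO R y) = Id A (FO R y)"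

text \<open>\<open>R : B \<rightarrow> X\<close> with \<open>\<theta> : R K \<Rightarrow> G\<close> is a right Kan extension of \<open>G : A \<rightarrow> X\<close> along \<open>K : A \<rightarrow> B\<close>.
  Two families of components are equal as natural transformations when they agree on objects, hence the
  extensionality in the uniqueness clause.\<close>

definition right_kan_extension ::
    "('o1, 'a1) cat \<Rightarrow> ('o2, 'a2) cat \<Rightarrow> ('o3, 'a3) cat \<Rightarrow>
     ('o1, 'a1, 'o2, 'a2) fctr \<Rightarrow> ('o1, 'a1, 'o3, 'a3) fctr \<Rightarrow>
     ('o2, 'a2, 'o3, 'a3) fctr \<Rightarrow> ('o1 \<Rightarrow> 'a3) \<Rightarrow> bool" where
  "right_kan_extension A B X K G R \<theta> \<longleftrightarrow>
     cat_functor A B K \<and> cat_functor A X G \<and> cat_functor B X R \<and>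
     nat_trans A X (R \<circ>\<^sub>F K) G \<theta> \<and>
     (\<forall>F \<gamma>. cat_functor B X F \<and> nat_trans A X (F \<circ>\<^sub>F K) G \<gamma> \<longrightarrow>
        (\<exists>!\<alpha>. \<alpha> \<in> extensional (Obj B) \<and> nat_trans B X F R \<alpha> \<and>
              (\<forall>x \<in> Obj A. \<theta> x \<cdot>\<^bsub>X\<^esub> \<alpha> (FO K x) = \<gamma> x)))"


section \<open>Monadic functors\<close>

definition EM_algebras ::
    "('o, 'a) cat \<Rightarrow> ('o, 'a, 'o, 'a) fctr \<Rightarrow> ('o \<Rightarrow> 'a) \<Rightarrow> ('o \<Rightarrow> 'a) \<Rightarrow> ('o \<times> 'a) set" where
  "EM_algebras X T \<eta> \<mu> = {(x, a). x \<in> Obj X \<and> a \<in> hom X (FO T x) x \<and>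
     a \<cdot>\<^bsub>X\<^esub> \<eta> x = Id X x \<and> a \<cdot>\<^bsub>X\<^esub> FA T a = a \<cdot>\<^bsub>X\<^esub> \<mu> x}"

text \<open>The Eilenberg--Moore category; its arrows, like those of slice and arrow categories below, carry
  their domain and codomain.\<close>

definition EM_cat ::
    "('o, 'a) cat \<Rightarrow> ('o, 'a, 'o, 'a) fctr \<Rightarrow> ('o \<Rightarrow> 'a) \<Rightarrow> ('o \<Rightarrow> 'a) \<Rightarrow>
     ('o \<times> 'a, ('o \<times> 'a) \<times> 'a \<times> ('o \<times> 'a)) cat" where
  "EM_cat X T \<eta> \<mu> = \<lparr>
     Obj = EM_algebras X T \<eta> \<mu>,
     Arr = {((x, a), h, (y, b)). (x, a) \<in> EM_algebras X T \<eta> \<mu> \<and> (y, b) \<in> EM_algebras X T \<eta> \<mu> \<and>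
              h \<in> hom X x y \<and> h \<cdot>\<^bsub>X\<^esub> a = b \<cdot>\<^bsub>X\<^esub> FA T h},
     Dom = (\<lambda>(s, h, t). s),
     Cod = (\<lambda>(s, h, t). t),
     Id = (\<lambda>s. (s, Id X (fst s), s)),
     Comp = (\<lambda>(s', h', t') (s, h, t). (s, h' \<cdot>\<^bsub>X\<^esub> h, t'))\<rparr>"

definition EM_comparison ::
    "('o1, 'a1) cat \<Rightarrow> ('o1, 'a1, 'o2, 'a2) fctr \<Rightarrow> ('o1 \<Rightarrow> 'a1) \<Rightarrow>
     ('o1, 'a1, 'o2 \<times> 'a2, ('o2 \<times> 'a2) \<times> 'a2 \<times> ('o2 \<times> 'a2)) fctr" where
  "EM_comparison A G \<epsilon> = (let K = (\<lambda>x. (FO G x, FA G (\<epsilon> x))) in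
     \<lparr>FO = K, FA = (\<lambda>f. (K (Dom A f), FA G f, K (Cod A f)))\<rparr>)"

definition monadic_functor ::
    "('o1, 'a1) cat \<Rightarrow> ('o2, 'a2) cat \<Rightarrow> ('o1, 'a1, 'o2, 'a2) fctr \<Rightarrow> bool" where
  "monadic_functor A X G \<longleftrightarrow>
     (\<exists>L \<eta> \<epsilon>. adjunction X A L G \<eta> \<epsilon> \<and>
        equivalence_functor A (EM_cat X (G \<circ>\<^sub>F L) \<eta> (\<lambda>x. FA G (\<epsilon> (FO L x)))) (EM_comparison A G \<epsilon>))"


section \<open>Limits, zero objects, kernels\<close>

definition is_cone ::
    "('j, 'i) cat \<Rightarrow> ('o, 'a) cat \<Rightarrow> ('j, 'i, 'o, 'a) fctr \<Rightarrow> 'o \<Rightarrow> ('j \<Rightarrow> 'a) \<Rightarrow> bool" where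
  "is_cone J C D L l \<longleftrightarrow> L \<in> Obj C \<and> (\<forall>j \<in> Obj J. l j \<in> hom C L (FO D j)) \<and>
     (\<forall>i \<in> Arr J. FA D i \<cdot>\<^bsub>C\<^esub> l (Dom J i) = l (Cod J i))"

definition is_limit ::
    "('j, 'i) cat \<Rightarrow> ('o, 'a) cat \<Rightarrow> ('j, 'i, 'o, 'a) fctr \<Rightarrow> 'o \<Rightarrow> ('j \<Rightarrow> 'a) \<Rightarrow> bool" where
  "is_limit J C D L l \<longleftrightarrow> is_cone J C D L l \<and>
     (\<forall>M m. is_cone J C D M m \<longrightarrow> (\<exists>!h. h \<in> hom C M L \<and> (\<forall>j \<in> Obj J. l j \<cdot>\<^bsub>C\<^esub> h = m j)))"

text \<open>Every finite category is isomorphic to one whose objects and arrows are natural numbers.\<close>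

definition finitely_complete :: "('o, 'a) cat \<Rightarrow> bool" where
  "finitely_complete C \<longleftrightarrow>
     (\<forall>(J :: (nat, nat) cat) D. finite (Obj J) \<and> finite (Arr J) \<and> cat_functor J C D \<longrightarrow>
        (\<exists>L l. is_limit J C D L l))"

text \<open>\<open>p\<close> and \<open>q\<close> are the projections to the domains of \<open>f\<close> and \<open>g\<close>, so \<open>q\<close> is a pullback of \<open>f\<close> along
  \<open>g\<close>.\<close>

definition is_pullback :: "('o, 'a) cat \<Rightarrow> 'a \<Rightarrow> 'a \<Rightarrow> 'a \<Rightarrow> 'a \<Rightarrow> bool" where
  "is_pullback C f g p q \<longleftrightarrow>
     f \<in> Arr C \<and> g \<in> Arr C \<and> Cod C f = Cod C g \<and>
     p \<in> hom C (Dom C p) (Dom C f) \<and> q \<in> hom C (Dom C p) (Dom C g) \<and> f \<cdot>\<^bsub>C\<^esub> p = g \<cdot>\<^bsub>C\<^esub> q \<and>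
     (\<forall>T r s. r \<in> hom C T (Dom C f) \<and> s \<in> hom C T (Dom C g) \<and> f \<cdot>\<^bsub>C\<^esub> r = g \<cdot>\<^bsub>C\<^esub> s \<longrightarrow>
        (\<exists>!h. h \<in> hom C T (Dom C p) \<and> p \<cdot>\<^bsub>C\<^esub> h = r \<and> q \<cdot>\<^bsub>C\<^esub> h = s))"

definition pb :: "('o, 'a) cat \<Rightarrow> 'a \<Rightarrow> 'a \<Rightarrow> 'a \<times> 'a" where
  "pb C f g = (SOME pq. is_pullback C f g (fst pq) (snd pq))"

definition pullback_stable :: "('o, 'a) cat \<Rightarrow> 'a set \<Rightarrow> bool" where
  "pullback_stable C M \<longleftrightarrow>
     (\<forall>f \<in> M. \<forall>g \<in> Arr C. Cod C f = Cod C g \<longrightarrow>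
        (\<exists>p q. is_pullback C f g p q) \<and> (\<forall>p q. is_pullback C f g p q \<longrightarrow> q \<in> M))"

definition is_zero_object :: "('o, 'a) cat \<Rightarrow> 'o \<Rightarrow> bool" where
  "is_zero_object C Z \<longleftrightarrow> Z \<in> Obj C \<and>
     (\<forall>A \<in> Obj C. (\<exists>!f. f \<in> hom C Z A) \<and> (\<exists>!f. f \<in> hom C A Z))"

definition pointed :: "('o, 'a) cat \<Rightarrow> bool" where
  "pointed C \<longleftrightarrow> (\<exists>Z. is_zero_object C Z)"

definition zero_arr :: "('o, 'a) cat \<Rightarrow> 'o \<Rightarrow> 'o \<Rightarrow> 'a" where
  "zero_arr C A B = (THE f. \<exists>Z s t. is_zero_object C Z \<and> t \<in> hom C A Z \<and> s \<in> hom C Z B \<and>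
                       f = s \<cdot>\<^bsub>C\<^esub> t)"

definition is_kernel :: "('o, 'a) cat \<Rightarrow> 'a \<Rightarrow> 'a \<Rightarrow> bool" where
  "is_kernel C f k \<longleftrightarrow>
     f \<in> Arr C \<and> k \<in> hom C (Dom C k) (Dom C f) \<and>
     f \<cdot>\<^bsub>C\<^esub> k = zero_arr C (Dom C k) (Cod C f) \<and>
     (\<forall>T h. h \<in> hom C T (Dom C f) \<and> f \<cdot>\<^bsub>C\<^esub> h = zero_arr C T (Cod C f) \<longrightarrow>
        (\<exists>!l. l \<in> hom C T (Dom C k) \<and> k \<cdot>\<^bsub>C\<^esub> l = h))"

definition ker :: "('o, 'a) cat \<Rightarrow> 'a \<Rightarrow> 'a" where
  "ker C f = (SOME k. is_kernel C f k)"

text \<open>The intersection of two subobjects \<open>m\<close>, \<open>n\<close> of the same object, as an arrow into that object.\<close>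

definition intersection :: "('o, 'a) cat \<Rightarrow> 'a \<Rightarrow> 'a \<Rightarrow> 'a" where
  "intersection C m n = m \<cdot>\<^bsub>C\<^esub> fst (pb C m n)"


section \<open>Slice and arrow categories\<close>

definition slice :: "('o, 'a) cat \<Rightarrow> 'o \<Rightarrow> ('a, 'a \<times> 'a \<times> 'a) cat" where
  "slice C B = \<lparr>
     Obj = {f \<in> Arr C. Cod C f = B},
     Arr = {(f, h, g). f \<in> Arr C \<and> g \<in> Arr C \<and> Cod C f = B \<and> Cod C g = B \<and>
              h \<in> hom C (Dom C f) (Dom C g) \<and> g \<cdot>\<^bsub>C\<^esub> h = f},
     Dom = (\<lambda>(f, h, g). f),
     Cod = (\<lambda>(f, h, g). g),
     Id = (\<lambda>f. (f, Id C (Dom C f), f)),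
     Comp = (\<lambda>(f', h', g') (f, h, g). (f, h' \<cdot>\<^bsub>C\<^esub> h, g'))\<rparr>"

definition arrow_cat :: "('o, 'a) cat \<Rightarrow> ('a, 'a \<times> ('a \<times> 'a) \<times> 'a) cat" where
  "arrow_cat C = \<lparr>
     Obj = Arr C,
     Arr = {(p, (f, b), p'). p \<in> Arr C \<and> p' \<in> Arr C \<and>
              f \<in> hom C (Dom C p) (Dom C p') \<and> b \<in> hom C (Cod C p) (Cod C p') \<and>
              p' \<cdot>\<^bsub>C\<^esub> f = b \<cdot>\<^bsub>C\<^esub> p},
     Dom = (\<lambda>(p, fb, p'). p),
     Cod = (\<lambda>(p, fb, p'). p'),
     Id = (\<lambda>p. (p, (Id C (Dom C p), Id C (Cod C p)), p)),
     Comp = (\<lambda>(q, (g, c), q') (p, (f, b), p'). (p, (g \<cdot>\<^bsub>C\<^esub> f, c \<cdot>\<^bsub>C\<^esub> b), q'))\<rparr>"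

text \<open>The functor \<open>Cod\<close> from (a full subcategory of) the arrow category to \<open>C\<close>.\<close>

definition cod_fctr :: "('o, 'a) cat \<Rightarrow> ('a, 'a \<times> ('a \<times> 'a) \<times> 'a, 'o, 'a) fctr" where
  "cod_fctr C = \<lparr>FO = Cod C, FA = (\<lambda>(p, (f, b), p'). b)\<rparr>"

definition slice_fctr ::
    "('o1, 'a1, 'o2, 'a2) fctr \<Rightarrow> ('a1, 'a1 \<times> 'a1 \<times> 'a1, 'a2, 'a2 \<times> 'a2 \<times> 'a2) fctr" where
  "slice_fctr F = \<lparr>FO = FA F, FA = (\<lambda>(f, h, g). (FA F f, FA F h, FA F g))\<rparr>"

text \<open>The functor \<open>b\<^sup>*\<close> between slices over the codomain and over the domain of \<open>b\<close>.\<close>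

definition pullback_fctr ::
    "('o, 'a) cat \<Rightarrow> 'a \<Rightarrow> ('a, 'a \<times> 'a \<times> 'a, 'a, 'a \<times> 'a \<times> 'a) fctr" where
  "pullback_fctr C b = \<lparr>
     FO = (\<lambda>f. snd (pb C f b)),
     FA = (\<lambda>(f, h, g). (snd (pb C f b),
             (THE k. k \<in> hom C (Dom C (snd (pb C f b))) (Dom C (snd (pb C g b))) \<and>
                     fst (pb C g b) \<cdot>\<^bsub>C\<^esub> k = h \<cdot>\<^bsub>C\<^esub> fst (pb C f b) \<and>
                     snd (pb C g b) \<cdot>\<^bsub>C\<^esub> k = snd (pb C f b)),
             snd (pb C g b)))\<rparr>"


section \<open>Galois structures\<close>

record ('o, 'a, 'p, 'b) galois =
  gC :: "('o, 'a) cat"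
  gX :: "('p, 'b) cat"
  gH :: "('p, 'b, 'o, 'a) fctr"
  gI :: "('o, 'a, 'p, 'b) fctr"
  g\<eta> :: "'o \<Rightarrow> 'a"
  g\<epsilon> :: "'p \<Rightarrow> 'b"
  gE :: "'a set"
  gF :: "'b set"

definition arrow_class :: "('o, 'a) cat \<Rightarrow> 'a set \<Rightarrow> bool" where
  "arrow_class C M \<longleftrightarrow> M \<subseteq> Arr C \<and> {f. is_iso C f} \<subseteq> M \<and> pullback_stable C M \<and>
     (\<forall>f \<in> M. \<forall>g \<in> M. Cod C f = Dom C g \<longrightarrow> g \<cdot>\<^bsub>C\<^esub> f \<in> M)"

locale galois_structure =
  fixes \<Gamma> :: "('o, 'a, 'p, 'b) galois"
  assumes adj: "adjunction (gC \<Gamma>) (gX \<Gamma>) (gI \<Gamma>) (gH \<Gamma>) (g\<eta> \<Gamma>) (g\<epsilon> \<Gamma>)"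
    and E_class: "arrow_class (gC \<Gamma>) (gE \<Gamma>)"
    and F_class: "arrow_class (gX \<Gamma>) (gF \<Gamma>)"
    and H_F: "FA (gH \<Gamma>) ` gF \<Gamma> \<subseteq> gE \<Gamma>"
    and I_E: "FA (gI \<Gamma>) ` gE \<Gamma> \<subseteq> gF \<Gamma>"

definition fib_slice :: "('o, 'a, 'p, 'b) galois \<Rightarrow> 'o \<Rightarrow> ('a, 'a \<times> 'a \<times> 'a) cat" where
  "fib_slice \<Gamma> B = full_sub (slice (gC \<Gamma>) B) (gE \<Gamma>)"

definition fib_slice_X :: "('o, 'a, 'p, 'b) galois \<Rightarrow> 'p \<Rightarrow> ('b, 'b \<times> 'b \<times> 'b) cat" where
  "fib_slice_X \<Gamma> X = full_sub (slice (gX \<Gamma>) X) (gF \<Gamma>)"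

definition H_at ::
    "('o, 'a, 'p, 'b) galois \<Rightarrow> 'o \<Rightarrow> ('b, 'b \<times> 'b \<times> 'b, 'a, 'a \<times> 'a \<times> 'a) fctr" where
  "H_at \<Gamma> B = pullback_fctr (gC \<Gamma>) (g\<eta> \<Gamma> B) \<circ>\<^sub>F slice_fctr (gH \<Gamma>)"

definition admissible :: "('o, 'a, 'p, 'b) galois \<Rightarrow> bool" where
  "admissible \<Gamma> \<longleftrightarrow> (\<forall>B \<in> Obj (gC \<Gamma>).
     full_functor (fib_slice_X \<Gamma> (FO (gI \<Gamma>) B)) (fib_slice \<Gamma> B) (H_at \<Gamma> B) \<and>
     faithful_functor (fib_slice_X \<Gamma> (FO (gI \<Gamma>) B)) (H_at \<Gamma> B))"

definition trivial_covering :: "('o, 'a, 'p, 'b) galois \<Rightarrow> 'a \<Rightarrow> bool" where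
  "trivial_covering \<Gamma> f \<longleftrightarrow> f \<in> gE \<Gamma> \<and>
     is_pullback (gC \<Gamma>) (FA (gH \<Gamma>) (FA (gI \<Gamma>) f)) (g\<eta> \<Gamma> (Cod (gC \<Gamma>) f)) (g\<eta> \<Gamma> (Dom (gC \<Gamma>) f)) f"

definition monadic_extension :: "('o, 'a, 'p, 'b) galois \<Rightarrow> 'a \<Rightarrow> bool" where
  "monadic_extension \<Gamma> p \<longleftrightarrow> p \<in> gE \<Gamma> \<and>
     monadic_functor (fib_slice \<Gamma> (Cod (gC \<Gamma>) p)) (fib_slice \<Gamma> (Dom (gC \<Gamma>) p))
       (pullback_fctr (gC \<Gamma>) p)"

definition normal_extension :: "('o, 'a, 'p, 'b) galois \<Rightarrow> 'a \<Rightarrow> bool" where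
  "normal_extension \<Gamma> p \<longleftrightarrow> monadic_extension \<Gamma> p \<and>
     trivial_covering \<Gamma> (FO (pullback_fctr (gC \<Gamma>) p) p)"

definition Ext :: "('o, 'a, 'p, 'b) galois \<Rightarrow> ('a, 'a \<times> ('a \<times> 'a) \<times> 'a) cat" where
  "Ext \<Gamma> = full_sub (arrow_cat (gC \<Gamma>)) {p. monadic_extension \<Gamma> p}"

definition NExt :: "('o, 'a, 'p, 'b) galois \<Rightarrow> ('a, 'a \<times> ('a \<times> 'a) \<times> 'a) cat" where
  "NExt \<Gamma> = full_sub (arrow_cat (gC \<Gamma>)) {p. normal_extension \<Gamma> p}"

definition weakly_universal :: "('o, 'a, 'p, 'b) galois \<Rightarrow> 'o \<Rightarrow> 'a \<Rightarrow> bool" where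
  "weakly_universal \<Gamma> B u \<longleftrightarrow> normal_extension \<Gamma> u \<and> Cod (gC \<Gamma>) u = B \<and>
     (\<forall>p. normal_extension \<Gamma> p \<and> Cod (gC \<Gamma>) p = B \<longrightarrow>
        (\<exists>e \<in> hom (gC \<Gamma>) (Dom (gC \<Gamma>) u) (Dom (gC \<Gamma>) p). p \<cdot>\<^bsub>gC \<Gamma>\<^esub> e = u))"


section \<open>Kernels, Galois groups and the fundamental group\<close>

text \<open>From here on \<open>H\<close> is understood to be the inclusion of a full subcategory and is suppressed. As that
  subcategory need not be closed under isomorphisms, the kernel of a normal extension is chosen with
  domain in \<open>X\<close>.\<close>

definition nker :: "('o, 'a, 'o, 'a) galois \<Rightarrow> 'a \<Rightarrow> 'a" where
  "nker \<Gamma> p = (SOME k. is_kernel (gC \<Gamma>) p k \<and> Dom (gC \<Gamma>) k \<in> Obj (gX \<Gamma>))"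

definition Ker_fctr ::
    "('o, 'a, 'o, 'a) galois \<Rightarrow> ('a, 'a \<times> ('a \<times> 'a) \<times> 'a, 'o, 'a) fctr" where
  "Ker_fctr \<Gamma> = \<lparr>
     FO = (\<lambda>p. Dom (gC \<Gamma>) (nker \<Gamma> p)),
     FA = (\<lambda>(p, (f, b), p'). THE k. k \<in> hom (gX \<Gamma>) (Dom (gC \<Gamma>) (nker \<Gamma> p)) (Dom (gC \<Gamma>) (nker \<Gamma> p')) \<and>
             nker \<Gamma> p' \<cdot>\<^bsub>gC \<Gamma>\<^esub> k = f \<cdot>\<^bsub>gC \<Gamma>\<^esub> nker \<Gamma> p)\<rparr>"

definition kp_fst :: "('o, 'a, 'p, 'b) galois \<Rightarrow> 'a \<Rightarrow> 'a" where
  "kp_fst \<Gamma> p = fst (pb (gC \<Gamma>) p p)"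

definition kp_snd :: "('o, 'a, 'p, 'b) galois \<Rightarrow> 'a \<Rightarrow> 'a" where
  "kp_snd \<Gamma> p = snd (pb (gC \<Gamma>) p p)"

definition Eq_obj :: "('o, 'a, 'p, 'b) galois \<Rightarrow> 'a \<Rightarrow> 'o" where
  "Eq_obj \<Gamma> p = Dom (gC \<Gamma>) (kp_fst \<Gamma> p)"

definition Eq_arr :: "('o, 'a, 'p, 'b) galois \<Rightarrow> 'a \<Rightarrow> 'a \<Rightarrow> 'a \<Rightarrow> 'a" where
  "Eq_arr \<Gamma> p f p' = (THE e. e \<in> hom (gC \<Gamma>) (Eq_obj \<Gamma> p) (Eq_obj \<Gamma> p') \<and>
     kp_fst \<Gamma> p' \<cdot>\<^bsub>gC \<Gamma>\<^esub> e = f \<cdot>\<^bsub>gC \<Gamma>\<^esub> kp_fst \<Gamma> p \<and>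
     kp_snd \<Gamma> p' \<cdot>\<^bsub>gC \<Gamma>\<^esub> e = f \<cdot>\<^bsub>gC \<Gamma>\<^esub> kp_snd \<Gamma> p)"

text \<open>The inclusion of \<open>Ker(I(d)) \<inter> Ker(I(c))\<close>, the underlying object of the Galois group of \<open>p\<close>, into
  \<open>I(Eq(p))\<close>; kernels and intersection are formed in \<open>X\<close>. The group structure plays no role in \<open>\<pi>\<^sub>1\<close> and
  \<open>\<delta>\<close>, which involve only the underlying-object functor.\<close>

definition gal_incl :: "('o, 'a, 'p, 'b) galois \<Rightarrow> 'a \<Rightarrow> 'b" where
  "gal_incl \<Gamma> p = intersection (gX \<Gamma>) (ker (gX \<Gamma>) (FA (gI \<Gamma>) (kp_fst \<Gamma> p)))
                                    (ker (gX \<Gamma>) (FA (gI \<Gamma>) (kp_snd \<Gamma> p)))"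

definition Gal_fctr ::
    "('o, 'a, 'p, 'b) galois \<Rightarrow> ('a, 'a \<times> ('a \<times> 'a) \<times> 'a, 'p, 'b) fctr" where
  "Gal_fctr \<Gamma> = \<lparr>
     FO = (\<lambda>p. Dom (gX \<Gamma>) (gal_incl \<Gamma> p)),
     FA = (\<lambda>(p, (f, b), p').
             THE g. g \<in> hom (gX \<Gamma>) (Dom (gX \<Gamma>) (gal_incl \<Gamma> p)) (Dom (gX \<Gamma>) (gal_incl \<Gamma> p')) \<and>
                    gal_incl \<Gamma> p' \<cdot>\<^bsub>gX \<Gamma>\<^esub> g = FA (gI \<Gamma>) (Eq_arr \<Gamma> p f p') \<cdot>\<^bsub>gX \<Gamma>\<^esub> gal_incl \<Gamma> p)\<rparr>"

text \<open>The inclusion \<open>Ker(p) \<inter> Ker(\<eta>\<^sub>E) \<rightarrow> Ker(p)\<close>.\<close>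

definition ker_unit_incl :: "('o, 'a, 'o, 'a) galois \<Rightarrow> 'a \<Rightarrow> 'a" where
  "ker_unit_incl \<Gamma> p = fst (pb (gC \<Gamma>) (nker \<Gamma> p) (ker (gC \<Gamma>) (g\<eta> \<Gamma> (Dom (gC \<Gamma>) p))))"

text \<open>\<open>\<langle>0, ker p\<rangle> : Ker(p) \<rightarrow> Eq(p)\<close>.\<close>

definition zero_ker_pair :: "('o, 'a, 'o, 'a) galois \<Rightarrow> 'a \<Rightarrow> 'a" where
  "zero_ker_pair \<Gamma> p = (THE s. s \<in> hom (gC \<Gamma>) (Dom (gC \<Gamma>) (nker \<Gamma> p)) (Eq_obj \<Gamma> p) \<and>
     kp_fst \<Gamma> p \<cdot>\<^bsub>gC \<Gamma>\<^esub> s = zero_arr (gC \<Gamma>) (Dom (gC \<Gamma>) (nker \<Gamma> p)) (Dom (gC \<Gamma>) p) \<and>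
     kp_snd \<Gamma> p \<cdot>\<^bsub>gC \<Gamma>\<^esub> s = nker \<Gamma> p)"

text \<open>The canonical isomorphism from \<open>Ker(p) \<inter> Ker(\<eta>\<^sub>E)\<close> to the underlying object of the Galois group.\<close>

definition gal_iso :: "('o, 'a, 'o, 'a) galois \<Rightarrow> 'a \<Rightarrow> 'a" where
  "gal_iso \<Gamma> p = (THE \<phi>. \<phi> \<in> hom (gC \<Gamma>) (Dom (gC \<Gamma>) (ker_unit_incl \<Gamma> p)) (FO (Gal_fctr \<Gamma>) p) \<and>
     gal_incl \<Gamma> p \<cdot>\<^bsub>gC \<Gamma>\<^esub> \<phi> =
       (g\<eta> \<Gamma> (Eq_obj \<Gamma> p) \<cdot>\<^bsub>gC \<Gamma>\<^esub> zero_ker_pair \<Gamma> p) \<cdot>\<^bsub>gC \<Gamma>\<^esub> ker_unit_incl \<Gamma> p)"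

definition gal_iota :: "('o, 'a, 'o, 'a) galois \<Rightarrow> 'a \<Rightarrow> 'a" where
  "gal_iota \<Gamma> p = ker_unit_incl \<Gamma> p \<cdot>\<^bsub>gC \<Gamma>\<^esub> inverse_arr (gC \<Gamma>) (gal_iso \<Gamma> p)"

text \<open>In the remaining definitions \<open>u\<close> assigns to each object \<open>B\<close> the chosen weakly universal normal
  extension of \<open>B\<close>. The choices of \<open>g\<close> and \<open>h\<close> are immaterial, as morphisms of normal extensions with the
  same codomain component induce the same morphism of Galois groups.\<close>

definition pi1 :: "('o, 'a, 'p, 'b) galois \<Rightarrow> ('o \<Rightarrow> 'a) \<Rightarrow> ('o, 'a, 'p, 'b) fctr" where
  "pi1 \<Gamma> u = \<lparr>
     FO = (\<lambda>B. FO (Gal_fctr \<Gamma>) (u B)),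
     FA = (\<lambda>f. let v = u (Dom (gC \<Gamma>) f); w = u (Cod (gC \<Gamma>) f)
                in FA (Gal_fctr \<Gamma>) (v, (SOME g. (v, (g, f), w) \<in> Arr (NExt \<Gamma>), f), w))\<rparr>"

definition kappa :: "('o, 'a, 'p, 'b) galois \<Rightarrow> ('o \<Rightarrow> 'a) \<Rightarrow> 'a \<Rightarrow> 'b" where
  "kappa \<Gamma> u p = (let B = Cod (gC \<Gamma>) p
     in FA (Gal_fctr \<Gamma>)
          (u B, (SOME h. (u B, (h, Id (gC \<Gamma>) B), p) \<in> Arr (NExt \<Gamma>), Id (gC \<Gamma>) B), p))"

definition delta :: "('o, 'a, 'o, 'a) galois \<Rightarrow> ('o \<Rightarrow> 'a) \<Rightarrow> 'a \<Rightarrow> 'a" where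
  "delta \<Gamma> u p = gal_iota \<Gamma> p \<cdot>\<^bsub>gX \<Gamma>\<^esub> kappa \<Gamma> u p"

end

theory Submission
  imports Defs
begin

text \<open>
  Let \<open>p : E \<rightarrow> B\<close> be a normal extension with kernel pair \<open>d, c : Eq p \<rightarrow> E\<close>. An element of \<open>I (Eq p)\<close> killed by \<open>I d\<close> and
  by \<open>I c\<close> lifts along the trivial covering \<open>d\<close> to a pair \<open>(0, e)\<close>, and \<open>e\<close> is killed by \<open>p\<close> and by \<open>\<eta>\<^sub>E\<close>. In this
  way the Galois group of \<open>p\<close> becomes the subobject of \<open>E\<close> of all elements killed by \<open>p\<close> and \<open>\<eta>\<^sub>E\<close>
  (\<open>gal_lift\<close>, \<open>gal_iso\<close>, \<open>gal_iota\<close>), and \<open>\<iota>\<close> is its inclusion into \<open>Ker p\<close>, a monomorphism. A morphism \<open>(f, b)\<close> of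
  normal extensions acts on it by \<open>f\<close> (\<open>Gal_arr\<close>), and this action depends on \<open>b\<close> only (\<open>Gal_arr_cod_only\<close>).
  Functoriality of \<open>\<pi>\<^sub>1\<close> and naturality of \<open>\<delta>\<close> follow.

  Let \<open>\<gamma> : F Cod \<Rightarrow> Ker\<close> be natural on normal extensions, and let \<open>u : U \<rightarrow> B\<close> be weakly universal. The arrow \<open>I U \<rightarrow> 0\<close> is a
  normal extension. The component of \<open>\<gamma>\<close> there vanishes, because the endomorphism \<open>(0, 1)\<close> of \<open>I U \<rightarrow> 0\<close>
  induces zero on the kernel and the identity on \<open>F 0\<close>. Naturality at \<open>(\<eta>\<^sub>U, 0) : u \<rightarrow> (I U \<rightarrow> 0)\<close> then shows that
  \<open>\<eta>\<^sub>U\<close> kills \<open>\<gamma>\<^sub>u\<close>, so \<open>\<gamma>\<^sub>u\<close> factors uniquely through the Galois group of \<open>u\<close>, which is \<open>\<pi>\<^sub>1 B\<close>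
  (\<open>component_factors\<close>). These factorisations are the required \<open>\<alpha>\<close>: the other components of \<open>\<gamma>\<close> are determined
  by those at weakly universal extensions (\<open>kan_existence_normal\<close>). For arbitrary monadic extensions,
  \<open>\<gamma> : F Cod \<Rightarrow> Ker I\<^sub>1\<close> is restricted to normal extensions along the counit of \<open>I\<^sub>1\<close>; as unit and
  counit lie over identities, a triangle identity recovers \<open>\<gamma>\<close> from its restriction (\<open>kan_extension\<close>).

  Two properties of the Galois structure enter. First, \<open>I U \<rightarrow> 0\<close> is monadic since it is split, and pulling back
  along a split fibration is monadic: the structure map of an algebra transports every fibre to the fibre over
  the section (\<open>monadic_pullback_split\<close>). Secondly, normal extensions are stable under pullback
  (\<open>normal_extension_stable\<close>), which makes \<open>u\<close> map to every normal extension over any arrow of the base. This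
  needs trivial coverings to be pullback-stable, and there the full faithfulness of the functors \<open>H\<^sup>B\<close>
  is used (\<open>pullback_along_unit_trivial\<close>).\<close>

section \<open>Composition and pullbacks\<close>

lemma in_hom_iff: "f \<in> hom C A B \<longleftrightarrow> f \<in> Arr C \<and> Dom C f = A \<and> Cod C f = B"
  by (auto simp: hom_def)

context category
begin

lemmas [simp] = dom_obj cod_obj

lemma id_arr [simp]: "A \<in> Obj C \<Longrightarrow> Id C A \<in> Arr C"
  and dom_id [simp]: "A \<in> Obj C \<Longrightarrow> Dom C (Id C A) = A"
  and cod_id [simp]: "A \<in> Obj C \<Longrightarrow> Cod C (Id C A) = A"
  using id_hom by (auto simp: in_hom_iff)

lemma comp_arr [simp]: "f \<in> Arr C \<Longrightarrow> g \<in> Arr C \<Longrightarrow> Cod C f = Dom C g \<Longrightarrow> g \<cdot>\<^bsub>C\<^esub> f \<in> Arr C"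
  and dom_comp [simp]: "f \<in> Arr C \<Longrightarrow> g \<in> Arr C \<Longrightarrow> Cod C f = Dom C g \<Longrightarrow> Dom C (g \<cdot>\<^bsub>C\<^esub> f) = Dom C f"
  and cod_comp [simp]: "f \<in> Arr C \<Longrightarrow> g \<in> Arr C \<Longrightarrow> Cod C f = Dom C g \<Longrightarrow> Cod C (g \<cdot>\<^bsub>C\<^esub> f) = Cod C g"
  using comp_hom[of f "Dom C f" "Cod C f" g "Cod C g"] by (auto simp: in_hom_iff)

lemma id_comp [simp]: "f \<in> Arr C \<Longrightarrow> Cod C f = B \<Longrightarrow> Id C B \<cdot>\<^bsub>C\<^esub> f = f"
  and comp_id [simp]: "f \<in> Arr C \<Longrightarrow> Dom C f = A \<Longrightarrow> f \<cdot>\<^bsub>C\<^esub> Id C A = f"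
  using id_left id_right by (auto simp: in_hom_iff)

lemma comp_assoc [simp]:
  "f \<in> Arr C \<Longrightarrow> g \<in> Arr C \<Longrightarrow> h \<in> Arr C \<Longrightarrow> Cod C f = Dom C g \<Longrightarrow> Cod C g = Dom C h \<Longrightarrow>
    (h \<cdot>\<^bsub>C\<^esub> g) \<cdot>\<^bsub>C\<^esub> f = h \<cdot>\<^bsub>C\<^esub> (g \<cdot>\<^bsub>C\<^esub> f)"
  using assoc by (simp add: in_hom_iff)

text \<open>Composites are kept associated to the right, so an equation between composites of length two has
  to be offered to the simplifier in this form as well.\<close>

lemma comp_eq_extend:
  assumes "g \<cdot>\<^bsub>C\<^esub> f = k" "f \<in> Arr C" "g \<in> Arr C" "Cod C f = Dom C g" "x \<in> Arr C" "Cod C x = Dom C f"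
  shows "g \<cdot>\<^bsub>C\<^esub> (f \<cdot>\<^bsub>C\<^esub> x) = k \<cdot>\<^bsub>C\<^esub> x"
  using assms comp_assoc by metis

lemma is_inverse_unique: "is_inverse C f g \<Longrightarrow> is_inverse C f g' \<Longrightarrow> g = g'"
proof -
  assume g: "is_inverse C f g" and g': "is_inverse C f g'"
  have "g = (g' \<cdot>\<^bsub>C\<^esub> f) \<cdot>\<^bsub>C\<^esub> g" using g g' by (simp add: is_inverse_def in_hom_iff del: comp_assoc)
  also have "\<dots> = g' \<cdot>\<^bsub>C\<^esub> (f \<cdot>\<^bsub>C\<^esub> g)"
    by (rule comp_assoc) (use g g' in \<open>auto simp: is_inverse_def in_hom_iff\<close>)
  also have "\<dots> = g'" using g g' by (simp add: is_inverse_def in_hom_iff)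
  finally show "g = g'" .
qed

lemma inverse_arr_eq: "is_inverse C f g \<Longrightarrow> inverse_arr C f = g"
  unfolding inverse_arr_def using is_inverse_unique by blast

end

lemma is_pullbackD:
  assumes "is_pullback C f g p q"
  shows "f \<in> Arr C" "g \<in> Arr C" "Cod C f = Cod C g" "p \<in> Arr C" "q \<in> Arr C" "Dom C q = Dom C p"
    "Cod C p = Dom C f" "Cod C q = Dom C g" "f \<cdot>\<^bsub>C\<^esub> p = g \<cdot>\<^bsub>C\<^esub> q"
  using assms unfolding is_pullback_def in_hom_iff by blast+

lemma is_pullback_factor:
  assumes "is_pullback C f g p q" "r \<in> hom C T (Dom C f)" "s \<in> hom C T (Dom C g)"
    "f \<cdot>\<^bsub>C\<^esub> r = g \<cdot>\<^bsub>C\<^esub> s"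
  obtains h where "h \<in> hom C T (Dom C p)" "p \<cdot>\<^bsub>C\<^esub> h = r" "q \<cdot>\<^bsub>C\<^esub> h = s"
  using assms unfolding is_pullback_def by metis

context category
begin

lemma is_pullback_jointly_monic:
  assumes pb: "is_pullback C f g p q" and h: "h \<in> hom C T (Dom C p)" "h' \<in> hom C T (Dom C p)"
    and eq: "p \<cdot>\<^bsub>C\<^esub> h = p \<cdot>\<^bsub>C\<^esub> h'" "q \<cdot>\<^bsub>C\<^esub> h = q \<cdot>\<^bsub>C\<^esub> h'"
  shows "h = h'"
proof -
  let ?r = "p \<cdot>\<^bsub>C\<^esub> h" and ?s = "q \<cdot>\<^bsub>C\<^esub> h"
  note pq = is_pullbackD[OF pb]
  have "?r \<in> hom C T (Dom C f)" "?s \<in> hom C T (Dom C g)"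
    using h pq by (auto simp: in_hom_iff)
  moreover have "f \<cdot>\<^bsub>C\<^esub> ?r = g \<cdot>\<^bsub>C\<^esub> ?s"
    using comp_assoc[of h p f] comp_assoc[of h q g] h pq by (simp add: in_hom_iff)
  ultimately have "\<exists>!h. h \<in> hom C T (Dom C p) \<and> p \<cdot>\<^bsub>C\<^esub> h = ?r \<and> q \<cdot>\<^bsub>C\<^esub> h = ?s"
    using pb by (auto simp: is_pullback_def)
  then show "h = h'" using h eq by metis
qed

lemma is_pullbackI:
  assumes "f \<in> Arr C" "g \<in> Arr C" "Cod C f = Cod C g" "p \<in> Arr C" "q \<in> Arr C"
    "Dom C q = Dom C p" "Cod C p = Dom C f" "Cod C q = Dom C g" "f \<cdot>\<^bsub>C\<^esub> p = g \<cdot>\<^bsub>C\<^esub> q"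
    and ex: "\<And>T r s. r \<in> hom C T (Dom C f) \<Longrightarrow> s \<in> hom C T (Dom C g) \<Longrightarrow> f \<cdot>\<^bsub>C\<^esub> r = g \<cdot>\<^bsub>C\<^esub> s \<Longrightarrow>
      \<exists>h. h \<in> hom C T (Dom C p) \<and> p \<cdot>\<^bsub>C\<^esub> h = r \<and> q \<cdot>\<^bsub>C\<^esub> h = s"
    and un: "\<And>T h h'. h \<in> hom C T (Dom C p) \<Longrightarrow> h' \<in> hom C T (Dom C p) \<Longrightarrow> p \<cdot>\<^bsub>C\<^esub> h = p \<cdot>\<^bsub>C\<^esub> h' \<Longrightarrow>
      q \<cdot>\<^bsub>C\<^esub> h = q \<cdot>\<^bsub>C\<^esub> h' \<Longrightarrow> h = h'"
  shows "is_pullback C f g p q"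
  unfolding is_pullback_def
proof (intro conjI allI impI)
  fix T r s
  assume "r \<in> hom C T (Dom C f) \<and> s \<in> hom C T (Dom C g) \<and> f \<cdot>\<^bsub>C\<^esub> r = g \<cdot>\<^bsub>C\<^esub> s"
  then obtain h where h: "h \<in> hom C T (Dom C p)" "p \<cdot>\<^bsub>C\<^esub> h = r" "q \<cdot>\<^bsub>C\<^esub> h = s" using ex by blast
  then show "\<exists>!h. h \<in> hom C T (Dom C p) \<and> p \<cdot>\<^bsub>C\<^esub> h = r \<and> q \<cdot>\<^bsub>C\<^esub> h = s"
    by (intro ex1I[of _ h] conjI h, elim conjE) (rule un; simp)
qed (simp_all only: in_hom_iff assms(1-9) simp_thms)

end

lemma pb_is_pullback: "\<exists>p q. is_pullback C f g p q \<Longrightarrow> is_pullback C f g (fst (pb C f g)) (snd (pb C f g))"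
proof -
  assume "\<exists>p q. is_pullback C f g p q"
  then have "\<exists>pq. is_pullback C f g (fst pq) (snd pq)" by simp
  then show ?thesis unfolding pb_def by (rule someI_ex)
qed

text \<open>The arrows \<open>3\<close> and \<open>4\<close> are the legs of the cospan; an object serves as its own identity.\<close>

definition cospan_shape :: "(nat, nat) cat" where
  "cospan_shape = \<lparr>Obj = {0, 1, 2}, Arr = {0, 1, 2, 3, 4},
     Dom = (\<lambda>i. if i = 3 then 0 else if i = 4 then 1 else i),
     Cod = (\<lambda>i. if i \<ge> 3 then 2 else i),
     Id = (\<lambda>x. x),
     Comp = (\<lambda>j i. if j < 3 then i else j)\<rparr>"

lemma category_cospan_shape: "category cospan_shape"
  apply (rule category.intro)
  apply (simp add: cospan_shape_def; elim disjE; simp)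
  apply (simp add: cospan_shape_def; elim disjE; simp)
  apply (simp add: cospan_shape_def hom_def; elim disjE; simp)
  apply (simp only: cospan_shape_def hom_def cat.simps mem_Collect_eq)
  apply (elim conjE insertE emptyE; simp split: if_splits)
  apply (simp_all add: cospan_shape_def hom_def split: if_splits)
  done

lemma (in category) finitely_complete_pullback:
  assumes fc: "finitely_complete C" and fg: "f \<in> Arr C" "g \<in> Arr C" "Cod C f = Cod C g"
  shows "\<exists>p q. is_pullback C f g p q"
proof -
  define D :: "(nat, nat, 'o, 'a) fctr" where
    "D = \<lparr>FO = (\<lambda>i. if i = 0 then Dom C f else if i = 1 then Dom C g else Cod C f),
          FA = (\<lambda>i. if i = 0 then Id C (Dom C f) else if i = 1 then Id C (Dom C g)
                    else if i = 2 then Id C (Cod C f) else if i = 3 then f else g)\<rparr>"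
  have D: "cat_functor cospan_shape C D"
  proof (rule cat_functor.intro)
    fix x y z i j
    show "category cospan_shape" by (fact category_cospan_shape)
    show "category C" by unfold_locales
    show "FO D x \<in> Obj C" if "x \<in> Obj cospan_shape"
      using that fg by (auto simp: cospan_shape_def D_def)
    show "FA D i \<in> hom C (FO D x) (FO D y)" if "i \<in> hom cospan_shape x y"
      using that fg by (auto simp: cospan_shape_def D_def hom_def split: if_splits)
    show "FA D (Id cospan_shape x) = Id C (FO D x)" if "x \<in> Obj cospan_shape"
      using that fg by (auto simp: cospan_shape_def D_def)
    show "FA D (j \<cdot>\<^bsub>cospan_shape\<^esub> i) = FA D j \<cdot>\<^bsub>C\<^esub> FA D i"
      if "i \<in> hom cospan_shape x y" "j \<in> hom cospan_shape y z"
      using that fg by (auto simp: cospan_shape_def D_def hom_def split: if_splits)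
  qed
  have cone: "is_cone cospan_shape C D L l \<longleftrightarrow>
      L \<in> Obj C \<and> l 0 \<in> hom C L (Dom C f) \<and> l 1 \<in> hom C L (Dom C g) \<and> l 2 \<in> hom C L (Cod C f) \<and>
      f \<cdot>\<^bsub>C\<^esub> l 0 = l 2 \<and> g \<cdot>\<^bsub>C\<^esub> l 1 = l 2" for L l
    using fg by (auto simp: is_cone_def cospan_shape_def D_def hom_def)
  have "finite (Obj cospan_shape)" "finite (Arr cospan_shape)" by (auto simp: cospan_shape_def)
  then obtain L l where lim: "is_limit cospan_shape C D L l"
    using fc D unfolding finitely_complete_def by blast
  then have l: "l 0 \<in> hom C L (Dom C f)" "l 1 \<in> hom C L (Dom C g)" "l 2 \<in> hom C L (Cod C f)"
    "f \<cdot>\<^bsub>C\<^esub> l 0 = l 2" "g \<cdot>\<^bsub>C\<^esub> l 1 = l 2"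
    unfolding is_limit_def cone by blast+
  have univ: "\<exists>!h. h \<in> hom C T L \<and> l 0 \<cdot>\<^bsub>C\<^esub> h = r \<and> l 1 \<cdot>\<^bsub>C\<^esub> h = s"
    if rs: "r \<in> hom C T (Dom C f)" "s \<in> hom C T (Dom C g)" "f \<cdot>\<^bsub>C\<^esub> r = g \<cdot>\<^bsub>C\<^esub> s" for T r s
  proof -
    define m where "m = (\<lambda>i. if i = 0 then r else if i = (1::nat) then s else f \<cdot>\<^bsub>C\<^esub> r)"
    have "is_cone cospan_shape C D T m"
      using rs fg dom_obj[of r] unfolding cone by (auto simp: m_def in_hom_iff)
    then have "\<exists>!h. h \<in> hom C T L \<and> (\<forall>j \<in> Obj cospan_shape. l j \<cdot>\<^bsub>C\<^esub> h = m j)"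
      using lim unfolding is_limit_def by blast
    moreover have eq: "(\<forall>j \<in> Obj cospan_shape. l j \<cdot>\<^bsub>C\<^esub> h = m j) \<longleftrightarrow> l 0 \<cdot>\<^bsub>C\<^esub> h = r \<and> l 1 \<cdot>\<^bsub>C\<^esub> h = s"
      if "h \<in> hom C T L" for h
    proof -
      have "l 2 \<cdot>\<^bsub>C\<^esub> h = f \<cdot>\<^bsub>C\<^esub> (l 0 \<cdot>\<^bsub>C\<^esub> h)"
        using l fg that comp_assoc[of h "l 0" f] by (simp add: in_hom_iff)
      then show ?thesis by (auto simp: m_def cospan_shape_def)
    qed
    ultimately show ?thesis by (simp cong: conj_cong)
  qed
  have "is_pullback C f g (l 0) (l 1)"
    unfolding is_pullback_def using l fg univ by (simp add: in_hom_iff)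
  then show ?thesis by blast
qed

section \<open>Zero arrows and kernels\<close>

lemma (in category) zero_arr_eq:
  assumes Z: "is_zero_object C Z" and t: "t \<in> hom C A Z" and s: "s \<in> hom C Z B"
  shows "zero_arr C A B = s \<cdot>\<^bsub>C\<^esub> t"
  unfolding zero_arr_def
proof (rule the_equality)
  show "\<exists>Z s' t'. is_zero_object C Z \<and> t' \<in> hom C A Z \<and> s' \<in> hom C Z B \<and> s \<cdot>\<^bsub>C\<^esub> t = s' \<cdot>\<^bsub>C\<^esub> t'"
    using assms by blast
next
  fix f
  assume "\<exists>Z s t. is_zero_object C Z \<and> t \<in> hom C A Z \<and> s \<in> hom C Z B \<and> f = s \<cdot>\<^bsub>C\<^esub> t"
  then obtain Z' s' t' where Z': "is_zero_object C Z'" "t' \<in> hom C A Z'" "s' \<in> hom C Z' B"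
    and f: "f = s' \<cdot>\<^bsub>C\<^esub> t'" by blast
  obtain i where i: "i \<in> hom C Z Z'" using Z Z' by (auto simp: is_zero_object_def)
  have AB: "A \<in> Obj C" "B \<in> Obj C" using t s by (auto simp: in_hom_iff)
  have it: "i \<cdot>\<^bsub>C\<^esub> t \<in> hom C A Z'" using i t by (auto simp: in_hom_iff)
  have "i \<cdot>\<^bsub>C\<^esub> t = t'" using it Z' AB unfolding is_zero_object_def by blast
  moreover have "s' \<cdot>\<^bsub>C\<^esub> i \<in> hom C Z B" using i Z' by (auto simp: in_hom_iff)
  then have "s' \<cdot>\<^bsub>C\<^esub> i = s" using s Z AB unfolding is_zero_object_def by blast
  ultimately show "f = s \<cdot>\<^bsub>C\<^esub> t" using f i t Z' by (auto simp: in_hom_iff)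
qed

locale pointed_category = category C for C :: "('o, 'a) cat" (structure) +
  assumes pointed: "pointed C"
begin

lemma zero_arr_factors:
  assumes "A \<in> Obj C" "B \<in> Obj C"
  obtains Z s t where "is_zero_object C Z" "t \<in> hom C A Z" "s \<in> hom C Z B"
    "zero_arr C A B = s \<cdot> t"
proof -
  obtain Z where Z: "is_zero_object C Z" using pointed by (auto simp: pointed_def)
  obtain t where t: "t \<in> hom C A Z" using Z assms unfolding is_zero_object_def by blast
  obtain s where s: "s \<in> hom C Z B" using Z assms unfolding is_zero_object_def by blast
  show thesis using that Z t s zero_arr_eq[OF Z t s] by blast
qed

lemma zero_arr_arr [simp]: "A \<in> Obj C \<Longrightarrow> B \<in> Obj C \<Longrightarrow> zero_arr C A B \<in> Arr C"
  and dom_zero_arr [simp]: "A \<in> Obj C \<Longrightarrow> B \<in> Obj C \<Longrightarrow> Dom C (zero_arr C A B) = A"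
  and cod_zero_arr [simp]: "A \<in> Obj C \<Longrightarrow> B \<in> Obj C \<Longrightarrow> Cod C (zero_arr C A B) = B"
  by (rule zero_arr_factors[of A B]; simp add: in_hom_iff)+

lemma comp_zero [simp]:
  assumes "f \<in> Arr C" "A \<in> Obj C" "Dom C f = B"
  shows "f \<cdot> zero_arr C A B = zero_arr C A (Cod C f)"
proof -
  have "B \<in> Obj C" using assms by auto
  then obtain Z s t where *: "is_zero_object C Z" "t \<in> hom C A Z" "s \<in> hom C Z B"
    "zero_arr C A B = s \<cdot> t" using zero_arr_factors[OF assms(2)] by blast
  have "zero_arr C A (Cod C f) = (f \<cdot> s) \<cdot> t"
    by (rule zero_arr_eq[OF *(1,2)]) (use * assms in \<open>auto simp: in_hom_iff\<close>)
  then show ?thesis using * assms by (auto simp: in_hom_iff)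
qed

lemma zero_comp [simp]:
  assumes "f \<in> Arr C" "B \<in> Obj C" "Cod C f = A"
  shows "zero_arr C A B \<cdot> f = zero_arr C (Dom C f) B"
proof -
  have "A \<in> Obj C" using assms by auto
  then obtain Z s t where *: "is_zero_object C Z" "t \<in> hom C A Z" "s \<in> hom C Z B"
    "zero_arr C A B = s \<cdot> t" using zero_arr_factors[OF _ assms(2)] by blast
  have "zero_arr C (Dom C f) B = s \<cdot> (t \<cdot> f)"
    by (rule zero_arr_eq[OF *(1) _ *(3)]) (use * assms in \<open>auto simp: in_hom_iff\<close>)
  then show ?thesis using * assms by (auto simp: in_hom_iff)
qed

lemma zero_arr_unique_to:
  assumes Z: "is_zero_object C Z" and f: "f \<in> hom C A Z" shows "f = zero_arr C A Z"
proof -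
  have A: "A \<in> Obj C" "Z \<in> Obj C" using f by (auto simp: in_hom_iff)
  then have "zero_arr C A Z \<in> hom C A Z" by (simp add: in_hom_iff)
  then show ?thesis using Z f A unfolding is_zero_object_def by blast
qed

lemma zero_arr_unique_from:
  assumes Z: "is_zero_object C Z" and f: "f \<in> hom C Z A" shows "f = zero_arr C Z A"
proof -
  have A: "A \<in> Obj C" "Z \<in> Obj C" using f by (auto simp: in_hom_iff)
  then have "zero_arr C Z A \<in> hom C Z A" by (simp add: in_hom_iff)
  then show ?thesis using Z f A unfolding is_zero_object_def by blast
qed

lemma is_kernelI:
  assumes "f \<in> Arr C" "k \<in> Arr C" "Cod C k = Dom C f"
    "f \<cdot> k = zero_arr C (Dom C k) (Cod C f)"
    and ex: "\<And>T h. h \<in> hom C T (Dom C f) \<Longrightarrow> f \<cdot> h = zero_arr C T (Cod C f) \<Longrightarrow>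
      \<exists>l. l \<in> hom C T (Dom C k) \<and> k \<cdot> l = h"
    and un: "\<And>T l l'. l \<in> hom C T (Dom C k) \<Longrightarrow> l' \<in> hom C T (Dom C k) \<Longrightarrow>
      k \<cdot> l = k \<cdot> l' \<Longrightarrow> l = l'"
  shows "is_kernel C f k"
  unfolding is_kernel_def
proof (intro conjI allI impI)
  show "k \<in> hom C (Dom C k) (Dom C f)" using assms by (simp add: in_hom_iff)
  fix T h assume "h \<in> hom C T (Dom C f) \<and> f \<cdot> h = zero_arr C T (Cod C f)"
  then obtain l where l: "l \<in> hom C T (Dom C k)" "k \<cdot> l = h" using ex by blast
  then show "\<exists>!l. l \<in> hom C T (Dom C k) \<and> k \<cdot> l = h"
    by (intro ex1I[of _ l] conjI l, elim conjE) (rule un; simp)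
qed (use assms in auto)

lemma is_kernel_factor:
  assumes "is_kernel C f k" "h \<in> hom C T (Dom C f)" "f \<cdot> h = zero_arr C T (Cod C f)"
  obtains l where "l \<in> hom C T (Dom C k)" "k \<cdot> l = h"
  using assms unfolding is_kernel_def by blast

lemma is_kernel_mono:
  assumes k: "is_kernel C f k" and l: "l \<in> hom C T (Dom C k)" "l' \<in> hom C T (Dom C k)"
    "k \<cdot> l = k \<cdot> l'"
  shows "l = l'"
proof -
  have ks: "k \<in> Arr C" "Cod C k = Dom C f" "f \<in> Arr C" "f \<cdot> k = zero_arr C (Dom C k) (Cod C f)"
    using k by (auto simp: is_kernel_def in_hom_iff)
  have h: "k \<cdot> l \<in> hom C T (Dom C f)" using ks l by (auto simp: in_hom_iff)
  have "f \<cdot> (k \<cdot> l) = zero_arr C T (Cod C f)"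
    using ks l comp_eq_extend[OF ks(4)] by (auto simp: in_hom_iff)
  then have "\<exists>!l'. l' \<in> hom C T (Dom C k) \<and> k \<cdot> l' = k \<cdot> l"
    using h k by (auto simp: is_kernel_def)
  then show ?thesis using l by auto
qed

text \<open>Existence of kernels reduces to existence of pullbacks, in the ambient category and in its reflective
  subcategory alike.\<close>

lemma pullback_zero_is_kernel:
  assumes Z: "is_zero_object C Z" and z: "z \<in> hom C Z (Cod C f)" and pb: "is_pullback C f z k q"
  shows "is_kernel C f k"
proof (rule is_kernelI)
  have *: "f \<in> Arr C" "k \<in> Arr C" "Cod C k = Dom C f" "q \<in> Arr C" "Dom C q = Dom C k" "Cod C q = Z"
    "f \<cdot> k = z \<cdot> q" "z \<in> Arr C" "Dom C z = Z" "Cod C z = Cod C f"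
    using is_pullbackD[OF pb] z by (auto simp: in_hom_iff)
  show "f \<in> Arr C" "k \<in> Arr C" "Cod C k = Dom C f" by fact+
  have "q = zero_arr C (Dom C k) Z" by (rule zero_arr_unique_to[OF Z]) (use * in \<open>simp add: in_hom_iff\<close>)
  then show "f \<cdot> k = zero_arr C (Dom C k) (Cod C f)" using * by simp
  show "\<exists>l. l \<in> hom C T (Dom C k) \<and> k \<cdot> l = h"
    if h: "h \<in> hom C T (Dom C f)" "f \<cdot> h = zero_arr C T (Cod C f)" for T h
  proof -
    have T: "T \<in> Obj C" "Z \<in> Obj C" using h Z by (auto simp: in_hom_iff is_zero_object_def)
    then have "zero_arr C T Z \<in> hom C T (Dom C z)" "f \<cdot> h = z \<cdot> zero_arr C T Z"
      using h * by (simp_all add: in_hom_iff)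
    then show ?thesis using is_pullback_factor[OF pb h(1)] by blast
  qed
  show "l = l'" if l: "l \<in> hom C T (Dom C k)" "l' \<in> hom C T (Dom C k)" "k \<cdot> l = k \<cdot> l'" for T l l'
  proof (rule is_pullback_jointly_monic[OF pb l])
    have "q \<cdot> l \<in> hom C T Z" "q \<cdot> l' \<in> hom C T Z" using l * by (auto simp: in_hom_iff)
    then show "q \<cdot> l = q \<cdot> l'" using zero_arr_unique_to[OF Z] by metis
  qed
qed

text \<open>By this converse, the comparison of pullbacks in \<open>X\<close> with pullbacks in the ambient category applies to kernels.\<close>

lemma kernel_is_pullback_zero:
  assumes k: "is_kernel C f k" and Z: "is_zero_object C Z"
  shows "is_pullback C f (zero_arr C Z (Cod C f)) k (zero_arr C (Dom C k) Z)"
proof (rule is_pullbackI)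
  have *: "f \<in> Arr C" "k \<in> Arr C" "Cod C k = Dom C f" "Z \<in> Obj C" "f \<cdot> k = zero_arr C (Dom C k) (Cod C f)"
    using k Z by (auto simp: is_kernel_def is_zero_object_def in_hom_iff)
  show "f \<cdot> k = zero_arr C Z (Cod C f) \<cdot> zero_arr C (Dom C k) Z" using * by simp
  show "\<exists>h. h \<in> hom C T (Dom C k) \<and> k \<cdot> h = a \<and> zero_arr C (Dom C k) Z \<cdot> h = b"
    if ab: "a \<in> hom C T (Dom C f)" "b \<in> hom C T (Dom C (zero_arr C Z (Cod C f)))"
      "f \<cdot> a = zero_arr C Z (Cod C f) \<cdot> b" for T a b
  proof -
    have b: "b \<in> hom C T Z" using ab(2) * by simp
    have "f \<cdot> a = zero_arr C T (Cod C f)" using ab(3) b * by (simp add: in_hom_iff)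
    then obtain h where "h \<in> hom C T (Dom C k)" "k \<cdot> h = a" using is_kernel_factor[OF k ab(1)] by blast
    then show ?thesis using zero_arr_unique_to[OF Z b] * by (intro exI[of _ h]) (simp add: in_hom_iff)
  qed
  show "h = h'" if "h \<in> hom C T (Dom C k)" "h' \<in> hom C T (Dom C k)" "k \<cdot> h = k \<cdot> h'" for T h h'
    using is_kernel_mono[OF k] that by blast
qed (use k Z in \<open>auto simp: is_kernel_def is_zero_object_def in_hom_iff\<close>)

text \<open>Both descriptions of the Galois group, inside \<open>I (Eq p)\<close> and inside the extension, are intersections of two
  kernels; the projection \<open>a\<close> exhibits the intersection as a subobject of one of them.\<close>

lemma kernel_intersection:
  assumes k: "is_kernel C f k" and l: "is_kernel C g l" and fg: "Dom C f = Dom C g"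
    and pb: "is_pullback C k l a b"
  shows "f \<cdot> (k \<cdot> a) = zero_arr C (Dom C a) (Cod C f)"
    and "g \<cdot> (k \<cdot> a) = zero_arr C (Dom C a) (Cod C g)"
    and "\<lbrakk>x \<in> Arr C; y \<in> Arr C; Dom C x = Dom C y; Cod C x = Dom C a; Cod C y = Dom C a;
      k \<cdot> (a \<cdot> x) = k \<cdot> (a \<cdot> y)\<rbrakk> \<Longrightarrow> x = y"
    and "\<lbrakk>t \<in> Arr C; Cod C t = Dom C f; f \<cdot> t = zero_arr C (Dom C t) (Cod C f);
      g \<cdot> t = zero_arr C (Dom C t) (Cod C g)\<rbrakk> \<Longrightarrow> \<exists>h. h \<in> hom C (Dom C t) (Dom C a) \<and> k \<cdot> (a \<cdot> h) = t"
proof -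
  have k': "k \<in> Arr C" "Cod C k = Dom C f" "f \<in> Arr C" "f \<cdot> k = zero_arr C (Dom C k) (Cod C f)"
    and l': "l \<in> Arr C" "Cod C l = Dom C f" "g \<in> Arr C" "g \<cdot> l = zero_arr C (Dom C l) (Cod C g)"
    using k l fg by (auto simp: is_kernel_def in_hom_iff)
  note ab = is_pullbackD[OF pb]
  show "f \<cdot> (k \<cdot> a) = zero_arr C (Dom C a) (Cod C f)"
    using comp_eq_extend[OF k'(4), of a] k'(1-3) ab(4,7) by simp
  show "g \<cdot> (k \<cdot> a) = zero_arr C (Dom C a) (Cod C g)"
    unfolding ab(9) using comp_eq_extend[OF l'(4), of b] l'(1-3) fg ab(4-8) by simp
  have lb: "l \<cdot> (b \<cdot> x) = k \<cdot> (a \<cdot> x)" if "x \<in> Arr C" "Cod C x = Dom C a" for x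
    using comp_eq_extend[OF ab(9), of x] that ab(1-8) by simp
  show "x = y" if x: "x \<in> Arr C" "y \<in> Arr C" "Dom C x = Dom C y" "Cod C x = Dom C a" "Cod C y = Dom C a"
    and eq: "k \<cdot> (a \<cdot> x) = k \<cdot> (a \<cdot> y)"
  proof (rule is_pullback_jointly_monic[OF pb, of x "Dom C x" y])
    show "a \<cdot> x = a \<cdot> y"
      by (rule is_kernel_mono[OF k, of _ "Dom C x"]) (use x eq ab(4,7) in \<open>simp_all add: in_hom_iff\<close>)
    show "b \<cdot> x = b \<cdot> y"
      by (rule is_kernel_mono[OF l, of _ "Dom C x"]) (use x eq lb ab(4-8) in \<open>simp_all add: in_hom_iff\<close>)
  qed (use x in \<open>simp_all add: in_hom_iff\<close>)
  show "\<exists>h. h \<in> hom C (Dom C t) (Dom C a) \<and> k \<cdot> (a \<cdot> h) = t"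
    if t: "t \<in> Arr C" "Cod C t = Dom C f" "f \<cdot> t = zero_arr C (Dom C t) (Cod C f)"
      "g \<cdot> t = zero_arr C (Dom C t) (Cod C g)"
  proof -
    obtain m where m: "m \<in> hom C (Dom C t) (Dom C k)" "k \<cdot> m = t"
      by (rule is_kernel_factor[OF k, of t "Dom C t"]) (use t in \<open>simp_all add: in_hom_iff\<close>)
    obtain n where n: "n \<in> hom C (Dom C t) (Dom C l)" "l \<cdot> n = t"
      by (rule is_kernel_factor[OF l, of t "Dom C t"]) (use t fg in \<open>simp_all add: in_hom_iff\<close>)
    obtain h where "h \<in> hom C (Dom C t) (Dom C a)" "a \<cdot> h = m"
      by (rule is_pullback_factor[OF pb m(1) n(1)]) (use m n in simp_all)
    then show ?thesis using m by blast
  qed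
qed

end

lemma ker_is_kernel: "\<exists>k. is_kernel C f k \<Longrightarrow> is_kernel C f (ker C f)"
  unfolding ker_def by (rule someI_ex)

section \<open>Functors, slices and Eilenberg--Moore categories\<close>

context cat_functor
begin

lemma FO_obj_simp [simp]: "x \<in> Obj A \<Longrightarrow> FO F x \<in> Obj B"
  by (rule FO_obj)

lemma FA_arr [simp]: "f \<in> Arr A \<Longrightarrow> FA F f \<in> Arr B"
  and dom_FA [simp]: "f \<in> Arr A \<Longrightarrow> Dom B (FA F f) = FO F (Dom A f)"
  and cod_FA [simp]: "f \<in> Arr A \<Longrightarrow> Cod B (FA F f) = FO F (Cod A f)"
  using FA_hom[of f "Dom A f" "Cod A f"] by (auto simp: in_hom_iff)

lemma FA_id_simp [simp]: "x \<in> Obj A \<Longrightarrow> FA F (Id A x) = Id B (FO F x)"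
  by (rule FA_id)

lemma FA_comp_simp [simp]: "f \<in> Arr A \<Longrightarrow> g \<in> Arr A \<Longrightarrow> Cod A f = Dom A g \<Longrightarrow>
    FA F (g \<cdot>\<^bsub>A\<^esub> f) = FA F g \<cdot>\<^bsub>B\<^esub> FA F f"
  using FA_comp by (simp add: in_hom_iff)

end

context nat_trans
begin

lemma component_arr [simp]: "x \<in> Obj A \<Longrightarrow> \<tau> x \<in> Arr B"
  and dom_component [simp]: "x \<in> Obj A \<Longrightarrow> Dom B (\<tau> x) = FO F x"
  and cod_component [simp]: "x \<in> Obj A \<Longrightarrow> Cod B (\<tau> x) = FO G x"
  using component by (auto simp: in_hom_iff)

lemma naturality_arr: "f \<in> Arr A \<Longrightarrow> FA G f \<cdot>\<^bsub>B\<^esub> \<tau> (Dom A f) = \<tau> (Cod A f) \<cdot>\<^bsub>B\<^esub> FA F f"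
  using naturality by (simp add: in_hom_iff)

end

lemma comp_fctr_simps [simp]:
  "FO (G \<circ>\<^sub>F F) x = FO G (FO F x)" "FA (G \<circ>\<^sub>F F) f = FA G (FA F f)"
  by (simp_all add: comp_fctr_def)

lemma id_fctr_simps [simp]: "FO id_fctr x = x" "FA id_fctr f = f"
  by (simp_all add: id_fctr_def)

lemma cat_functor_id: "category A \<Longrightarrow> cat_functor A A id_fctr"
  by (simp add: cat_functor_def)

lemma cat_functor_comp:
  assumes "cat_functor A B F" "cat_functor B C G"
  shows "cat_functor A C (G \<circ>\<^sub>F F)"
proof -
  interpret F: cat_functor A B F by fact
  interpret G: cat_functor B C G by fact
  show ?thesis
    by (rule cat_functor.intro) (auto simp: F.cat_source G.cat_target in_hom_iff)
qed

lemma full_sub_simps [simp]: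
  "Obj (full_sub C S) = Obj C \<inter> S"
  "Arr (full_sub C S) = {f \<in> Arr C. Dom C f \<in> S \<and> Cod C f \<in> S}"
  "Dom (full_sub C S) = Dom C" "Cod (full_sub C S) = Cod C"
  "Id (full_sub C S) = Id C" "Comp (full_sub C S) = Comp C"
  by (simp_all add: full_sub_def)

lemma (in category) category_full_sub: "category (full_sub C S)"
  by (rule category.intro) (auto simp: in_hom_iff)

lemma slice_simps [simp]:
  "Obj (slice C B) = {f \<in> Arr C. Cod C f = B}"
  "(f, h, g) \<in> Arr (slice C B) \<longleftrightarrow> f \<in> Arr C \<and> g \<in> Arr C \<and> Cod C f = B \<and> Cod C g = B \<and>
     h \<in> hom C (Dom C f) (Dom C g) \<and> g \<cdot>\<^bsub>C\<^esub> h = f"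
  "Dom (slice C B) = fst" "Cod (slice C B) = (\<lambda>x. snd (snd x))"
  "Id (slice C B) = (\<lambda>f. (f, Id C (Dom C f), f))"
  "(f', h', g') \<cdot>\<^bsub>slice C B\<^esub> (f, h, g) = (f, h' \<cdot>\<^bsub>C\<^esub> h, g')"
  by (auto simp: slice_def)

lemma (in category) category_slice: "category (slice C B)"
  by (rule category.intro) (auto simp: in_hom_iff simp flip: comp_assoc)

lemma arrow_cat_simps [simp]:
  "Obj (arrow_cat C) = Arr C"
  "(p, (f, b), p') \<in> Arr (arrow_cat C) \<longleftrightarrow> p \<in> Arr C \<and> p' \<in> Arr C \<and>
     f \<in> hom C (Dom C p) (Dom C p') \<and> b \<in> hom C (Cod C p) (Cod C p') \<and> p' \<cdot>\<^bsub>C\<^esub> f = b \<cdot>\<^bsub>C\<^esub> p"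
  "Dom (arrow_cat C) = fst" "Cod (arrow_cat C) = (\<lambda>x. snd (snd x))"
  "Id (arrow_cat C) = (\<lambda>p. (p, (Id C (Dom C p), Id C (Cod C p)), p))"
  "(q, (g, c), q') \<cdot>\<^bsub>arrow_cat C\<^esub> (p, (f, b), p') = (p, (g \<cdot>\<^bsub>C\<^esub> f, c \<cdot>\<^bsub>C\<^esub> b), q')"
  by (auto simp: arrow_cat_def)

lemma (in category) category_arrow_cat: "category (arrow_cat C)"
proof (rule category.intro)
  fix x y z \<phi> \<psi>
  assume "\<phi> \<in> hom (arrow_cat C) x y" "\<psi> \<in> hom (arrow_cat C) y z"
  then obtain f b g c where *: "\<phi> = (x, (f, b), y)" "\<psi> = (y, (g, c), z)" "x \<in> Arr C" "y \<in> Arr C" "z \<in> Arr C"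
    "f \<in> hom C (Dom C x) (Dom C y)" "b \<in> hom C (Cod C x) (Cod C y)" "y \<cdot>\<^bsub>C\<^esub> f = b \<cdot>\<^bsub>C\<^esub> x"
    "g \<in> hom C (Dom C y) (Dom C z)" "c \<in> hom C (Cod C y) (Cod C z)" "z \<cdot>\<^bsub>C\<^esub> g = c \<cdot>\<^bsub>C\<^esub> y"
    by (cases \<phi>; cases \<psi>) (auto simp: in_hom_iff)
  then show "\<psi> \<cdot>\<^bsub>arrow_cat C\<^esub> \<phi> \<in> hom (arrow_cat C) x z"
    using comp_eq_extend[OF *(11), of f] by (simp add: in_hom_iff)
qed (auto simp: in_hom_iff)

lemma EM_cat_simps [simp]:
  "Obj (EM_cat X T \<eta> \<mu>) = EM_algebras X T \<eta> \<mu>"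
  "(s, h, t) \<in> Arr (EM_cat X T \<eta> \<mu>) \<longleftrightarrow> s \<in> EM_algebras X T \<eta> \<mu> \<and> t \<in> EM_algebras X T \<eta> \<mu> \<and>
     h \<in> hom X (fst s) (fst t) \<and> h \<cdot>\<^bsub>X\<^esub> snd s = snd t \<cdot>\<^bsub>X\<^esub> FA T h"
  "Dom (EM_cat X T \<eta> \<mu>) = fst" "Cod (EM_cat X T \<eta> \<mu>) = (\<lambda>x. snd (snd x))"
  "Id (EM_cat X T \<eta> \<mu>) = (\<lambda>s. (s, Id X (fst s), s))"
  "(s', h', t') \<cdot>\<^bsub>EM_cat X T \<eta> \<mu>\<^esub> (s, h, t) = (s, h' \<cdot>\<^bsub>X\<^esub> h, t')"
  by (auto simp: EM_cat_def)

lemma category_EM_cat: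
  assumes "cat_functor X X T"
  shows "category (EM_cat X T \<eta> \<mu>)"
proof -
  interpret T: cat_functor X X T by fact
  interpret X: category X by (rule T.cat_source)
  note alg = EM_algebras_def in_hom_iff
  have comp: "(h' \<cdot>\<^bsub>X\<^esub> h) \<cdot>\<^bsub>X\<^esub> a = c \<cdot>\<^bsub>X\<^esub> FA T (h' \<cdot>\<^bsub>X\<^esub> h)"
    if "h \<in> Arr X" "h' \<in> Arr X" "Cod X h = Dom X h'" "a \<in> Arr X" "b \<in> Arr X" "c \<in> Arr X"
      "Cod X a = Dom X h" "Dom X a = FO T (Dom X h)" "Dom X b = FO T (Cod X h)" "Cod X b = Cod X h"
      "Dom X c = FO T (Cod X h')" "Cod X c = Cod X h'"
      "h \<cdot>\<^bsub>X\<^esub> a = b \<cdot>\<^bsub>X\<^esub> FA T h" "h' \<cdot>\<^bsub>X\<^esub> b = c \<cdot>\<^bsub>X\<^esub> FA T h'"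
    for h h' a b c
  proof -
    have "(h' \<cdot>\<^bsub>X\<^esub> h) \<cdot>\<^bsub>X\<^esub> a = h' \<cdot>\<^bsub>X\<^esub> (b \<cdot>\<^bsub>X\<^esub> FA T h)" using that by simp
    also have "\<dots> = (c \<cdot>\<^bsub>X\<^esub> FA T h') \<cdot>\<^bsub>X\<^esub> FA T h" using that by (simp flip: X.comp_assoc)
    finally show ?thesis using that by simp
  qed
  show ?thesis
  proof (rule category.intro)
    show "g \<cdot>\<^bsub>EM_cat X T \<eta> \<mu>\<^esub> f \<in> hom (EM_cat X T \<eta> \<mu>) U W"
      if "f \<in> hom (EM_cat X T \<eta> \<mu>) U V" "g \<in> hom (EM_cat X T \<eta> \<mu>) V W" for f g U V W
    proof -
      have "f = (U, fst (snd f), V)" "g = (V, fst (snd g), W)"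
        using that by (auto simp: in_hom_iff prod_eq_iff)
      then obtain k l where fg: "f = (U, k, V)" "g = (V, l, W)" by metis
      show ?thesis using that comp[of k l "snd U" "snd V" "snd W"] unfolding fg by (auto simp: alg)
    qed
  qed (auto simp: alg)
qed

lemma EM_comparison_simps:
  "FO (EM_comparison A G \<epsilon>) x = (FO G x, FA G (\<epsilon> x))"
  "FA (EM_comparison A G \<epsilon>) f =
     ((FO G (Dom A f), FA G (\<epsilon> (Dom A f))), FA G f, (FO G (Cod A f), FA G (\<epsilon> (Cod A f))))"
  by (simp_all add: EM_comparison_def Let_def)

lemma cat_functor_EM_comparison:
  assumes "adjunction X A L G \<eta> \<epsilon>"
  shows "cat_functor A (EM_cat X (G \<circ>\<^sub>F L) \<eta> (\<lambda>x. FA G (\<epsilon> (FO L x)))) (EM_comparison A G \<epsilon>)"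
proof -
  interpret adjunction X A L G \<eta> \<epsilon> by fact
  interpret L: cat_functor X A L by (rule left_functor)
  interpret G: cat_functor A X G by (rule right_functor)
  interpret \<eta>: nat_trans X X id_fctr "G \<circ>\<^sub>F L" \<eta> by (rule unit_natural)
  interpret \<epsilon>: nat_trans A A "L \<circ>\<^sub>F G" id_fctr \<epsilon> by (rule counit_natural)
  interpret X: category X by (rule L.cat_source)
  interpret A: category A by (rule L.cat_target)
  have nat: "FA G f \<cdot>\<^bsub>X\<^esub> FA G (\<epsilon> (Dom A f)) = FA G (\<epsilon> (Cod A f)) \<cdot>\<^bsub>X\<^esub> FA G (FA L (FA G f))"
    if "f \<in> Arr A" for f
    using that \<epsilon>.naturality_arr[OF that, THEN arg_cong[of _ _ "FA G"]] by simp
  have alg: "(FO G x, FA G (\<epsilon> x)) \<in> EM_algebras X (G \<circ>\<^sub>F L) \<eta> (\<lambda>x. FA G (\<epsilon> (FO L x)))"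
    if "x \<in> Obj A" for x
    using that triangle_right[OF that] nat[of "\<epsilon> x"] by (simp add: EM_algebras_def in_hom_iff)
  show ?thesis
  proof (rule cat_functor.intro)
    show "category (EM_cat X (G \<circ>\<^sub>F L) \<eta> (\<lambda>x. FA G (\<epsilon> (FO L x))))"
      by (rule category_EM_cat) (rule cat_functor_comp[OF left_functor right_functor])
  qed (use nat alg in \<open>auto simp: EM_comparison_simps in_hom_iff A.category_axioms\<close>)
qed

text \<open>The inverse of an algebra morphism is again one since \<open>T\<close> preserves inverses.\<close>

lemma (in category) EM_iso:
  assumes T: "cat_functor C C T"
    and k: "((x, a), k, (y, b)) \<in> Arr (EM_cat C T \<eta> \<mu>)" and k': "is_inverse C k k'"
  shows "is_inverse (EM_cat C T \<eta> \<mu>) ((x, a), k, (y, b)) ((y, b), k', (x, a))"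
proof -
  interpret T: cat_functor C C T by fact
  have *: "k \<in> Arr C" "k' \<in> Arr C" "Dom C k = x" "Cod C k = y" "Dom C k' = y" "Cod C k' = x"
    "k' \<cdot>\<^bsub>C\<^esub> k = Id C x" "k \<cdot>\<^bsub>C\<^esub> k' = Id C y" "a \<in> Arr C" "b \<in> Arr C" "Dom C a = FO T x"
    "Cod C a = x" "Dom C b = FO T y" "Cod C b = y" "k \<cdot>\<^bsub>C\<^esub> a = b \<cdot>\<^bsub>C\<^esub> FA T k" "x \<in> Obj C" "y \<in> Obj C"
    using k k' by (auto simp: is_inverse_def in_hom_iff EM_algebras_def)
  have "k' \<cdot>\<^bsub>C\<^esub> b = k' \<cdot>\<^bsub>C\<^esub> (b \<cdot>\<^bsub>C\<^esub> FA T (k \<cdot>\<^bsub>C\<^esub> k'))" using * by simp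
  also have "\<dots> = k' \<cdot>\<^bsub>C\<^esub> ((b \<cdot>\<^bsub>C\<^esub> FA T k) \<cdot>\<^bsub>C\<^esub> FA T k')" using *(1-6,9-14) by simp
  also have "\<dots> = k' \<cdot>\<^bsub>C\<^esub> (k \<cdot>\<^bsub>C\<^esub> (a \<cdot>\<^bsub>C\<^esub> FA T k'))" using * by (simp flip: *(15))
  also have "\<dots> = a \<cdot>\<^bsub>C\<^esub> FA T k'" using * by (simp add: comp_eq_extend[OF *(7)])
  finally show ?thesis using k * by (auto simp: is_inverse_def in_hom_iff)
qed

text \<open>The quasi-inverse is chosen objectwise; full faithfulness makes the choice functorial and provides the unit and its
  inverse as preimages of the chosen isomorphisms.\<close>

lemma equivalence_functorI:
  assumes F: "cat_functor A B F" and full: "full_functor A B F" and faithful: "faithful_functor A F"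
    and eso: "\<And>y. y \<in> Obj B \<Longrightarrow> \<exists>x \<in> Obj A. \<exists>k \<in> hom B (FO F x) y. is_iso B k"
  shows "equivalence_functor A B F"
proof -
  interpret F: cat_functor A B F by (rule F)
  interpret A: category A by (rule F.cat_source)
  interpret B: category B by (rule F.cat_target)
  have "\<exists>x k k'. x \<in> Obj A \<and> k \<in> hom B (FO F x) y \<and> is_inverse B k k'" if "y \<in> Obj B" for y
    using eso[OF that] unfolding is_iso_def by blast
  then obtain Go \<theta> \<theta>' where
    "\<And>y. y \<in> Obj B \<Longrightarrow> Go y \<in> Obj A \<and> \<theta> y \<in> hom B (FO F (Go y)) y \<and> is_inverse B (\<theta> y) (\<theta>' y)"
    by metis
  then have Go [simp]: "Go y \<in> Obj A" and \<theta> [simp]: "\<theta> y \<in> Arr B" "Dom B (\<theta> y) = FO F (Go y)"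
      "Cod B (\<theta> y) = y" "\<theta>' y \<in> Arr B" "Dom B (\<theta>' y) = y" "Cod B (\<theta>' y) = FO F (Go y)"
    and \<theta>\<theta>' [simp]: "\<theta> y \<cdot>\<^bsub>B\<^esub> \<theta>' y = Id B y" "\<theta>' y \<cdot>\<^bsub>B\<^esub> \<theta> y = Id B (FO F (Go y))"
    if "y \<in> Obj B" for y
    using that by (auto simp: is_inverse_def in_hom_iff)
  have cancel [simp]: "\<theta> y \<cdot>\<^bsub>B\<^esub> (\<theta>' y \<cdot>\<^bsub>B\<^esub> f) = f" "Cod B g = FO F (Go y) \<Longrightarrow> \<theta>' y \<cdot>\<^bsub>B\<^esub> (\<theta> y \<cdot>\<^bsub>B\<^esub> g) = g"
    if "y \<in> Obj B" "f \<in> Arr B" "Cod B f = y" "g \<in> Arr B" for y f g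
    using that B.comp_eq_extend[OF \<theta>\<theta>'(1), of y f] B.comp_eq_extend[OF \<theta>\<theta>'(2), of y g] by simp_all
  define pre where "pre x y g = (SOME f. f \<in> hom A x y \<and> FA F f = g)" for x y g
  have "pre x y g \<in> hom A x y \<and> FA F (pre x y g) = g"
    if "x \<in> Obj A" "y \<in> Obj A" "g \<in> hom B (FO F x) (FO F y)" for x y g
  proof -
    have "\<exists>f \<in> hom A x y. FA F f = g" using full that by (simp add: full_functor_def)
    then show ?thesis unfolding pre_def Bex_def by (rule someI_ex)
  qed
  then have pre [simp]: "pre x y g \<in> Arr A" "Dom A (pre x y g) = x" "Cod A (pre x y g) = y"
    "FA F (pre x y g) = g" if "x \<in> Obj A" "y \<in> Obj A" "g \<in> Arr B" "Dom B g = FO F x" "Cod B g = FO F y"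
    for x y g
    using that by (auto simp: in_hom_iff)
  have eqI: "f = f'" if "f \<in> Arr A" "f' \<in> Arr A" "Dom A f = Dom A f'" "Cod A f = Cod A f'"
    "FA F f = FA F f'" for f f'
  proof -
    have "inj_on (FA F) (hom A (Dom A f) (Cod A f))"
      using faithful that by (simp add: faithful_functor_def)
    then show ?thesis by (rule inj_onD) (use that in \<open>simp_all add: in_hom_iff\<close>)
  qed
  define Ga where "Ga g = pre (Go (Dom B g)) (Go (Cod B g)) (\<theta>' (Cod B g) \<cdot>\<^bsub>B\<^esub> (g \<cdot>\<^bsub>B\<^esub> \<theta> (Dom B g)))" for g
  have Ga [simp]: "Ga g \<in> Arr A" "Dom A (Ga g) = Go (Dom B g)" "Cod A (Ga g) = Go (Cod B g)"
    "FA F (Ga g) = \<theta>' (Cod B g) \<cdot>\<^bsub>B\<^esub> (g \<cdot>\<^bsub>B\<^esub> \<theta> (Dom B g))" if "g \<in> Arr B" for g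
    using that by (auto simp: Ga_def)
  define G where "G = \<lparr>FO = Go, FA = Ga\<rparr>"
  have G_simps [simp]: "FO G = Go" "FA G = Ga" by (simp_all add: G_def)
  define \<sigma> where "\<sigma> x = pre x (Go (FO F x)) (\<theta>' (FO F x))" for x
  have \<sigma> [simp]: "\<sigma> x \<in> Arr A" "Dom A (\<sigma> x) = x" "Cod A (\<sigma> x) = Go (FO F x)" "FA F (\<sigma> x) = \<theta>' (FO F x)"
    if "x \<in> Obj A" for x
    using that by (auto simp: \<sigma>_def)
  have G: "cat_functor B A G"
    by (rule cat_functor.intro)
      (auto simp: in_hom_iff A.category_axioms B.category_axioms intro!: eqI)
  moreover have "nat_trans A A id_fctr (G \<circ>\<^sub>F F) \<sigma>"
    by (rule nat_trans.intro)
      (auto simp: in_hom_iff cat_functor_id A.category_axioms cat_functor_comp[OF F G] intro!: eqI)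
  moreover have "is_iso A (\<sigma> x)" if "x \<in> Obj A" for x
  proof -
    have "is_inverse A (\<sigma> x) (pre (Go (FO F x)) x (\<theta> (FO F x)))"
      using that by (auto simp: is_inverse_def in_hom_iff intro!: eqI)
    then show ?thesis by (auto simp: is_iso_def)
  qed
  moreover have "nat_trans B B (F \<circ>\<^sub>F G) id_fctr \<theta>"
    by (rule nat_trans.intro)
      (auto simp: in_hom_iff cat_functor_id B.category_axioms cat_functor_comp[OF G F])
  moreover have "is_iso B (\<theta> y)" if "y \<in> Obj B" for y
    using that unfolding is_iso_def is_inverse_def by (auto simp: in_hom_iff intro!: exI[of _ "\<theta>' y"])
  ultimately show ?thesis
    unfolding equivalence_functor_def using F by blast
qed

section \<open>Split fibrations are monadic\<close>

lemma pullback_fctr_simps: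
  "FO (pullback_fctr C b) f = snd (pb C f b)"
  "FA (pullback_fctr C b) (f, h, g) = (snd (pb C f b),
     (THE k. k \<in> hom C (Dom C (snd (pb C f b))) (Dom C (snd (pb C g b))) \<and>
        fst (pb C g b) \<cdot>\<^bsub>C\<^esub> k = h \<cdot>\<^bsub>C\<^esub> fst (pb C f b) \<and>
        snd (pb C g b) \<cdot>\<^bsub>C\<^esub> k = snd (pb C f b)),
     snd (pb C g b))"
  by (simp_all add: pullback_fctr_def)

lemma pullback_stable_pb:
  assumes "pullback_stable C M" "f \<in> M" "g \<in> Arr C" "Cod C f = Cod C g"
  shows "is_pullback C f g (fst (pb C f g)) (snd (pb C f g))" "snd (pb C f g) \<in> M"
proof -
  have *: "(\<exists>p q. is_pullback C f g p q) \<and> (\<forall>p q. is_pullback C f g p q \<longrightarrow> q \<in> M)"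
    using assms unfolding pullback_stable_def by blast
  then show pb: "is_pullback C f g (fst (pb C f g)) (snd (pb C f g))"
    by (intro pb_is_pullback) (rule conjunct1)
  show "snd (pb C f g) \<in> M" by (rule conjunct2[OF *, rule_format, OF pb])
qed

definition composition_fctr :: "('o, 'a) cat \<Rightarrow> 'a \<Rightarrow> ('a, 'a \<times> 'a \<times> 'a, 'a, 'a \<times> 'a \<times> 'a) fctr" where
  "composition_fctr C p =
     \<lparr>FO = (\<lambda>g. p \<cdot>\<^bsub>C\<^esub> g), FA = (\<lambda>(f, h, g). (p \<cdot>\<^bsub>C\<^esub> f, h, p \<cdot>\<^bsub>C\<^esub> g))\<rparr>"

lemma composition_fctr_simps [simp]:
  "FO (composition_fctr C p) g = p \<cdot>\<^bsub>C\<^esub> g"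
  "FA (composition_fctr C p) (f, h, g) = (p \<cdot>\<^bsub>C\<^esub> f, h, p \<cdot>\<^bsub>C\<^esub> g)"
  by (simp_all add: composition_fctr_def)

locale split_fibration = category C for C :: "('o, 'a) cat" (structure) +
  fixes E :: "'a set" and p s :: 'a
  assumes fibrations: "arrow_class C E" and p_fib: "p \<in> E"
    and section_hom: "s \<in> hom C (Cod C p) (Dom C p)" and section_eq: "p \<cdot> s = Id C (Cod C p)"
begin

abbreviation fibs :: "'o \<Rightarrow> ('a, 'a \<times> 'a \<times> 'a) cat" where
  "fibs X \<equiv> full_sub (slice C X) E"

abbreviation pr :: "'a \<Rightarrow> 'a" where "pr f \<equiv> fst (pb C f p)"
abbreviation pl :: "'a \<Rightarrow> 'a" where "pl f \<equiv> snd (pb C f p)"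

abbreviation Pull where "Pull \<equiv> pullback_fctr C p"
abbreviation Post where "Post \<equiv> composition_fctr C p"
abbreviation base where "base \<equiv> fibs (Cod C p)"
abbreviation total where "total \<equiv> fibs (Dom C p)"

text \<open>The mediating arrow \<open>\<langle>r, t\<rangle>\<close> into the chosen pullback of \<open>f\<close> along \<open>p\<close>.\<close>

definition med :: "'a \<Rightarrow> 'a \<Rightarrow> 'a \<Rightarrow> 'a" where
  "med f r t = (THE k. k \<in> hom C (Dom C r) (Dom C (pr f)) \<and> pr f \<cdot> k = r \<and> pl f \<cdot> k = t)"

lemma fib_arr [simp]: "f \<in> E \<Longrightarrow> f \<in> Arr C"
  using fibrations by (auto simp: arrow_class_def)

lemma fib_comp [simp]: "f \<in> E \<Longrightarrow> g \<in> E \<Longrightarrow> Cod C f = Dom C g \<Longrightarrow> g \<cdot> f \<in> E"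
  using fibrations by (auto simp: arrow_class_def)

lemma fib_pullback:
  assumes "f \<in> E" "g \<in> Arr C" "Cod C f = Cod C g"
  shows "is_pullback C f g (fst (pb C f g)) (snd (pb C f g))" "snd (pb C f g) \<in> E"
  using pullback_stable_pb[of C E f g] fibrations assms by (simp_all add: arrow_class_def)

lemma p_arr [simp]: "p \<in> E"
  and s_arr [simp]: "s \<in> Arr C" "Dom C s = Cod C p" "Cod C s = Dom C p"
  and ps [simp]: "p \<cdot> s = Id C (Cod C p)"
  using p_fib section_hom section_eq by (auto simp: in_hom_iff)

lemma p_s_comp [simp]: "x \<in> Arr C \<Longrightarrow> Cod C x = Cod C p \<Longrightarrow> p \<cdot> (s \<cdot> x) = x"
  using comp_eq_extend[OF ps] by simp

lemma proj [simp]: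
  assumes "f \<in> E" "Cod C f = Cod C p"
  shows "pr f \<in> Arr C" "Cod C (pr f) = Dom C f" "pl f \<in> E" "Dom C (pl f) = Dom C (pr f)"
    "Cod C (pl f) = Dom C p" "f \<cdot> pr f = p \<cdot> pl f"
  using is_pullbackD[OF fib_pullback(1)[of f p]] fib_pullback(2)[of f p] assms by simp_all

lemma square [simp]:
  assumes "f \<in> E" "Cod C f = Cod C p" "x \<in> Arr C" "Cod C x = Dom C (pr f)"
  shows "f \<cdot> (pr f \<cdot> x) = p \<cdot> (pl f \<cdot> x)"
  using comp_eq_extend[OF proj(6)[OF assms(1,2)]] assms by simp

text \<open>The square of the composite \<open>p g\<close>, in the right-associated form to which simplification brings it.\<close>

lemma composite_square [simp]:
  assumes "g \<in> E" "Cod C g = Dom C p"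
  shows "p \<cdot> (g \<cdot> pr (p \<cdot> g)) = p \<cdot> pl (p \<cdot> g)"
    "x \<in> Arr C \<Longrightarrow> Cod C x = Dom C (pr (p \<cdot> g)) \<Longrightarrow>
      p \<cdot> (g \<cdot> (pr (p \<cdot> g) \<cdot> x)) = p \<cdot> (pl (p \<cdot> g) \<cdot> x)"
  using proj(6)[of "p \<cdot> g"] square[of "p \<cdot> g" x] assms by (simp_all del: proj(6) square)

lemma med [simp]:
  assumes "f \<in> E" "Cod C f = Cod C p" "r \<in> Arr C" "t \<in> Arr C" "Dom C t = Dom C r"
    "Cod C r = Dom C f" "Cod C t = Dom C p" "f \<cdot> r = p \<cdot> t"
  shows "med f r t \<in> Arr C" "Dom C (med f r t) = Dom C r" "Cod C (med f r t) = Dom C (pr f)"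
    "pr f \<cdot> med f r t = r" "pl f \<cdot> med f r t = t"
proof -
  have "\<exists>!k. k \<in> hom C (Dom C r) (Dom C (pr f)) \<and> pr f \<cdot> k = r \<and> pl f \<cdot> k = t"
    using fib_pullback(1)[of f p] assms unfolding is_pullback_def by (simp add: in_hom_iff)
  from theI'[OF this] show "med f r t \<in> Arr C" "Dom C (med f r t) = Dom C r"
    "Cod C (med f r t) = Dom C (pr f)" "pr f \<cdot> med f r t = r" "pl f \<cdot> med f r t = t"
    unfolding med_def by (auto simp: in_hom_iff)
qed

lemma med_comp [simp]:
  assumes "f \<in> E" "Cod C f = Cod C p" "r \<in> Arr C" "t \<in> Arr C" "Dom C t = Dom C r"
    "Cod C r = Dom C f" "Cod C t = Dom C p" "f \<cdot> r = p \<cdot> t" "x \<in> Arr C" "Cod C x = Dom C r"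
  shows "pr f \<cdot> (med f r t \<cdot> x) = r \<cdot> x" "pl f \<cdot> (med f r t \<cdot> x) = t \<cdot> x"
  using comp_eq_extend[OF med(4)] comp_eq_extend[OF med(5)] assms by simp_all

lemma proj_eqI:
  assumes "f \<in> E" "Cod C f = Cod C p" "h \<in> Arr C" "h' \<in> Arr C" "Dom C h = Dom C h'"
    "Cod C h = Dom C (pr f)" "Cod C h' = Dom C (pr f)" "pr f \<cdot> h = pr f \<cdot> h'" "pl f \<cdot> h = pl f \<cdot> h'"
  shows "h = h'"
  using is_pullback_jointly_monic[OF fib_pullback(1)[of f p], of h "Dom C h" h'] assms
  by (simp add: in_hom_iff)

lemma med_precomp:
  assumes "f \<in> E" "Cod C f = Cod C p" "r \<in> Arr C" "t \<in> Arr C" "Dom C t = Dom C r"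
    "Cod C r = Dom C f" "Cod C t = Dom C p" "f \<cdot> r = p \<cdot> t" "x \<in> Arr C" "Cod C x = Dom C r"
  shows "med f r t \<cdot> x = med f (r \<cdot> x) (t \<cdot> x)"
proof -
  have "f \<cdot> (r \<cdot> x) = p \<cdot> (t \<cdot> x)"
    using comp_eq_extend[OF assms(8), of x] assms by simp
  then show ?thesis using assms by (simp add: proj_eqI[of f])
qed

lemma pullback_FA [simp]:
  assumes "f \<in> E" "g \<in> E" "Cod C f = Cod C p" "Cod C g = Cod C p" "h \<in> Arr C" "Dom C h = Dom C f"
    "Cod C h = Dom C g" "g \<cdot> h = f"
  shows "FA Pull (f, h, g) = (pl f, med g (h \<cdot> pr f) (pl f), pl g)"
  using assms by (simp add: pullback_fctr_simps med_def)

text \<open>The unit at \<open>g\<close> is \<open>\<langle>1, g\<rangle>\<close> into the pullback of \<open>p g\<close> along \<open>p\<close>; the counit at \<open>f\<close> is the projection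
  \<open>p\<^sup>* f \<rightarrow> f\<close>.\<close>

definition unit_fib :: "'a \<Rightarrow> 'a \<times> 'a \<times> 'a" where
  "unit_fib g = (g, med (p \<cdot> g) (Id C (Dom C g)) g, pl (p \<cdot> g))"

definition counit_fib :: "'a \<Rightarrow> 'a \<times> 'a \<times> 'a" where
  "counit_fib f = (p \<cdot> pl f, pr f, f)"

lemma cat_functor_pullback: "cat_functor base total Pull"
proof (rule cat_functor.intro)
  show "category base" "category total"
    by (simp_all add: category.category_full_sub category_slice)
  fix x y z \<phi> \<psi>
  show "FO Pull x \<in> Obj total" if "x \<in> Obj base"
    using that by (simp add: pullback_fctr_simps)
  show "FA Pull (Id base x) =
      Id total (FO Pull x)" if "x \<in> Obj base"
    using that by (simp add: pullback_fctr_simps(1)) (rule proj_eqI[of x]; simp)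
  assume \<phi>: "\<phi> \<in> hom base x y"
  then obtain h where h: "\<phi> = (x, h, y)" "x \<in> E" "y \<in> E" "Cod C x = Cod C p" "Cod C y = Cod C p"
    "h \<in> Arr C" "Dom C h = Dom C x" "Cod C h = Dom C y" "y \<cdot> h = x"
    by (cases \<phi>) (auto simp: in_hom_iff)
  have sq: "y \<cdot> (h \<cdot> pr x) = p \<cdot> pl x"
    using comp_eq_extend[OF h(9), of "pr x"] h by simp
  then show "FA Pull \<phi> \<in> hom total (FO Pull x) (FO Pull y)"
    using h by (simp add: in_hom_iff pullback_fctr_simps(1))
  assume \<psi>: "\<psi> \<in> hom base y z"
  then obtain k where k: "\<psi> = (y, k, z)" "z \<in> E" "Cod C z = Cod C p"
    "k \<in> Arr C" "Dom C k = Dom C y" "Cod C k = Dom C z" "z \<cdot> k = y"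
    by (cases \<psi>) (auto simp: in_hom_iff)
  have sq': "z \<cdot> (k \<cdot> pr y) = p \<cdot> pl y"
    using comp_eq_extend[OF k(7), of "pr y"] h k by simp
  have kh: "z \<cdot> (k \<cdot> h) = x" "z \<cdot> (k \<cdot> (h \<cdot> pr x)) = p \<cdot> pl x"
    using comp_eq_extend[OF k(7), of h] comp_eq_extend[OF k(7), of "h \<cdot> pr x"] h k sq by simp_all
  show "FA Pull (\<psi> \<cdot>\<^bsub>base\<^esub> \<phi>) =
      FA Pull \<psi> \<cdot>\<^bsub>total\<^esub> FA Pull \<phi>"
    using h k sq sq' kh by (simp add: pullback_fctr_simps(1)) (rule proj_eqI[of z]; simp)
qed

lemma cat_functor_composition: "cat_functor total base Post"
proof (rule cat_functor.intro)
  show "category base" "category total"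
    by (simp_all add: category.category_full_sub category_slice)
  fix x y z \<phi> \<psi>
  show "FO Post x \<in> Obj base" if "x \<in> Obj total"
    using that by simp
  show "FA Post (Id total x) =
      Id base (FO Post x)" if "x \<in> Obj total"
    using that by simp
  assume \<phi>: "\<phi> \<in> hom total x y"
  then obtain h where h: "\<phi> = (x, h, y)" by (cases \<phi>) (auto simp: in_hom_iff)
  show "FA Post \<phi> \<in> hom base (FO Post x)
      (FO Post y)"
    using \<phi> unfolding h by (simp add: in_hom_iff)
  assume \<psi>: "\<psi> \<in> hom total y z"
  then obtain k where k: "\<psi> = (y, k, z)" by (cases \<psi>) (auto simp: in_hom_iff)
  show "FA Post (\<psi> \<cdot>\<^bsub>total\<^esub> \<phi>) =
      FA Post \<psi> \<cdot>\<^bsub>base\<^esub> FA Post \<phi>"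
    unfolding h k by simp
qed

lemma adjunction_composition_pullback:
  "adjunction total base Post Pull
     unit_fib counit_fib"
proof (rule adjunction.intro)
  show "cat_functor total base Post"
    by (rule cat_functor_composition)
  show "cat_functor base total Pull"
    by (rule cat_functor_pullback)
  have cats: "category base" "category total"
    by (simp_all add: category.category_full_sub category_slice)
  show "nat_trans total total id_fctr
      (Pull \<circ>\<^sub>F Post) unit_fib"
  proof (rule nat_trans.intro)
    fix x y \<phi>
    show "unit_fib x \<in> hom total (FO id_fctr x) (FO (Pull \<circ>\<^sub>F Post) x)"
      if "x \<in> Obj total"
      using that by (simp add: in_hom_iff unit_fib_def pullback_fctr_simps(1))
    assume "\<phi> \<in> hom total x y"
    then obtain h where h: "\<phi> = (x, h, y)" "x \<in> E" "y \<in> E" "Cod C x = Dom C p" "Cod C y = Dom C p"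
      "h \<in> Arr C" "Dom C h = Dom C x" "Cod C h = Dom C y" "y \<cdot> h = x"
      by (cases \<phi>) (auto simp: in_hom_iff)
    have sq: "p \<cdot> (y \<cdot> (h \<cdot> pr (p \<cdot> x))) = p \<cdot> pl (p \<cdot> x)"
      using comp_eq_extend[OF h(9), of "pr (p \<cdot> x)"] h by simp
    show "FA (Pull \<circ>\<^sub>F Post) \<phi> \<cdot>\<^bsub>total\<^esub> unit_fib x =
        unit_fib y \<cdot>\<^bsub>total\<^esub> FA id_fctr \<phi>"
      using h sq by (simp add: unit_fib_def) (rule proj_eqI[of "p \<cdot> y"]; simp)
  qed (intro cat_functor_id cat_functor_comp[OF cat_functor_composition cat_functor_pullback] cats)+
  show "nat_trans base base (Post \<circ>\<^sub>F Pull)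
      id_fctr counit_fib"
  proof (rule nat_trans.intro)
    fix x y \<phi>
    show "counit_fib x \<in> hom base (FO (Post \<circ>\<^sub>F Pull) x) (FO id_fctr x)"
      if "x \<in> Obj base"
      using that by (simp add: in_hom_iff counit_fib_def pullback_fctr_simps(1))
    assume "\<phi> \<in> hom base x y"
    then obtain h where h: "\<phi> = (x, h, y)" "x \<in> E" "y \<in> E" "Cod C x = Cod C p" "Cod C y = Cod C p"
      "h \<in> Arr C" "Dom C h = Dom C x" "Cod C h = Dom C y" "y \<cdot> h = x"
      by (cases \<phi>) (auto simp: in_hom_iff)
    have sq: "y \<cdot> (h \<cdot> pr x) = p \<cdot> pl x"
      using comp_eq_extend[OF h(9), of "pr x"] h by simp
    show "FA id_fctr \<phi> \<cdot>\<^bsub>base\<^esub> counit_fib x =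
        counit_fib y \<cdot>\<^bsub>base\<^esub> FA (Post \<circ>\<^sub>F Pull) \<phi>"
      using h sq by (simp add: counit_fib_def)
  qed (intro cat_functor_id cat_functor_comp[OF cat_functor_pullback cat_functor_composition] cats)+
  show "counit_fib (FO Post x) \<cdot>\<^bsub>base\<^esub> FA Post (unit_fib x) =
      Id base (FO Post x)" if "x \<in> Obj total" for x
    using that by (simp add: counit_fib_def unit_fib_def)
  show "FA Pull (counit_fib y) \<cdot>\<^bsub>total\<^esub> unit_fib (FO Pull y) =
      Id total (FO Pull y)" if "y \<in> Obj base" for y
    using that by (simp add: counit_fib_def unit_fib_def pullback_fctr_simps(1)) (rule proj_eqI[of y]; simp)
qed

abbreviation split_monad :: "('a, 'a \<times> 'a \<times> 'a, 'a, 'a \<times> 'a \<times> 'a) fctr" where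
  "split_monad \<equiv> Pull \<circ>\<^sub>F Post"

abbreviation split_mult :: "'a \<Rightarrow> 'a \<times> 'a \<times> 'a" where
  "split_mult x \<equiv> FA Pull (counit_fib (FO Post x))"

abbreviation split_algebras :: "('a \<times> 'a \<times> 'a \<times> 'a, ('a \<times> 'a \<times> 'a \<times> 'a) \<times> ('a \<times> 'a \<times> 'a) \<times> ('a \<times> 'a \<times> 'a \<times> 'a)) cat" where
  "split_algebras \<equiv> EM_cat total split_monad unit_fib split_mult"

abbreviation split_comparison where
  "split_comparison \<equiv> EM_comparison base Pull counit_fib"

lemma pullback_counit:
  assumes "f \<in> E" "Cod C f = Cod C p"
  shows "FA Pull (counit_fib f) =
    (pl (p \<cdot> pl f), med f (pr f \<cdot> pr (p \<cdot> pl f)) (pl (p \<cdot> pl f)), pl f)"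
  using assms by (simp add: counit_fib_def)

lemma comparison_arrow_eq:
  assumes "f \<in> E" "g \<in> E" "Cod C f = Cod C p" "Cod C g = Cod C p" "h \<in> Arr C" "Dom C h = Dom C f"
    "Cod C h = Dom C g" "g \<cdot> h = f"
  shows "FA split_comparison (f, h, g) = (FO split_comparison f,
     (pl f, med g (h \<cdot> pr f) (pl f), pl g), FO split_comparison g)"
  using assms by (simp add: EM_comparison_simps)

text \<open>An arrow \<open>h : f \<rightarrow> g\<close> over the codomain of \<open>p\<close> is recovered from its pullback along \<open>p\<close> by restricting to the
  fibre over the section, that is, by precomposing with \<open>\<langle>1, s f\<rangle>\<close>.\<close>

lemma faithful_split_comparison: "faithful_functor base split_comparison"
  unfolding faithful_functor_def
proof (intro ballI inj_onI)
  fix f g \<phi> \<psi>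
  assume "\<phi> \<in> hom base f g" "\<psi> \<in> hom base f g"
    and eq: "FA split_comparison \<phi> = FA split_comparison \<psi>"
  then obtain h k where h: "\<phi> = (f, h, g)" "\<psi> = (f, k, g)" "f \<in> E" "g \<in> E" "Cod C f = Cod C p"
      "Cod C g = Cod C p" "h \<in> Arr C" "Dom C h = Dom C f" "Cod C h = Dom C g" "g \<cdot> h = f"
      "k \<in> Arr C" "Dom C k = Dom C f" "Cod C k = Dom C g" "g \<cdot> k = f"
    by (cases \<phi>; cases \<psi>) (auto simp: in_hom_iff)
  have sq: "g \<cdot> (h \<cdot> pr f) = p \<cdot> pl f" "g \<cdot> (k \<cdot> pr f) = p \<cdot> pl f"
    using comp_eq_extend[OF h(10), of "pr f"] comp_eq_extend[OF h(14), of "pr f"] h by simp_all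
  have "med g (h \<cdot> pr f) (pl f) = med g (k \<cdot> pr f) (pl f)"
    using eq h by (simp add: comparison_arrow_eq)
  then have "pr g \<cdot> med g (h \<cdot> pr f) (pl f) = pr g \<cdot> med g (k \<cdot> pr f) (pl f)" by simp
  then have "h \<cdot> pr f = k \<cdot> pr f" using h sq by simp
  then have "(h \<cdot> pr f) \<cdot> med f (Id C (Dom C f)) (s \<cdot> f) = (k \<cdot> pr f) \<cdot> med f (Id C (Dom C f)) (s \<cdot> f)"
    by simp
  then show "\<phi> = \<psi>" using h by simp
qed

text \<open>An algebra morphism \<open>p\<^sup>* f \<rightarrow> p\<^sup>* g\<close> maps \<open>(a, e)\<close> to some \<open>(k a e, e)\<close>, and compatibility with the algebra structures
  says that \<open>k a e\<close> does not depend on \<open>e\<close>. Evaluation at \<open>e = s (f a)\<close> therefore descends it.\<close>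

lemma full_split_comparison: "full_functor base split_algebras split_comparison"
  unfolding full_functor_def
proof (intro ballI)
  fix f g \<phi>
  assume fg: "f \<in> Obj base" "g \<in> Obj base"
    and \<phi>: "\<phi> \<in> hom split_algebras (FO split_comparison f) (FO split_comparison g)"
  have f: "f \<in> E" "g \<in> E" "Cod C f = Cod C p" "Cod C g = Cod C p" using fg by auto
  obtain k where \<phi>_eq: "\<phi> = (FO split_comparison f, (pl f, k, pl g), FO split_comparison g)"
    and k: "k \<in> Arr C" "Dom C k = Dom C (pr f)" "Cod C k = Dom C (pr g)" "pl g \<cdot> k = pl f"
    and alg: "(pl f, k, pl g) \<cdot>\<^bsub>total\<^esub> FA Pull (counit_fib f) =
      FA Pull (counit_fib g) \<cdot>\<^bsub>total\<^esub> FA split_monad (pl f, k, pl g)"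
    using \<phi> f by (cases \<phi>) (auto simp: in_hom_iff EM_comparison_simps pullback_fctr_simps(1))
  let ?e = "med f (pr f \<cdot> pr (p \<cdot> pl f)) (pl (p \<cdot> pl f))"
  let ?e' = "med g (pr g \<cdot> pr (p \<cdot> pl g)) (pl (p \<cdot> pl g))"
  let ?Tk = "med (p \<cdot> pl g) (k \<cdot> pr (p \<cdot> pl f)) (pl (p \<cdot> pl f))"
  have Tk: "p \<cdot> (pl g \<cdot> (k \<cdot> pr (p \<cdot> pl f))) = p \<cdot> pl (p \<cdot> pl f)"
    using comp_eq_extend[OF k(4), of "pr (p \<cdot> pl f)"] f k by simp
  have alg': "k \<cdot> ?e = ?e' \<cdot> ?Tk"
    using alg f k by (simp add: pullback_counit)
  \<comment> \<open>\<open>?j\<close> is \<open>a \<mapsto> (a, s (f a))\<close> and \<open>?m\<close> is \<open>(a, e) \<mapsto> ((a, s (f a)), e)\<close>\<close>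
  let ?j = "med f (Id C (Dom C f)) (s \<cdot> f)"
  let ?m = "med (p \<cdot> pl f) (?j \<cdot> pr f) (pl f)"
  define h where "h = pr g \<cdot> (k \<cdot> ?j)"
  have em: "?e \<cdot> ?m = Id C (Dom C (pr f))"
    using f by (simp add: proj_eqI[of f])
  have "pr g \<cdot> k = pr g \<cdot> (k \<cdot> (?e \<cdot> ?m))" using f k em by simp
  also have "\<dots> = pr g \<cdot> ((?e' \<cdot> ?Tk) \<cdot> ?m)" using f k by (simp flip: alg')
  also have "\<dots> = h \<cdot> pr f" using f k Tk by (simp add: h_def)
  finally have hk: "h \<cdot> pr f = pr g \<cdot> k" ..
  have h: "h \<in> Arr C" "Dom C h = Dom C f" "Cod C h = Dom C g" using f k by (simp_all add: h_def)
  have "pl g \<cdot> (k \<cdot> ?j) = s \<cdot> f" using comp_eq_extend[OF k(4), of ?j] f k by simp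
  then have gh: "g \<cdot> h = f" using f k by (simp add: h_def)
  have sq: "g \<cdot> (h \<cdot> pr f) = p \<cdot> pl f" using comp_eq_extend[OF gh, of "pr f"] f h by simp
  have "k = med g (h \<cdot> pr f) (pl f)"
    using f h k sq hk by (intro proj_eqI[of g k "med g (h \<cdot> pr f) (pl f)"]) simp_all
  then have "FA split_comparison (f, h, g) = \<phi>"
    unfolding \<phi>_eq using f h gh by (simp add: comparison_arrow_eq)
  moreover have "(f, h, g) \<in> hom base f g" using f h gh by (simp add: in_hom_iff)
  ultimately show "\<exists>\<psi> \<in> hom base f g. FA split_comparison \<psi> = \<phi>" by blast
qed

text \<open>An algebra structure on \<open>g\<close> is a transport \<open>act d e\<close> of the points \<open>d\<close> of its domain to the fibre over any \<open>e\<close> with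
  \<open>p (g d) = p e\<close>, satisfying \<open>act d (g d) = d\<close> and \<open>act (act d e) e' = act d e'\<close>. Transport to the
  section identifies the domain of \<open>g\<close> with the pullback along \<open>p\<close> of the restriction \<open>f\<close> of \<open>g\<close> to the section: a point \<open>d\<close>
  corresponds to \<open>(act d (s (p (g d))), g d)\<close>, and a pair \<open>(x, e)\<close> to \<open>act x e\<close>.\<close>

lemma split_algebra_is_pullback:
  assumes "(g, \<alpha>) \<in> EM_algebras total split_monad unit_fib split_mult"
  shows "\<exists>f \<in> Obj base. \<exists>\<kappa> \<in> hom split_algebras (FO split_comparison f) (g, \<alpha>).
    is_iso split_algebras \<kappa>"
proof -
  have g: "g \<in> E" "Cod C g = Dom C p"
    and \<alpha>: "\<alpha> \<in> hom total (pl (p \<cdot> g)) g"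
    and unit: "\<alpha> \<cdot>\<^bsub>total\<^esub> unit_fib g = (g, Id C (Dom C g), g)"
    and mult: "\<alpha> \<cdot>\<^bsub>total\<^esub> FA split_monad \<alpha> = \<alpha> \<cdot>\<^bsub>total\<^esub> split_mult g"
    using assms by (auto simp: EM_algebras_def pullback_fctr_simps(1))
  obtain a where \<alpha>_eq: "\<alpha> = (pl (p \<cdot> g), a, g)"
    and a: "a \<in> Arr C" "Dom C a = Dom C (pr (p \<cdot> g))" "Cod C a = Dom C g" "g \<cdot> a = pl (p \<cdot> g)"
    using \<alpha> by (cases \<alpha>) (auto simp: in_hom_iff)
  define act where "act d e = a \<cdot> med (p \<cdot> g) d e" for d e
  have act [simp]: "act d e \<in> Arr C" "Dom C (act d e) = Dom C d" "Cod C (act d e) = Dom C g"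
    "g \<cdot> act d e = e"
    if "d \<in> Arr C" "e \<in> Arr C" "Dom C e = Dom C d" "Cod C d = Dom C g" "Cod C e = Dom C p"
      "p \<cdot> (g \<cdot> d) = p \<cdot> e" for d e
    using that g a comp_eq_extend[OF a(4), of "med (p \<cdot> g) d e"] by (simp_all add: act_def)
  have "a \<cdot> med (p \<cdot> g) (Id C (Dom C g)) g = Id C (Dom C g)"
    using unit g a by (simp add: unit_fib_def \<alpha>_eq)
  from comp_eq_extend[OF this] have act_unit: "act d (g \<cdot> d) = d" if "d \<in> Arr C" "Cod C d = Dom C g" for d
    using that g a by (simp add: act_def med_precomp)
  let ?gg = "p \<cdot> pl (p \<cdot> g)"
  have sq: "p \<cdot> (g \<cdot> (a \<cdot> pr ?gg)) = p \<cdot> pl ?gg"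
    using comp_eq_extend[OF a(4), of "pr ?gg"] g a by simp
  have mult': "a \<cdot> med (p \<cdot> g) (a \<cdot> pr ?gg) (pl ?gg) = a \<cdot> med (p \<cdot> g) (pr (p \<cdot> g) \<cdot> pr ?gg) (pl ?gg)"
    using mult g a by (simp add: \<alpha>_eq pullback_counit)
  have act_act: "act (act d e) e' = act d e'"
    if d: "d \<in> Arr C" "e \<in> Arr C" "e' \<in> Arr C" "Dom C e = Dom C d" "Dom C e' = Dom C d"
      "Cod C d = Dom C g" "Cod C e = Dom C p" "Cod C e' = Dom C p"
      "p \<cdot> (g \<cdot> d) = p \<cdot> e" "p \<cdot> e = p \<cdot> e'" for d e e'
  proof -
    let ?m = "med ?gg (med (p \<cdot> g) d e) e'"
    have m: "?m \<in> Arr C" "Dom C ?m = Dom C d" "Cod C ?m = Dom C (pr ?gg)" "pr ?gg \<cdot> ?m = med (p \<cdot> g) d e"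
      "pl ?gg \<cdot> ?m = e'"
      using g d by simp_all
    have "(a \<cdot> med (p \<cdot> g) (a \<cdot> pr ?gg) (pl ?gg)) \<cdot> ?m = act (act d e) e'"
      using g a d m sq by (simp add: med_precomp act_def)
    moreover have "(a \<cdot> med (p \<cdot> g) (pr (p \<cdot> g) \<cdot> pr ?gg) (pl ?gg)) \<cdot> ?m = act d e'"
      using g a d m by (simp add: med_precomp act_def)
    ultimately show ?thesis using mult' by simp
  qed
  define i f where "i = fst (pb C g s)" and "f = snd (pb C g s)"
  have pb: "is_pullback C g s i f" and f_fib: "f \<in> E"
    unfolding i_def f_def using fib_pullback[of g s] g by simp_all
  have if_arr [simp]: "i \<in> Arr C" "Cod C i = Dom C g" "Dom C f = Dom C i" "Cod C f = Cod C p"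
    "g \<cdot> i = s \<cdot> f" "f \<in> Arr C"
    using is_pullbackD[OF pb] by simp_all
  have gi [simp]: "g \<cdot> (i \<cdot> x) = s \<cdot> (f \<cdot> x)" if "x \<in> Arr C" "Cod C x = Dom C i" for x
    using comp_eq_extend[OF if_arr(5)] g f_fib that by simp
  define k where "k = act (i \<cdot> pr f) (pl f)"
  have k [simp]: "k \<in> Arr C" "Dom C k = Dom C (pr f)" "Cod C k = Dom C g" "g \<cdot> k = pl f"
    using g f_fib by (simp_all add: k_def)
  have act_comp: "act d e \<cdot> x = act (d \<cdot> x) (e \<cdot> x)"
    if "d \<in> Arr C" "e \<in> Arr C" "Dom C e = Dom C d" "Cod C d = Dom C g" "Cod C e = Dom C p"
      "p \<cdot> (g \<cdot> d) = p \<cdot> e" "x \<in> Arr C" "Cod C x = Dom C d" for d e x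
    using that g a by (simp add: act_def med_precomp)
  define y where "y = act (Id C (Dom C g)) (s \<cdot> (p \<cdot> g))"
  have y: "y \<in> Arr C" "Dom C y = Dom C g" "Cod C y = Dom C g" "g \<cdot> y = s \<cdot> (p \<cdot> g)"
    using g by (simp_all add: y_def)
  obtain c where c: "c \<in> Arr C" "Dom C c = Dom C g" "Cod C c = Dom C i" "i \<cdot> c = y" "f \<cdot> c = p \<cdot> g"
    using is_pullback_factor[OF pb, of y "Dom C g" "p \<cdot> g"] g y by (auto simp: in_hom_iff)
  define k' where "k' = med f c g"
  have k' [simp]: "k' \<in> Arr C" "Dom C k' = Dom C g" "Cod C k' = Dom C (pr f)" "pr f \<cdot> k' = c" "pl f \<cdot> k' = g"
    using g c f_fib by (simp_all add: k'_def)
  have kk': "k \<cdot> k' = Id C (Dom C g)"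
    using act_act[of "Id C (Dom C g)" "s \<cdot> (p \<cdot> g)" g] act_unit[of "Id C (Dom C g)"] g f_fib c
    by (simp add: k_def act_comp flip: y_def)
  have gk: "g \<cdot> (k \<cdot> x) = pl f \<cdot> x" if "x \<in> Arr C" "Cod C x = Dom C (pr f)" for x
    using comp_eq_extend[OF k(4), of x] that g by simp
  have "c \<cdot> k = pr f"
  proof (rule is_pullback_jointly_monic[OF pb, of _ "Dom C (pr f)"])
    show "f \<cdot> (c \<cdot> k) = f \<cdot> pr f"
      using comp_eq_extend[OF c(5), of k] g c f_fib by simp
    have "i \<cdot> (c \<cdot> k) = y \<cdot> k" using comp_eq_extend[OF c(4), of k] g c by simp
    also have "\<dots> = act k (s \<cdot> (p \<cdot> pl f))" using g f_fib by (simp add: y_def act_comp)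
    also have "\<dots> = act (i \<cdot> pr f) (s \<cdot> (p \<cdot> pl f))"
      unfolding k_def using g f_fib by (intro act_act) simp_all
    also have "s \<cdot> (p \<cdot> pl f) = g \<cdot> (i \<cdot> pr f)" using g f_fib by simp
    also have "act (i \<cdot> pr f) (g \<cdot> (i \<cdot> pr f)) = i \<cdot> pr f" by (rule act_unit) (use f_fib in simp_all)
    finally show "i \<cdot> (c \<cdot> k) = i \<cdot> pr f" .
  qed (use f_fib c in \<open>simp_all add: in_hom_iff\<close>)
  then have k'k: "k' \<cdot> k = Id C (Dom C (pr f))"
    using g f_fib c by (simp add: k'_def proj_eqI[of f])
  have "k \<cdot> med f (pr f \<cdot> pr (p \<cdot> pl f)) (pl (p \<cdot> pl f)) = act (i \<cdot> (pr f \<cdot> pr (p \<cdot> pl f))) (pl (p \<cdot> pl f))"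
    using g f_fib by (simp add: k_def act_comp)
  also have "\<dots> = act (act (i \<cdot> (pr f \<cdot> pr (p \<cdot> pl f))) (pl f \<cdot> pr (p \<cdot> pl f))) (pl (p \<cdot> pl f))"
    using g f_fib by (intro act_act[symmetric]) simp_all
  also have "\<dots> = act (k \<cdot> pr (p \<cdot> pl f)) (pl (p \<cdot> pl f))"
    using g f_fib by (simp add: k_def act_comp)
  finally have hom: "k \<cdot> med f (pr f \<cdot> pr (p \<cdot> pl f)) (pl (p \<cdot> pl f)) =
    a \<cdot> med (p \<cdot> g) (k \<cdot> pr (p \<cdot> pl f)) (pl (p \<cdot> pl f))"
    by (simp add: act_def)
  have alg: "FO split_comparison f \<in> EM_algebras total split_monad unit_fib split_mult"
    using cat_functor.FO_obj[OF cat_functor_EM_comparison[OF adjunction_composition_pullback], of f] f_fib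
    by simp
  let ?\<kappa> = "(FO split_comparison f, (pl f, k, g), (g, \<alpha>))"
  have \<kappa>: "?\<kappa> \<in> Arr split_algebras"
    using alg assms g f_fib a gk hom
    by (simp add: EM_comparison_simps pullback_fctr_simps(1) in_hom_iff \<alpha>_eq pullback_counit)
  have "is_inverse total (pl f, k, g) (g, k', pl f)"
    using g f_fib kk' k'k by (simp add: is_inverse_def in_hom_iff)
  then have "is_iso split_algebras ?\<kappa>"
    using category.EM_iso[of "total" split_monad] \<kappa>
      cat_functor_comp[OF cat_functor_composition cat_functor_pullback] category_slice
    unfolding is_iso_def EM_comparison_simps
    by (meson category.category_full_sub)
  moreover have "?\<kappa> \<in> hom split_algebras (FO split_comparison f) (g, \<alpha>)"
    unfolding in_hom_iff using \<kappa> by (simp del: EM_cat_simps(2))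
  moreover have "f \<in> Obj base" using f_fib by simp
  ultimately show ?thesis by blast
qed

theorem monadic_pullback_split:
  "monadic_functor base total Pull"
proof -
  have "equivalence_functor base split_algebras split_comparison"
    using cat_functor_EM_comparison[OF adjunction_composition_pullback] full_split_comparison
      faithful_split_comparison split_algebra_is_pullback
    by (intro equivalence_functorI) auto
  then show ?thesis unfolding monadic_functor_def using adjunction_composition_pullback by blast
qed

end

section \<open>Limits in a reflective subcategory\<close>

locale reflective_galois = pointed_category C for C :: "('o, 'a) cat" (structure) +
  fixes \<Gamma> :: "('o, 'a, 'o, 'a) galois" and S :: "'o set"
  assumes galois: "galois_structure \<Gamma>" and gC [simp]: "gC \<Gamma> = C"
    and gX [simp]: "gX \<Gamma> = full_sub C S" and gH [simp]: "gH \<Gamma> = id_fctr"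
    and S_obj: "S \<subseteq> Obj C" and complete: "finitely_complete C"
begin

abbreviation X :: "('o, 'a) cat" where "X \<equiv> full_sub C S"
abbreviation I :: "'a \<Rightarrow> 'a" where "I \<equiv> FA (gI \<Gamma>)"
abbreviation Io :: "'o \<Rightarrow> 'o" where "Io \<equiv> FO (gI \<Gamma>)"
abbreviation \<eta> :: "'o \<Rightarrow> 'a" where "\<eta> \<equiv> g\<eta> \<Gamma>"
abbreviation \<epsilon> :: "'o \<Rightarrow> 'a" where "\<epsilon> \<equiv> g\<epsilon> \<Gamma>"

lemma S_obj_simp [simp]: "A \<in> S \<Longrightarrow> A \<in> Obj C"
  using S_obj by auto

lemma Obj_X [simp]: "Obj C \<inter> S = S"
  using S_obj by auto

lemma hom_X: "A \<in> S \<Longrightarrow> B \<in> S \<Longrightarrow> hom X A B = hom C A B"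
  by (auto simp: in_hom_iff)

lemma reflection: "adjunction C X (gI \<Gamma>) id_fctr \<eta> \<epsilon>"
  using galois_structure.adj[OF galois] by simp

lemma I_S [simp]: "A \<in> Obj C \<Longrightarrow> Io A \<in> S"
  and I_arr [simp]: "f \<in> Arr C \<Longrightarrow> I f \<in> Arr C"
  and dom_I [simp]: "f \<in> Arr C \<Longrightarrow> Dom C (I f) = Io (Dom C f)"
  and cod_I [simp]: "f \<in> Arr C \<Longrightarrow> Cod C (I f) = Io (Cod C f)"
  and I_id [simp]: "A \<in> Obj C \<Longrightarrow> I (Id C A) = Id C (Io A)"
  and I_comp [simp]: "f \<in> Arr C \<Longrightarrow> g \<in> Arr C \<Longrightarrow> Cod C f = Dom C g \<Longrightarrow> I (g \<cdot> f) = I g \<cdot> I f"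
proof -
  interpret I: cat_functor C X "gI \<Gamma>" using reflection by (rule adjunction.left_functor)
  show "A \<in> Obj C \<Longrightarrow> Io A \<in> S" using I.FO_obj by simp
  show "f \<in> Arr C \<Longrightarrow> I f \<in> Arr C" using I.FA_arr by simp
  show "f \<in> Arr C \<Longrightarrow> Dom C (I f) = Io (Dom C f)" using I.dom_FA by simp
  show "f \<in> Arr C \<Longrightarrow> Cod C (I f) = Io (Cod C f)" using I.cod_FA by simp
  show "A \<in> Obj C \<Longrightarrow> I (Id C A) = Id C (Io A)" using I.FA_id by simp
  show "f \<in> Arr C \<Longrightarrow> g \<in> Arr C \<Longrightarrow> Cod C f = Dom C g \<Longrightarrow> I (g \<cdot> f) = I g \<cdot> I f"
    using I.FA_comp_simp by simp
qed

lemma unit_arr [simp]: "A \<in> Obj C \<Longrightarrow> \<eta> A \<in> Arr C"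
  and dom_unit [simp]: "A \<in> Obj C \<Longrightarrow> Dom C (\<eta> A) = A"
  and cod_unit [simp]: "A \<in> Obj C \<Longrightarrow> Cod C (\<eta> A) = Io A"
  and unit_naturality: "f \<in> Arr C \<Longrightarrow> Cod C f = B \<Longrightarrow> \<eta> B \<cdot> f = I f \<cdot> \<eta> (Dom C f)"
proof -
  interpret \<eta>: nat_trans C C id_fctr "id_fctr \<circ>\<^sub>F gI \<Gamma>" \<eta> using reflection by (rule adjunction.unit_natural)
  show "A \<in> Obj C \<Longrightarrow> \<eta> A \<in> Arr C" "A \<in> Obj C \<Longrightarrow> Dom C (\<eta> A) = A" "A \<in> Obj C \<Longrightarrow> Cod C (\<eta> A) = Io A"
    using \<eta>.component_arr \<eta>.dom_component \<eta>.cod_component by simp_all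
  show "f \<in> Arr C \<Longrightarrow> Cod C f = B \<Longrightarrow> \<eta> B \<cdot> f = I f \<cdot> \<eta> (Dom C f)" using \<eta>.naturality_arr[of f] by simp
qed

lemma unit_naturality_comp:
  assumes "f \<in> Arr C" "Cod C f = B" "x \<in> Arr C" "Cod C x = Dom C f"
  shows "\<eta> B \<cdot> (f \<cdot> x) = I f \<cdot> (\<eta> (Dom C f) \<cdot> x)"
  using comp_eq_extend[OF unit_naturality[OF assms(1,2)]] assms by auto

lemma reflect:
  assumes "r \<in> Arr C" "Dom C r = A" "Cod C r \<in> S"
  obtains r' where "r' \<in> Arr C" "Dom C r' = Io A" "Cod C r' = Cod C r" "r' \<cdot> \<eta> A = r"
proof -
  interpret adjunction C X "gI \<Gamma>" id_fctr \<eta> \<epsilon> by (rule reflection)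
  interpret \<epsilon>: nat_trans X X "gI \<Gamma> \<circ>\<^sub>F id_fctr" id_fctr \<epsilon> by (rule counit_natural)
  have \<epsilon>: "\<epsilon> B \<in> Arr C" "Dom C (\<epsilon> B) = Io B" "Cod C (\<epsilon> B) = B" "\<epsilon> B \<cdot> \<eta> B = Id C B" if "B \<in> S" for B
    using that \<epsilon>.component[of B] triangle_right[of B] by (simp_all add: in_hom_iff)
  have "(\<epsilon> (Cod C r) \<cdot> I r) \<cdot> \<eta> A = (\<epsilon> (Cod C r) \<cdot> \<eta> (Cod C r)) \<cdot> r"
    using assms \<epsilon>(1-3)[OF assms(3)] by (auto simp: unit_naturality)
  then show thesis
    using that[of "\<epsilon> (Cod C r) \<cdot> I r"] assms \<epsilon>[OF assms(3)] by auto
qed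

lemma reflect_unique:
  assumes r: "r \<in> Arr C" "r' \<in> Arr C" "Dom C r = Io A" "Dom C r' = Io A" "Cod C r = B" "Cod C r' = B"
    "B \<in> S" "A \<in> Obj C" and eq: "r \<cdot> \<eta> A = r' \<cdot> \<eta> A"
  shows "r = r'"
proof -
  interpret adjunction C X "gI \<Gamma>" id_fctr \<eta> \<epsilon> by (rule reflection)
  interpret \<epsilon>: nat_trans X X "gI \<Gamma> \<circ>\<^sub>F id_fctr" id_fctr \<epsilon> by (rule counit_natural)
  have \<epsilon>: "\<epsilon> B \<in> Arr C" "Dom C (\<epsilon> B) = Io B" "Cod C (\<epsilon> B) = B" if "B \<in> S" for B
    using that \<epsilon>.component[of B] by (simp_all add: in_hom_iff)
  have "x = \<epsilon> B \<cdot> I (x \<cdot> \<eta> A)" if x: "x \<in> Arr C" "Dom C x = Io A" "Cod C x = B" for x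
  proof -
    have nat: "\<epsilon> B \<cdot> I x = x \<cdot> \<epsilon> (Io A)"
      using \<epsilon>.naturality_arr[of x] x r by simp
    have "\<epsilon> B \<cdot> I (x \<cdot> \<eta> A) = (\<epsilon> B \<cdot> I x) \<cdot> I (\<eta> A)"
      using x r \<epsilon>[of B] by simp
    also have "\<dots> = x \<cdot> (\<epsilon> (Io A) \<cdot> I (\<eta> A))"
      unfolding nat using x r \<epsilon>[of "Io A"] by simp
    finally show ?thesis using triangle_left[of A] x r by simp
  qed
  from this[of r] this[of r'] show ?thesis using r eq by metis
qed

text \<open>The reflection \<open>I P\<close> of a pullback \<open>P\<close> of objects of \<open>X\<close> admits projections as well, so it retracts
  onto \<open>P\<close>, and a retraction of a unit component is an inverse of it.\<close>

lemma unit_invertible_on_pullback: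
  assumes pb: "is_pullback C f g p q" and fg: "Dom C f \<in> S" "Dom C g \<in> S" "Cod C f \<in> S"
  obtains r where "r \<in> Arr C" "Dom C r = Io (Dom C p)" "Cod C r = Dom C p"
    "r \<cdot> \<eta> (Dom C p) = Id C (Dom C p)" "\<eta> (Dom C p) \<cdot> r = Id C (Io (Dom C p))"
proof -
  note pq = is_pullbackD[OF pb]
  let ?P = "Dom C p"
  have P: "?P \<in> Obj C" using pq by simp
  obtain p' where p': "p' \<in> Arr C" "Dom C p' = Io ?P" "Cod C p' = Dom C f" "p' \<cdot> \<eta> ?P = p"
    by (rule reflect[of p ?P]) (use pq fg in auto)
  obtain q' where q': "q' \<in> Arr C" "Dom C q' = Io ?P" "Cod C q' = Dom C g" "q' \<cdot> \<eta> ?P = q"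
    by (rule reflect[of q ?P]) (use pq fg in auto)
  have sq: "f \<cdot> p' = g \<cdot> q'"
    by (rule reflect_unique[of _ _ ?P "Cod C f"]) (use pq fg p' q' P in simp_all)
  obtain r where r: "r \<in> hom C (Io ?P) ?P" "p \<cdot> r = p'" "q \<cdot> r = q'"
    by (rule is_pullback_factor[OF pb, of p' "Io ?P" q']) (use p' q' sq in \<open>simp_all add: in_hom_iff\<close>)
  have r': "r \<in> Arr C" "Dom C r = Io ?P" "Cod C r = ?P" using r by (auto simp: in_hom_iff)
  have r\<eta>: "r \<cdot> \<eta> ?P = Id C ?P"
    by (rule is_pullback_jointly_monic[OF pb, of _ ?P])
      (use r' P pq p' q' comp_eq_extend[OF r(2), of "\<eta> ?P"] comp_eq_extend[OF r(3), of "\<eta> ?P"]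
        in \<open>simp_all add: in_hom_iff\<close>)
  have "\<eta> ?P \<cdot> r = Id C (Io ?P)"
    by (rule reflect_unique[of _ _ ?P "Io ?P"]) (use r' P r\<eta> in simp_all)
  then show thesis using that r' r\<eta> by blast
qed

lemma pullback_in_X_exists:
  assumes fg: "f \<in> Arr X" "g \<in> Arr X" "Cod C f = Cod C g"
  shows "\<exists>p q. is_pullback X f g p q"
proof -
  have fg': "f \<in> Arr C" "g \<in> Arr C" "Dom C f \<in> S" "Dom C g \<in> S" "Cod C f \<in> S"
    using fg by auto
  obtain p q where pb: "is_pullback C f g p q"
    using finitely_complete_pullback[OF complete fg'(1,2) fg(3)] by blast
  note pq = is_pullbackD[OF pb]
  let ?P = "Dom C p"
  have P: "?P \<in> Obj C" using pq by simp
  obtain r where r: "r \<in> Arr C" "Dom C r = Io ?P" "Cod C r = ?P" "r \<cdot> \<eta> ?P = Id C ?P"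
    "\<eta> ?P \<cdot> r = Id C (Io ?P)"
    by (rule unit_invertible_on_pullback[OF pb]) (use fg' in auto)
  have r_comp: "r \<cdot> (\<eta> ?P \<cdot> x) = x" if "x \<in> Arr C" "Cod C x = ?P" for x
    using comp_eq_extend[OF r(4), of x] r(1-3) P that by simp
  interpret X: category X by (rule category_full_sub)
  have "is_pullback X f g (p \<cdot> r) (q \<cdot> r)"
  proof (rule X.is_pullbackI)
    have "f \<cdot> (p \<cdot> r) = g \<cdot> (q \<cdot> r)" using comp_eq_extend[OF pq(9), of r] pq(1-8) r(1-3) by simp
    then show "f \<cdot>\<^bsub>X\<^esub> (p \<cdot> r) = g \<cdot>\<^bsub>X\<^esub> (q \<cdot> r)" by simp
    show "\<exists>h. h \<in> hom X T (Dom X (p \<cdot> r)) \<and> (p \<cdot> r) \<cdot>\<^bsub>X\<^esub> h = a \<and> (q \<cdot> r) \<cdot>\<^bsub>X\<^esub> h = b"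
      if ab: "a \<in> hom X T (Dom X f)" "b \<in> hom X T (Dom X g)" "f \<cdot>\<^bsub>X\<^esub> a = g \<cdot>\<^bsub>X\<^esub> b" for T a b
    proof -
      obtain h where h: "h \<in> hom C T ?P" "p \<cdot> h = a" "q \<cdot> h = b"
        by (rule is_pullback_factor[OF pb, of a T b]) (use ab in \<open>auto simp: in_hom_iff\<close>)
      then have "h \<in> Arr C" "Dom C h = T" "Cod C h = ?P" by (simp_all add: in_hom_iff)
      moreover have "T \<in> S" using ab by (auto simp: in_hom_iff)
      ultimately show ?thesis
        using h(2,3) P r(1-3) r_comp[of h] pq(4-8) by (intro exI[of _ "\<eta> ?P \<cdot> h"]) (simp add: in_hom_iff)
    qed
    show "h = h'" if h: "h \<in> hom X T (Dom X (p \<cdot> r))" "h' \<in> hom X T (Dom X (p \<cdot> r))"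
      "(p \<cdot> r) \<cdot>\<^bsub>X\<^esub> h = (p \<cdot> r) \<cdot>\<^bsub>X\<^esub> h'" "(q \<cdot> r) \<cdot>\<^bsub>X\<^esub> h = (q \<cdot> r) \<cdot>\<^bsub>X\<^esub> h'" for T h h'
    proof -
      have h': "h \<in> Arr C" "h' \<in> Arr C" "Dom C h = T" "Dom C h' = T" "Cod C h = Io ?P" "Cod C h' = Io ?P"
        using h(1,2) r(1-3) pq(4-8) by (auto simp: in_hom_iff)
      have "r \<cdot> h = r \<cdot> h'"
        by (rule is_pullback_jointly_monic[OF pb, of _ T])
          (use h(3,4) h' r(1-3) pq(4-8) in \<open>simp_all add: in_hom_iff\<close>)
      then have "\<eta> ?P \<cdot> (r \<cdot> h) = \<eta> ?P \<cdot> (r \<cdot> h')" by simp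
      then show ?thesis using comp_eq_extend[OF r(5)] h' r(1-3) P by simp
    qed
  qed (use fg fg' pq(4-8) r(1-3) P in simp_all)
  then show ?thesis by blast
qed

text \<open>The square makes a fibration a trivial covering. Invariance under isomorphisms of the domain serves for the interchange
  of the factors of a kernel pair, and for the comparison of an arbitrary pullback with the chosen one.\<close>

lemma unit_square_iso:
  assumes sq: "is_pullback C (I f) (\<eta> (Cod C f)) (\<eta> (Dom C f)) f"
    and \<theta>: "\<theta> \<in> Arr C" "\<theta>' \<in> Arr C" "Cod C \<theta> = Dom C f" "Dom C \<theta>' = Dom C f" "Cod C \<theta>' = Dom C \<theta>"
      "\<theta>' \<cdot> \<theta> = Id C (Dom C \<theta>)" "\<theta> \<cdot> \<theta>' = Id C (Dom C f)"
  shows "is_pullback C (I (f \<cdot> \<theta>)) (\<eta> (Cod C f)) (\<eta> (Dom C \<theta>)) (f \<cdot> \<theta>)"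
proof (rule is_pullbackI)
  have f: "f \<in> Arr C" using is_pullbackD[OF sq] by simp
  let ?A = "Dom C \<theta>" and ?A' = "Dom C f"
  have \<theta>_comp: "\<theta>' \<cdot> (\<theta> \<cdot> x) = x" if "x \<in> Arr C" "Cod C x = ?A" for x
    using comp_eq_extend[OF \<theta>(6)] that \<theta> by simp
  have \<theta>'_comp: "\<theta> \<cdot> (\<theta>' \<cdot> x) = x" if "x \<in> Arr C" "Cod C x = ?A'" for x
    using comp_eq_extend[OF \<theta>(7)] that \<theta> by simp
  have "I \<theta>' \<cdot> I \<theta> = Id C (Io ?A)" using \<theta> by (simp flip: I_comp)
  then have I\<theta>: "I \<theta>' \<cdot> (I \<theta> \<cdot> x) = x" if "x \<in> Arr C" "Cod C x = Io ?A" for x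
    using comp_eq_extend[of "I \<theta>'" "I \<theta>" _ x] that \<theta>(1-5) by simp
  show "I (f \<cdot> \<theta>) \<cdot> \<eta> ?A = \<eta> (Cod C f) \<cdot> (f \<cdot> \<theta>)" using f \<theta>(1-5) unit_naturality[of "f \<cdot> \<theta>"] by simp
  show "\<exists>h. h \<in> hom C T (Dom C (\<eta> ?A)) \<and> \<eta> ?A \<cdot> h = r \<and> (f \<cdot> \<theta>) \<cdot> h = e"
    if re: "r \<in> hom C T (Dom C (I (f \<cdot> \<theta>)))" "e \<in> hom C T (Dom C (\<eta> (Cod C f)))"
      "I (f \<cdot> \<theta>) \<cdot> r = \<eta> (Cod C f) \<cdot> e" for T r e
  proof -
    have r: "r \<in> Arr C" "Dom C r = T" "Cod C r = Io ?A" "e \<in> Arr C" "Dom C e = T" "Cod C e = Cod C f"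
      using re f \<theta>(1-5) by (simp_all add: in_hom_iff)
    obtain x where x: "x \<in> hom C T (Dom C (\<eta> ?A'))" "\<eta> ?A' \<cdot> x = I \<theta> \<cdot> r" "f \<cdot> x = e"
      by (rule is_pullback_factor[OF sq, of "I \<theta> \<cdot> r" T e])
        (use re(3) r f \<theta>(1-5) in \<open>simp_all add: in_hom_iff\<close>)
    have x': "x \<in> Arr C" "Dom C x = T" "Cod C x = ?A'" using x(1) f by (simp_all add: in_hom_iff)
    have "\<eta> ?A \<cdot> (\<theta>' \<cdot> x) = I \<theta>' \<cdot> (\<eta> ?A' \<cdot> x)" using \<theta>(1-5) x' by (simp add: unit_naturality_comp)
    also have "\<dots> = r" unfolding x(2) using I\<theta> r by simp
    finally show ?thesis
      using f \<theta>(1-5) x' x(3) \<theta>'_comp by (intro exI[of _ "\<theta>' \<cdot> x"]) (simp add: in_hom_iff)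
  qed
  show "x = y" if xy: "x \<in> hom C T (Dom C (\<eta> ?A))" "y \<in> hom C T (Dom C (\<eta> ?A))"
    and eq: "\<eta> ?A \<cdot> x = \<eta> ?A \<cdot> y" "(f \<cdot> \<theta>) \<cdot> x = (f \<cdot> \<theta>) \<cdot> y" for T x y
  proof -
    have x: "x \<in> Arr C" "Dom C x = T" "Cod C x = ?A" "y \<in> Arr C" "Dom C y = T" "Cod C y = ?A"
      using xy \<theta>(1-5) by (simp_all add: in_hom_iff)
    have "\<theta> \<cdot> x = \<theta> \<cdot> y"
      by (rule is_pullback_jointly_monic[OF sq, of _ T])
        (use x f \<theta>(1-5) eq in \<open>simp_all add: in_hom_iff unit_naturality_comp\<close>)
    then have "\<theta>' \<cdot> (\<theta> \<cdot> x) = \<theta>' \<cdot> (\<theta> \<cdot> y)" by simp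
    then show ?thesis using \<theta>_comp x by simp
  qed
qed (use is_pullbackD[OF sq] \<theta>(1-5) in simp_all)

text \<open>An arrow into an object of \<open>X\<close> factors through the reflection of its domain, so universal properties
  tested on objects of \<open>X\<close> hold for all objects.\<close>

lemma pullback_X_to_C:
  assumes pb: "is_pullback X f g p q"
  shows "is_pullback C f g p q"
proof (rule is_pullbackI)
  interpret X: category X by (rule category_full_sub)
  have pq: "f \<in> Arr C" "g \<in> Arr C" "p \<in> Arr C" "q \<in> Arr C" "Cod C f = Cod C g" "Dom C q = Dom C p"
    "Cod C p = Dom C f" "Cod C q = Dom C g" "f \<cdot> p = g \<cdot> q" "Dom C f \<in> S" "Dom C g \<in> S" "Cod C g \<in> S"
    "Dom C p \<in> S"
    using is_pullbackD[OF pb] by auto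
  then show "f \<in> Arr C" "g \<in> Arr C" "Cod C f = Cod C g" "p \<in> Arr C" "q \<in> Arr C" "Dom C q = Dom C p"
    "Cod C p = Dom C f" "Cod C q = Dom C g" "f \<cdot> p = g \<cdot> q" by auto
  show "\<exists>h. h \<in> hom C T (Dom C p) \<and> p \<cdot> h = a \<and> q \<cdot> h = b"
    if ab: "a \<in> hom C T (Dom C f)" "b \<in> hom C T (Dom C g)" "f \<cdot> a = g \<cdot> b" for T a b
  proof -
    have T: "T \<in> Obj C" using ab by (auto simp: in_hom_iff)
    obtain a' where a': "a' \<in> Arr C" "Dom C a' = Io T" "Cod C a' = Dom C f" "a' \<cdot> \<eta> T = a"
      by (rule reflect[of a T]) (use pq ab in \<open>auto simp: in_hom_iff\<close>)
    obtain b' where b': "b' \<in> Arr C" "Dom C b' = Io T" "Cod C b' = Dom C g" "b' \<cdot> \<eta> T = b"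
      by (rule reflect[of b T]) (use pq ab in \<open>auto simp: in_hom_iff\<close>)
    have sq: "f \<cdot> a' = g \<cdot> b'"
      by (rule reflect_unique[of _ _ T "Cod C g"]) (use pq ab a' b' T in simp_all)
    obtain h where h: "h \<in> hom X (Io T) (Dom X p)" "p \<cdot>\<^bsub>X\<^esub> h = a'" "q \<cdot>\<^bsub>X\<^esub> h = b'"
      by (rule is_pullback_factor[OF pb, of a' "Io T" b'])
        (use a' b' T sq pq in \<open>simp_all add: in_hom_iff\<close>)
    then show ?thesis
      using T pq a' b' comp_eq_extend[of p h a' "\<eta> T"] comp_eq_extend[of q h b' "\<eta> T"]
      by (intro exI[of _ "h \<cdot> \<eta> T"]) (auto simp: in_hom_iff)
  qed
  show "h = h'" if h: "h \<in> hom C T (Dom C p)" "h' \<in> hom C T (Dom C p)" "p \<cdot> h = p \<cdot> h'" "q \<cdot> h = q \<cdot> h'"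
    for T h h'
  proof -
    have T: "T \<in> Obj C" using h by (auto simp: in_hom_iff)
    obtain k where k: "k \<in> Arr C" "Dom C k = Io T" "Cod C k = Dom C p" "k \<cdot> \<eta> T = h"
      by (rule reflect[of h T]) (use pq h in \<open>auto simp: in_hom_iff\<close>)
    obtain k' where k': "k' \<in> Arr C" "Dom C k' = Io T" "Cod C k' = Dom C p" "k' \<cdot> \<eta> T = h'"
      by (rule reflect[of h' T]) (use pq h in \<open>auto simp: in_hom_iff\<close>)
    have "p \<cdot> k = p \<cdot> k'"
      by (rule reflect_unique[of _ _ T "Dom C f"]) (use pq h k k' T in simp_all)
    moreover have "q \<cdot> k = q \<cdot> k'"
      by (rule reflect_unique[of _ _ T "Dom C g"]) (use pq h k k' T in simp_all)
    ultimately have "k = k'"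
      by (intro X.is_pullback_jointly_monic[OF pb, of k "Io T" k'])
        (use k k' T pq in \<open>simp_all add: in_hom_iff\<close>)
    then show ?thesis using k k' by simp
  qed
qed

text \<open>For a zero object \<open>Z\<close>, the composite \<open>I Z \<rightarrow> Z \<rightarrow> I Z\<close> agrees with the identity after \<open>\<eta>\<^sub>Z\<close>; so \<open>I Z\<close> is
  isomorphic to \<open>Z\<close>.\<close>

lemma zero_object_in_S:
  obtains Z where "is_zero_object C Z" "is_zero_object X Z" "Z \<in> S"
proof -
  obtain Z where Z: "is_zero_object C Z" using pointed by (auto simp: pointed_def)
  then have ZO: "Z \<in> Obj C" by (simp add: is_zero_object_def)
  let ?t = "zero_arr C (Io Z) Z"
  have t: "?t \<in> Arr C" "Dom C ?t = Io Z" "Cod C ?t = Z" using ZO by simp_all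
  have t1: "?t \<cdot> \<eta> Z = Id C Z"
    using zero_arr_unique_to[OF Z, of "?t \<cdot> \<eta> Z" Z] zero_arr_unique_to[OF Z, of "Id C Z" Z] t ZO
    by (simp add: in_hom_iff)
  have t2: "\<eta> Z \<cdot> ?t = Id C (Io Z)"
    by (rule reflect_unique[of _ _ Z "Io Z"]) (use t t1 ZO in \<open>simp_all del: comp_zero zero_comp\<close>)
  have from_IZ: "\<exists>!f. f \<in> hom C (Io Z) A" if A: "A \<in> Obj C" for A
  proof (rule ex1I)
    show "zero_arr C (Io Z) A \<in> hom C (Io Z) A" using A ZO by (simp add: in_hom_iff)
    fix f assume f: "f \<in> hom C (Io Z) A"
    then have "f \<cdot> \<eta> Z = zero_arr C Z A"
      by (intro zero_arr_unique_from[OF Z]) (use ZO in \<open>auto simp: in_hom_iff\<close>)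
    then have "(f \<cdot> \<eta> Z) \<cdot> ?t = zero_arr C (Io Z) A" using A ZO by simp
    moreover have "(f \<cdot> \<eta> Z) \<cdot> ?t = f \<cdot> (\<eta> Z \<cdot> ?t)"
      by (rule comp_assoc) (use f ZO in \<open>auto simp: in_hom_iff\<close>)
    ultimately show "f = zero_arr C (Io Z) A" using f ZO t2 by (auto simp: in_hom_iff)
  qed
  have to_IZ: "\<exists>!f. f \<in> hom C A (Io Z)" if A: "A \<in> Obj C" for A
  proof (rule ex1I)
    show "zero_arr C A (Io Z) \<in> hom C A (Io Z)" using A ZO by (simp add: in_hom_iff)
    fix f assume f: "f \<in> hom C A (Io Z)"
    have "(\<eta> Z \<cdot> ?t) \<cdot> f = \<eta> Z \<cdot> (?t \<cdot> f)"
      by (rule comp_assoc) (use f ZO in \<open>auto simp: in_hom_iff\<close>)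
    then show "f = zero_arr C A (Io Z)" using f ZO t2 A by (auto simp: in_hom_iff)
  qed
  have 1: "is_zero_object C (Io Z)" using from_IZ to_IZ ZO by (simp add: is_zero_object_def)
  then have "is_zero_object X (Io Z)" using ZO by (simp add: is_zero_object_def hom_X)
  then show thesis using that 1 ZO by simp
qed

lemma pointed_X: "pointed_category X"
proof -
  obtain Z where "is_zero_object X Z" by (rule zero_object_in_S)
  then show ?thesis
    using category_full_sub by (auto simp: pointed_category_def pointed_category_axioms_def pointed_def)
qed

lemma zero_arr_X [simp]:
  assumes "A \<in> S" "B \<in> S" shows "zero_arr X A B = zero_arr C A B"
proof -
  obtain Z where Z: "is_zero_object C Z" "is_zero_object X Z" "Z \<in> S" by (rule zero_object_in_S)
  have ZO: "Z \<in> Obj C" using Z by simp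
  have "zero_arr X A B = zero_arr C Z B \<cdot>\<^bsub>X\<^esub> zero_arr C A Z"
    by (rule category.zero_arr_eq[OF category_full_sub Z(2)]) (use assms ZO Z in \<open>simp_all add: in_hom_iff\<close>)
  then show ?thesis using assms ZO by simp
qed

lemma kernel_in_X_exists:
  assumes f: "f \<in> Arr X"
  shows "\<exists>k. is_kernel X f k"
proof -
  interpret X: pointed_category X by (rule pointed_X)
  obtain Z where Z: "is_zero_object C Z" "is_zero_object X Z" "Z \<in> S" by (rule zero_object_in_S)
  have z: "zero_arr C Z (Cod C f) \<in> hom X Z (Cod X f)" using Z f by (auto simp: in_hom_iff)
  then obtain k q where "is_pullback X f (zero_arr C Z (Cod C f)) k q"
    using pullback_in_X_exists[OF f, of "zero_arr C Z (Cod C f)"] by (auto simp: in_hom_iff)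
  then show ?thesis using X.pullback_zero_is_kernel[OF Z(2) z] by blast
qed

lemma kernel_X_to_C:
  assumes k: "is_kernel X f k"
  shows "is_kernel C f k"
proof -
  interpret X: pointed_category X by (rule pointed_X)
  obtain Z where Z: "is_zero_object C Z" "is_zero_object X Z" "Z \<in> S" by (rule zero_object_in_S)
  have "is_pullback X f (zero_arr X Z (Cod X f)) k (zero_arr X (Dom X k) Z)"
    by (rule X.kernel_is_pullback_zero[OF k Z(2)])
  then have pb: "is_pullback C f (zero_arr X Z (Cod X f)) k (zero_arr X (Dom X k) Z)"
    by (rule pullback_X_to_C)
  moreover have "zero_arr X Z (Cod X f) \<in> hom C Z (Cod C f)"
    using k Z by (auto simp: is_kernel_def in_hom_iff)
  ultimately show ?thesis using pullback_zero_is_kernel[OF Z(1)] by blast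
qed

end

section \<open>The Galois group as a subobject of the extension\<close>

locale normal_ext = reflective_galois C \<Gamma> S
  for C :: "('o, 'a) cat" (structure) and \<Gamma> :: "('o, 'a, 'o, 'a) galois" and S :: "'o set" +
  fixes p :: 'a
  assumes normal: "normal_extension \<Gamma> p"
begin

abbreviation d :: 'a where "d \<equiv> kp_fst \<Gamma> p"
abbreviation c :: 'a where "c \<equiv> kp_snd \<Gamma> p"
abbreviation E :: 'o where "E \<equiv> Dom C p"
abbreviation Q :: 'o where "Q \<equiv> Eq_obj \<Gamma> p"

lemma p_arr [simp]: "p \<in> Arr C"
  using normal galois_structure.E_class[OF galois]
  by (auto simp: normal_extension_def monadic_extension_def arrow_class_def)

lemma kernel_pair: "is_pullback C p p d c"
  unfolding kp_fst_def kp_snd_def gC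
  by (rule pb_is_pullback, rule finitely_complete_pullback[OF complete]) simp_all

lemma kernel_pair_arr [simp]: "d \<in> Arr C" "c \<in> Arr C" "Dom C d = Q" "Dom C c = Q" "Cod C d = E"
  "Cod C c = E" "p \<cdot> c = p \<cdot> d" "Q \<in> Obj C"
proof -
  note D = is_pullbackD[OF kernel_pair]
  show "Dom C d = Q" by (simp add: Eq_obj_def)
  then show "d \<in> Arr C" "c \<in> Arr C" "Dom C c = Q" "Cod C d = E"
    "Cod C c = E" "p \<cdot> c = p \<cdot> d" "Q \<in> Obj C" using D dom_obj[of d] by simp_all
qed

lemma p_c [simp]: "x \<in> Arr C \<Longrightarrow> Cod C x = Q \<Longrightarrow> p \<cdot> (c \<cdot> x) = p \<cdot> (d \<cdot> x)"
  using comp_eq_extend[of p c "p \<cdot> d" x] by simp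

lemma pair_exists:
  assumes "r \<in> Arr C" "t \<in> Arr C" "Dom C t = Dom C r" "Cod C r = E" "Cod C t = E" "p \<cdot> r = p \<cdot> t"
  obtains x where "x \<in> Arr C" "Dom C x = Dom C r" "Cod C x = Q" "d \<cdot> x = r" "c \<cdot> x = t"
  using is_pullback_factor[OF kernel_pair, of r "Dom C r" t] assms by (auto simp: in_hom_iff)

lemma pair_unique:
  assumes "x \<in> Arr C" "y \<in> Arr C" "Dom C x = Dom C y" "Cod C x = Q" "Cod C y = Q"
    "d \<cdot> x = d \<cdot> y" "c \<cdot> x = c \<cdot> y"
  shows "x = y"
  using is_pullback_jointly_monic[OF kernel_pair, of x "Dom C y" y] assms by (simp add: in_hom_iff)

lemma c_trivial: "is_pullback C (I c) (\<eta> E) (\<eta> Q) c"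
proof -
  have "snd (pb C p p) = c" by (simp add: kp_snd_def)
  then show ?thesis
    using normal by (simp add: normal_extension_def trivial_covering_def pullback_fctr_simps(1))
qed

text \<open>The interchange of the two factors of the kernel pair carries one projection to the other, so both
  are trivial coverings.\<close>

lemma d_trivial: "is_pullback C (I d) (\<eta> E) (\<eta> Q) d"
proof -
  obtain \<sigma> where \<sigma>: "\<sigma> \<in> Arr C" "Dom C \<sigma> = Q" "Cod C \<sigma> = Q" "d \<cdot> \<sigma> = c" "c \<cdot> \<sigma> = d"
    by (rule pair_exists[of c d]) auto
  have "\<sigma> \<cdot> \<sigma> = Id C Q"
    by (rule pair_unique) (use \<sigma> comp_eq_extend[OF \<sigma>(4), of \<sigma>] comp_eq_extend[OF \<sigma>(5), of \<sigma>] in simp_all)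
  then show ?thesis using unit_square_iso[of c \<sigma> \<sigma>] c_trivial \<sigma> by simp
qed

lemma d_lift:
  assumes "r \<in> Arr C" "e \<in> Arr C" "Dom C e = Dom C r" "Cod C r = Io Q" "Cod C e = E"
    "I d \<cdot> r = \<eta> E \<cdot> e"
  obtains x where "x \<in> Arr C" "Dom C x = Dom C r" "Cod C x = Q" "\<eta> Q \<cdot> x = r" "d \<cdot> x = e"
  using is_pullback_factor[OF d_trivial, of r "Dom C r" e] assms by (auto simp: in_hom_iff)

lemma d_lift_unique:
  assumes "x \<in> Arr C" "y \<in> Arr C" "Dom C x = Dom C y" "Cod C x = Q" "Cod C y = Q"
    "\<eta> Q \<cdot> x = \<eta> Q \<cdot> y" "d \<cdot> x = d \<cdot> y"
  shows "x = y"
  using is_pullback_jointly_monic[OF d_trivial, of x "Dom C y" y] assms by (simp add: in_hom_iff)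

lemma c_lift_unique:
  assumes "x \<in> Arr C" "y \<in> Arr C" "Dom C x = Dom C y" "Cod C x = Q" "Cod C y = Q"
    "\<eta> Q \<cdot> x = \<eta> Q \<cdot> y" "c \<cdot> x = c \<cdot> y"
  shows "x = y"
  using is_pullback_jointly_monic[OF c_trivial, of x "Dom C y" y] assms by (simp add: in_hom_iff)

lemma ker_I:
  assumes "f = d \<or> f = c"
  shows "is_kernel X (I f) (ker X (I f))"
  by (rule ker_is_kernel, rule kernel_in_X_exists) (use assms in auto)

text \<open>The kernel of \<open>p\<close> is that of its pullback \<open>d\<close> along itself, which is the kernel of \<open>I d\<close> because \<open>d\<close> is a trivial
  covering; and \<open>I d\<close> lies in \<open>X\<close>.\<close>

lemma kernel_in_S: "\<exists>k. is_kernel C p k \<and> Dom C k \<in> S"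
proof -
  let ?k = "ker X (I d)"
  have k: "is_kernel C (I d) ?k" by (rule kernel_X_to_C, rule ker_I) simp
  then have k_arr: "?k \<in> Arr C" "Cod C ?k = Io Q" "I d \<cdot> ?k = zero_arr C (Dom C ?k) (Io E)"
    by (auto simp: is_kernel_def in_hom_iff)
  have kS: "Dom C ?k \<in> S" using ker_I[of d] by (auto simp: is_kernel_def in_hom_iff)
  obtain x where x: "x \<in> Arr C" "Dom C x = Dom C ?k" "Cod C x = Q" "\<eta> Q \<cdot> x = ?k"
    "d \<cdot> x = zero_arr C (Dom C ?k) E"
    by (rule d_lift[of ?k "zero_arr C (Dom C ?k) E"]) (use k_arr in auto)
  have "is_kernel C p (c \<cdot> x)"
  proof (rule is_kernelI)
    show "\<exists>l. l \<in> hom C T (Dom C (c \<cdot> x)) \<and> (c \<cdot> x) \<cdot> l = h"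
      if h: "h \<in> hom C T (Dom C p)" "p \<cdot> h = zero_arr C T (Cod C p)" for T h
    proof -
      have h': "h \<in> Arr C" "Dom C h = T" "Cod C h = E" "T \<in> Obj C" using h by (auto simp: in_hom_iff)
      obtain y where y: "y \<in> Arr C" "Dom C y = T" "Cod C y = Q" "d \<cdot> y = zero_arr C T E" "c \<cdot> y = h"
        by (rule pair_exists[of "zero_arr C T E" h]) (use h h' in auto)
      have "I d \<cdot> (\<eta> Q \<cdot> y) = zero_arr C T (Io E)"
        using unit_naturality_comp[of d E y] y h' by simp
      then obtain l where l: "l \<in> hom C T (Dom C ?k)" "?k \<cdot> l = \<eta> Q \<cdot> y"
        using is_kernel_factor[OF k, of "\<eta> Q \<cdot> y" T] y by (auto simp: in_hom_iff)
      have l': "l \<in> Arr C" "Dom C l = T" "Cod C l = Dom C ?k" using l by (auto simp: in_hom_iff)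
      have "x \<cdot> l = y"
        by (rule d_lift_unique)
          (use x y l l' h' k_arr comp_eq_extend[OF x(4), of l] comp_eq_extend[OF x(5), of l] in simp_all)
      then show ?thesis using x y l' by (intro exI[of _ l]) (simp add: in_hom_iff)
    qed
    show "l = l'" if l: "l \<in> hom C T (Dom C (c \<cdot> x))" "l' \<in> hom C T (Dom C (c \<cdot> x))"
      "(c \<cdot> x) \<cdot> l = (c \<cdot> x) \<cdot> l'" for T l l'
    proof -
      have ll: "l \<in> Arr C" "Dom C l = T" "Cod C l = Dom C ?k" "l' \<in> Arr C" "Dom C l' = T" "Cod C l' = Dom C ?k"
        using l x by (auto simp: in_hom_iff)
      have "x \<cdot> l = x \<cdot> l'"
        by (rule pair_unique) (use x ll l(3) k_arr comp_eq_extend[OF x(5)] in simp_all)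
      then have "\<eta> Q \<cdot> (x \<cdot> l) = \<eta> Q \<cdot> (x \<cdot> l')" by simp
      then have "?k \<cdot> l = ?k \<cdot> l'" using x ll comp_eq_extend[OF x(4)] by simp
      then show ?thesis by - (rule is_kernel_mono[OF k, of l T l'], use ll in \<open>simp_all add: in_hom_iff\<close>)
    qed
  qed (use x k_arr in simp_all)
  then show ?thesis using x kS by (intro exI[of _ "c \<cdot> x"]) simp
qed

abbreviation k :: 'a where "k \<equiv> nker \<Gamma> p"
abbreviation K :: 'o where "K \<equiv> Dom C k"

lemma nker: "is_kernel C p k" "K \<in> S"
  using someI_ex[OF kernel_in_S] unfolding nker_def by simp_all

lemma nker_arr [simp]: "k \<in> Arr C" "Cod C k = E" "p \<cdot> k = zero_arr C K (Cod C p)" "K \<in> S" "K \<in> Obj C"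
  using nker by (auto simp: is_kernel_def in_hom_iff)

abbreviation i :: 'a where "i \<equiv> gal_incl \<Gamma> p"
abbreviation G :: 'o where "G \<equiv> Dom C i"

lemma gal_incl_arr [simp]: "i \<in> Arr C" "Cod C i = Io Q" "G \<in> S" "G \<in> Obj C"
    "I d \<cdot> i = zero_arr C G (Io E)" "I c \<cdot> i = zero_arr C G (Io E)"
  and gal_incl_mono: "l \<in> Arr C \<Longrightarrow> l' \<in> Arr C \<Longrightarrow> Dom C l = Dom C l' \<Longrightarrow> Cod C l = G \<Longrightarrow> Cod C l' = G \<Longrightarrow>
    i \<cdot> l = i \<cdot> l' \<Longrightarrow> l = l'"
  and gal_incl_factor: "t \<in> Arr C \<Longrightarrow> Cod C t = Io Q \<Longrightarrow> I d \<cdot> t = zero_arr C (Dom C t) (Io E) \<Longrightarrow>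
    I c \<cdot> t = zero_arr C (Dom C t) (Io E) \<Longrightarrow> \<exists>l. l \<in> hom C (Dom C t) G \<and> i \<cdot> l = t"
proof -
  let ?kd = "ker X (I d)" and ?kc = "ker X (I c)"
  let ?a = "fst (pb X ?kd ?kc)" and ?b = "snd (pb X ?kd ?kc)"
  have kX: "is_kernel X (I d) ?kd" "is_kernel X (I c) ?kc" by (simp_all add: ker_I)
  have kC: "is_kernel C (I d) ?kd" "is_kernel C (I c) ?kc" using kX kernel_X_to_C by blast+
  have kd: "?kd \<in> Arr C" "Cod C ?kd = Io Q" "Dom C ?kd \<in> S" "I d \<cdot> ?kd = zero_arr C (Dom C ?kd) (Io E)"
    and kc: "?kc \<in> Arr C" "Cod C ?kc = Io Q" "Dom C ?kc \<in> S" "I c \<cdot> ?kc = zero_arr C (Dom C ?kc) (Io E)"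
    using kX by (auto simp: is_kernel_def in_hom_iff)
  have pbX: "is_pullback X ?kd ?kc ?a ?b"
    by (rule pb_is_pullback, rule pullback_in_X_exists) (use kd kc in auto)
  then have pbC: "is_pullback C ?kd ?kc ?a ?b" by (rule pullback_X_to_C)
  have ab: "?a \<in> Arr C" "Cod C ?a = Dom C ?kd" and aS: "Dom C ?a \<in> S"
    using is_pullbackD[OF pbC] is_pullbackD[OF pbX] by auto
  have i_eq: "i = ?kd \<cdot> ?a" by (simp add: gal_incl_def intersection_def)
  then show i: "i \<in> Arr C" "Cod C i = Io Q" "G \<in> S" "G \<in> Obj C" using kd ab aS by simp_all
  have i_comp: "i \<cdot> x = ?kd \<cdot> (?a \<cdot> x)" if "x \<in> Arr C" "Cod C x = G" for x
    using that kd ab by (simp_all add: i_eq)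
  note int = kernel_intersection[OF kC _ pbC]
  have GA: "G = Dom C ?a" using kd ab by (simp add: i_eq)
  show "I d \<cdot> i = zero_arr C G (Io E)" "I c \<cdot> i = zero_arr C G (Io E)"
    using int(1,2) GA by (simp_all add: i_eq)
  show "l = l'" if "l \<in> Arr C" "l' \<in> Arr C" "Dom C l = Dom C l'" "Cod C l = G" "Cod C l' = G" "i \<cdot> l = i \<cdot> l'"
    by (rule int(3)) (use that i_comp GA in simp_all)
  show "\<exists>l. l \<in> hom C (Dom C t) G \<and> i \<cdot> l = t"
    if "t \<in> Arr C" "Cod C t = Io Q" "I d \<cdot> t = zero_arr C (Dom C t) (Io E)"
      "I c \<cdot> t = zero_arr C (Dom C t) (Io E)"
    using int(4)[of t] that i_comp GA by (auto simp: in_hom_iff)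
qed

abbreviation m :: 'a where "m \<equiv> ker_unit_incl \<Gamma> p"
abbreviation M :: 'o where "M \<equiv> Dom C m"

lemma ker_unit_incl [simp]: "m \<in> Arr C" "Cod C m = K" "M \<in> Obj C" "\<eta> E \<cdot> (k \<cdot> m) = zero_arr C M (Io E)"
  and ker_unit_mono: "l \<in> Arr C \<Longrightarrow> l' \<in> Arr C \<Longrightarrow> Dom C l = Dom C l' \<Longrightarrow> Cod C l = M \<Longrightarrow> Cod C l' = M \<Longrightarrow>
    k \<cdot> (m \<cdot> l) = k \<cdot> (m \<cdot> l') \<Longrightarrow> l = l'"
  and ker_unit_factor: "t \<in> Arr C \<Longrightarrow> Cod C t = E \<Longrightarrow> p \<cdot> t = zero_arr C (Dom C t) (Cod C p) \<Longrightarrow>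
    \<eta> E \<cdot> t = zero_arr C (Dom C t) (Io E) \<Longrightarrow> \<exists>l. l \<in> hom C (Dom C t) M \<and> k \<cdot> (m \<cdot> l) = t"
proof -
  let ?n = "ker C (\<eta> E)"
  let ?b = "snd (pb C k ?n)"
  obtain Z where Z: "is_zero_object C Z" "Z \<in> S" by (rule zero_object_in_S)
  have z: "zero_arr C Z (Io E) \<in> hom C Z (Cod C (\<eta> E))" using Z by (simp add: in_hom_iff)
  have "\<exists>k q. is_pullback C (\<eta> E) (zero_arr C Z (Io E)) k q"
    by (rule finitely_complete_pullback[OF complete]) (use Z in simp_all)
  then have n: "is_kernel C (\<eta> E) ?n"
    using pullback_zero_is_kernel[OF Z(1) z] by (intro ker_is_kernel) blast
  then have n_arr: "?n \<in> Arr C" "Cod C ?n = E" "\<eta> E \<cdot> ?n = zero_arr C (Dom C ?n) (Io E)"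
    by (auto simp: is_kernel_def in_hom_iff)
  have pb: "is_pullback C k ?n m ?b"
    unfolding ker_unit_incl_def gC
    by (rule pb_is_pullback, rule finitely_complete_pullback[OF complete]) (use n_arr in simp_all)
  note int = kernel_intersection[OF nker(1) n _ pb]
  show "m \<in> Arr C" "Cod C m = K" "M \<in> Obj C"
    using is_pullbackD[OF pb] dom_obj[of m] by simp_all
  show "\<eta> E \<cdot> (k \<cdot> m) = zero_arr C M (Io E)" using int(2) by simp
  show "l = l'" if "l \<in> Arr C" "l' \<in> Arr C" "Dom C l = Dom C l'" "Cod C l = M" "Cod C l' = M"
    "k \<cdot> (m \<cdot> l) = k \<cdot> (m \<cdot> l')"
    by (rule int(3)) (use that in simp_all)
  show "\<exists>l. l \<in> hom C (Dom C t) M \<and> k \<cdot> (m \<cdot> l) = t" if "t \<in> Arr C" "Cod C t = E"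
    "p \<cdot> t = zero_arr C (Dom C t) (Cod C p)" "\<eta> E \<cdot> t = zero_arr C (Dom C t) (Io E)"
    by (rule int(4)) (use that in simp_all)
qed

abbreviation z :: 'a where "z \<equiv> zero_ker_pair \<Gamma> p"

lemma zero_ker_pair [simp]: "z \<in> Arr C" "Dom C z = K" "Cod C z = Q" "d \<cdot> z = zero_arr C K E" "c \<cdot> z = k"
proof -
  obtain s where s: "s \<in> Arr C" "Dom C s = K" "Cod C s = Q" "d \<cdot> s = zero_arr C K E" "c \<cdot> s = k"
    by (rule pair_exists[of "zero_arr C K E" k]) simp_all
  have "z = s"
    unfolding zero_ker_pair_def gC
  proof (rule the_equality)
    fix t assume "t \<in> hom C K Q \<and> d \<cdot> t = zero_arr C K E \<and> c \<cdot> t = k"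
    then show "t = s" by - (rule pair_unique, use s in \<open>simp_all add: in_hom_iff\<close>)
  qed (use s in \<open>simp add: in_hom_iff\<close>)
  then show "z \<in> Arr C" "Dom C z = K" "Cod C z = Q" "d \<cdot> z = zero_arr C K E" "c \<cdot> z = k" using s by simp_all
qed

text \<open>The generic element of the Galois group lifts along the trivial covering \<open>d\<close> to a pair \<open>(0, e)\<close>; here \<open>e\<close> lies in the
  kernel of \<open>p\<close>, and in that of the unit because \<open>I c\<close> kills the given element.\<close>

definition gal_lift :: 'a where
  "gal_lift = (THE x. x \<in> hom C G Q \<and> \<eta> Q \<cdot> x = i \<and> d \<cdot> x = zero_arr C G E)"

lemma gal_lift [simp]: "gal_lift \<in> Arr C" "Dom C gal_lift = G" "Cod C gal_lift = Q" "\<eta> Q \<cdot> gal_lift = i"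
  "d \<cdot> gal_lift = zero_arr C G E"
proof -
  obtain x where x: "x \<in> Arr C" "Dom C x = G" "Cod C x = Q" "\<eta> Q \<cdot> x = i" "d \<cdot> x = zero_arr C G E"
    by (rule d_lift[of i "zero_arr C G E"]) simp_all
  have "gal_lift = x" unfolding gal_lift_def
  proof (rule the_equality)
    fix y assume "y \<in> hom C G Q \<and> \<eta> Q \<cdot> y = i \<and> d \<cdot> y = zero_arr C G E"
    then show "y = x" by - (rule d_lift_unique, use x in \<open>simp_all add: in_hom_iff\<close>)
  qed (use x in \<open>simp add: in_hom_iff\<close>)
  then show "gal_lift \<in> Arr C" "Dom C gal_lift = G" "Cod C gal_lift = Q" "\<eta> Q \<cdot> gal_lift = i"
    "d \<cdot> gal_lift = zero_arr C G E" using x by simp_all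
qed

text \<open>The Galois group as the subobject \<open>Ker p \<inter> Ker \<eta>\<^sub>E\<close> of \<open>E\<close>.\<close>

definition j :: 'a where "j = c \<cdot> gal_lift"

lemma j_arr [simp]: "j \<in> Arr C" "Dom C j = G" "Cod C j = E" "p \<cdot> j = zero_arr C G (Cod C p)"
    "\<eta> E \<cdot> j = zero_arr C G (Io E)"
  by (simp_all add: j_def unit_naturality_comp[of c])

text \<open>The inverse \<open>\<psi>\<close> of the canonical isomorphism sends an element to the second component of its lift.\<close>

lemma gal_iso: "\<exists>\<psi>. is_inverse C (gal_iso \<Gamma> p) \<psi> \<and> Dom C (gal_iso \<Gamma> p) = M \<and> Cod C (gal_iso \<Gamma> p) = G \<and>
  k \<cdot> (m \<cdot> \<psi>) = j"
proof -
  have "I d \<cdot> (\<eta> Q \<cdot> (z \<cdot> m)) = zero_arr C M (Io E)"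
    using unit_naturality_comp[of d E "z \<cdot> m"] comp_eq_extend[of d z _ m] by simp
  moreover have "I c \<cdot> (\<eta> Q \<cdot> (z \<cdot> m)) = zero_arr C M (Io E)"
    using unit_naturality_comp[of c E "z \<cdot> m"] comp_eq_extend[of c z _ m] by simp
  ultimately obtain \<phi> where \<phi>: "\<phi> \<in> hom C M G" "i \<cdot> \<phi> = \<eta> Q \<cdot> (z \<cdot> m)"
    using gal_incl_factor[of "\<eta> Q \<cdot> (z \<cdot> m)"] by auto
  have \<phi>': "\<phi> \<in> Arr C" "Dom C \<phi> = M" "Cod C \<phi> = G" using \<phi> by (auto simp: in_hom_iff)
  have iso: "gal_iso \<Gamma> p = \<phi>"
    unfolding gal_iso_def gC
  proof (rule the_equality)
    fix x assume "x \<in> hom C M (FO (Gal_fctr \<Gamma>) p) \<and> i \<cdot> x = (\<eta> Q \<cdot> z) \<cdot> m"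
    then show "x = \<phi>"
      by - (rule gal_incl_mono, use \<phi> \<phi>' in \<open>simp_all add: in_hom_iff Gal_fctr_def\<close>)
  qed (use \<phi> \<phi>' in \<open>simp add: in_hom_iff Gal_fctr_def\<close>)
  obtain \<psi> where \<psi>: "\<psi> \<in> hom C G M" "k \<cdot> (m \<cdot> \<psi>) = j"
    using ker_unit_factor[of j] by auto
  have \<psi>': "\<psi> \<in> Arr C" "Dom C \<psi> = G" "Cod C \<psi> = M" using \<psi> by (auto simp: in_hom_iff)
  have "gal_lift \<cdot> \<phi> = z \<cdot> m"
    by (rule d_lift_unique)
      (use \<phi>' \<phi> comp_eq_extend[of "\<eta> Q" gal_lift _ \<phi>] comp_eq_extend[of d gal_lift _ \<phi>]
        comp_eq_extend[of d z _ m] in simp_all)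
  then have j\<phi>: "j \<cdot> \<phi> = k \<cdot> m" using \<phi>' comp_eq_extend[of c z _ m] by (simp add: j_def)
  have \<psi>\<phi>: "\<psi> \<cdot> \<phi> = Id C M"
    by (rule ker_unit_mono) (use \<phi>' \<psi>' \<psi>(2) j\<phi> comp_eq_extend[of "k \<cdot> m" \<psi> j \<phi>] in simp_all)
  have "z \<cdot> (m \<cdot> \<psi>) = gal_lift"
    by (rule pair_unique)
      (use \<psi>' \<psi>(2) comp_eq_extend[of d z _ "m \<cdot> \<psi>"] comp_eq_extend[of c z _ "m \<cdot> \<psi>"] in \<open>simp_all add: j_def\<close>)
  then have "\<eta> Q \<cdot> (z \<cdot> (m \<cdot> \<psi>)) = i" by simp
  then have "i \<cdot> (\<phi> \<cdot> \<psi>) = i" using comp_eq_extend[OF \<phi>(2), of \<psi>] \<phi>' \<psi>' by simp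
  then have "\<phi> \<cdot> \<psi> = Id C G" by - (rule gal_incl_mono, use \<phi>' \<psi>' in simp_all)
  then show ?thesis unfolding iso using \<phi>' \<psi>' \<psi>(2) \<psi>\<phi> by (auto simp: is_inverse_def in_hom_iff)
qed

abbreviation \<iota> :: 'a where "\<iota> \<equiv> gal_iota \<Gamma> p"

lemma gal_iota [simp]: "\<iota> \<in> Arr C" "Dom C \<iota> = G" "Cod C \<iota> = K" "k \<cdot> \<iota> = j"
  and gal_iota_mono: "l \<in> Arr C \<Longrightarrow> l' \<in> Arr C \<Longrightarrow> Dom C l = Dom C l' \<Longrightarrow> Cod C l = G \<Longrightarrow> Cod C l' = G \<Longrightarrow>
    \<iota> \<cdot> l = \<iota> \<cdot> l' \<Longrightarrow> l = l'"
  and j_factor: "t \<in> Arr C \<Longrightarrow> Cod C t = E \<Longrightarrow> p \<cdot> t = zero_arr C (Dom C t) (Cod C p) \<Longrightarrow>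
    \<eta> E \<cdot> t = zero_arr C (Dom C t) (Io E) \<Longrightarrow> \<exists>l. l \<in> hom C (Dom C t) G \<and> j \<cdot> l = t"
proof -
  let ?\<phi> = "gal_iso \<Gamma> p"
  obtain \<psi> where \<psi>: "is_inverse C ?\<phi> \<psi>" "Dom C ?\<phi> = M" "Cod C ?\<phi> = G" "k \<cdot> (m \<cdot> \<psi>) = j"
    using gal_iso by blast
  then have \<phi>\<psi>: "?\<phi> \<in> Arr C" "\<psi> \<in> Arr C" "Dom C \<psi> = G" "Cod C \<psi> = M" "\<psi> \<cdot> ?\<phi> = Id C M" "?\<phi> \<cdot> \<psi> = Id C G"
    by (auto simp: is_inverse_def in_hom_iff)
  have \<iota>_eq: "\<iota> = m \<cdot> \<psi>" by (simp add: gal_iota_def inverse_arr_eq[OF \<psi>(1)])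
  show \<iota>: "\<iota> \<in> Arr C" "Dom C \<iota> = G" "Cod C \<iota> = K" "k \<cdot> \<iota> = j"
    using \<phi>\<psi> \<psi> by (simp_all add: \<iota>_eq)
  show "l = l'" if l: "l \<in> Arr C" "l' \<in> Arr C" "Dom C l = Dom C l'" "Cod C l = G" "Cod C l' = G" "\<iota> \<cdot> l = \<iota> \<cdot> l'"
  proof -
    have "k \<cdot> (\<iota> \<cdot> l) = k \<cdot> (\<iota> \<cdot> l')" using l by simp
    then have "\<psi> \<cdot> l = \<psi> \<cdot> l'" using l \<phi>\<psi> by - (rule ker_unit_mono, simp_all add: \<iota>_eq)
    then have "?\<phi> \<cdot> (\<psi> \<cdot> l) = ?\<phi> \<cdot> (\<psi> \<cdot> l')" by simp
    then show ?thesis using comp_eq_extend[OF \<phi>\<psi>(6)] l \<phi>\<psi> \<psi>(2,3) by simp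
  qed
  show "\<exists>l. l \<in> hom C (Dom C t) G \<and> j \<cdot> l = t" if t: "t \<in> Arr C" "Cod C t = E"
    "p \<cdot> t = zero_arr C (Dom C t) (Cod C p)" "\<eta> E \<cdot> t = zero_arr C (Dom C t) (Io E)"
  proof -
    obtain l where l: "l \<in> hom C (Dom C t) M" "k \<cdot> (m \<cdot> l) = t" using ker_unit_factor[OF t] by blast
    have l': "l \<in> Arr C" "Dom C l = Dom C t" "Cod C l = M" using l by (auto simp: in_hom_iff)
    have "j \<cdot> (?\<phi> \<cdot> l) = k \<cdot> (m \<cdot> (\<psi> \<cdot> (?\<phi> \<cdot> l)))" using \<phi>\<psi> l' \<psi> by (simp flip: \<psi>(4))
    also have "\<dots> = t" using comp_eq_extend[OF \<phi>\<psi>(5), of l] \<phi>\<psi> l' l \<psi> by simp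
    finally show ?thesis using \<phi>\<psi> l' \<psi> by (intro exI[of _ "?\<phi> \<cdot> l"]) (simp add: in_hom_iff)
  qed
qed

end

section \<open>Stability of normal extensions\<close>

lemma pullback_fctr_FA_eq:
  assumes C: "category C" and pb: "is_pullback C g b (fst (pb C g b)) (snd (pb C g b))"
    and k: "k \<in> hom C (Dom C (snd (pb C f b))) (Dom C (snd (pb C g b)))"
      "fst (pb C g b) \<cdot>\<^bsub>C\<^esub> k = h \<cdot>\<^bsub>C\<^esub> fst (pb C f b)" "snd (pb C g b) \<cdot>\<^bsub>C\<^esub> k = snd (pb C f b)"
  shows "FA (pullback_fctr C b) (f, h, g) = (snd (pb C f b), k, snd (pb C g b))"
proof -
  have "(THE k. k \<in> hom C (Dom C (snd (pb C f b))) (Dom C (snd (pb C g b))) \<and>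
      fst (pb C g b) \<cdot>\<^bsub>C\<^esub> k = h \<cdot>\<^bsub>C\<^esub> fst (pb C f b) \<and> snd (pb C g b) \<cdot>\<^bsub>C\<^esub> k = snd (pb C f b)) = k"
  proof (rule the_equality)
    fix l assume "l \<in> hom C (Dom C (snd (pb C f b))) (Dom C (snd (pb C g b))) \<and>
      fst (pb C g b) \<cdot>\<^bsub>C\<^esub> l = h \<cdot>\<^bsub>C\<^esub> fst (pb C f b) \<and> snd (pb C g b) \<cdot>\<^bsub>C\<^esub> l = snd (pb C f b)"
    then show "l = k"
      using k is_pullbackD(6)[OF pb]
      by (intro category.is_pullback_jointly_monic[OF C pb, of l "Dom C (snd (pb C f b))" k]) simp_all
  qed (use k in simp)
  then show ?thesis by (simp add: pullback_fctr_simps)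
qed

locale admissible_galois = reflective_galois C \<Gamma> S
  for C :: "('o, 'a) cat" (structure) and \<Gamma> :: "('o, 'a, 'o, 'a) galois" and S :: "'o set" +
  assumes admissible: "admissible \<Gamma>"
    and monadic_stable: "pullback_stable C {p. monadic_extension \<Gamma> p}"
begin

lemma fibration_arr [simp]: "f \<in> gE \<Gamma> \<Longrightarrow> f \<in> Arr C"
  using galois_structure.E_class[OF galois] by (auto simp: arrow_class_def)

lemma fibration_stable: "pullback_stable C (gE \<Gamma>)" and gF_stable: "pullback_stable X (gF \<Gamma>)"
  using galois_structure.E_class[OF galois] galois_structure.F_class[OF galois]
  by (auto simp: arrow_class_def)

lemma pullback_stable_closed:
  "pullback_stable D N \<Longrightarrow> f \<in> N \<Longrightarrow> is_pullback D f g p q \<Longrightarrow> q \<in> N"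
  using is_pullbackD(2,3)[of D f g p q] unfolding pullback_stable_def by blast

lemma gF_arr: "g \<in> gF \<Gamma> \<Longrightarrow> g \<in> Arr X"
  using galois_structure.F_class[OF galois] by (auto simp: arrow_class_def)

lemma gF_fibration: "g \<in> gF \<Gamma> \<Longrightarrow> g \<in> gE \<Gamma>"
  using galois_structure.H_F[OF galois] by auto

lemma I_gF: "f \<in> gE \<Gamma> \<Longrightarrow> I f \<in> gF \<Gamma>"
  using galois_structure.I_E[OF galois] by auto

text \<open>Let \<open>f : A \<rightarrow> B\<close> be the pullback of \<open>g : Y \<rightarrow> I B\<close> along \<open>\<eta>\<^sub>B\<close>. The projection \<open>A \<rightarrow> Y\<close> induces \<open>v : I A \<rightarrow> Y\<close> over \<open>I B\<close>.
  Fullness of \<open>H\<^sup>B\<close> lifts the canonical arrow \<open>f \<rightarrow> H\<^sup>B (I f)\<close> to some \<open>t : Y \<rightarrow> I A\<close>, and faithfulness together with the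
  universality of \<open>\<eta>\<^sub>A\<close> makes \<open>t\<close> and \<open>v\<close> mutually inverse. So \<open>g\<close> is isomorphic to \<open>I f\<close>, and the square
  defining \<open>f\<close> is its naturality square.\<close>

lemma pullback_along_unit_trivial:
  assumes B: "B \<in> Obj C" and g: "g \<in> gF \<Gamma>" "Cod C g = Io B"
  defines "y \<equiv> fst (pb C g (\<eta> B))" and "f \<equiv> snd (pb C g (\<eta> B))"
  shows "is_pullback C (I f) (\<eta> B) (\<eta> (Dom C f)) f"
proof -
  let ?Y = "Dom C g" and ?A = "Dom C y"
  have gX': "g \<in> Arr C" "?Y \<in> S" using gF_arr[OF g(1)] by auto
  have pbg: "is_pullback C g (\<eta> B) y f" and f_fib: "f \<in> gE \<Gamma>"
    unfolding y_def f_def using pullback_stable_pb[OF fibration_stable gF_fibration[OF g(1)], of "\<eta> B"] B g(2)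
    by simp_all
  note pq = is_pullbackD[OF pbg]
  have yf: "y \<in> Arr C" "f \<in> Arr C" "Dom C f = ?A" "Cod C y = ?Y" "Cod C f = B" "g \<cdot> y = \<eta> B \<cdot> f" "?A \<in> Obj C"
    using pq B dom_obj[of y] by simp_all
  obtain v where v: "v \<in> Arr C" "Dom C v = Io ?A" "Cod C v = ?Y" "v \<cdot> \<eta> ?A = y"
    by (rule reflect[of y ?A]) (use yf gX' in auto)
  have gv: "g \<cdot> v = I f"
    by (rule reflect_unique[of _ _ ?A "Io B"]) (use v yf g gX' B unit_naturality[of f B] in simp_all)
  have If: "I f \<in> gF \<Gamma>" "Cod C (I f) = Io B" using I_gF[OF f_fib] yf by simp_all
  let ?y2 = "fst (pb C (I f) (\<eta> B))" and ?f2 = "snd (pb C (I f) (\<eta> B))"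
  have pb2: "is_pullback C (I f) (\<eta> B) ?y2 ?f2" and f2_fib: "?f2 \<in> gE \<Gamma>"
    using pullback_stable_pb[OF fibration_stable gF_fibration[OF If(1)], of "\<eta> B"] B If(2) by simp_all
  note pq2 = is_pullbackD[OF pb2]
  have yf2: "?y2 \<in> Arr C" "?f2 \<in> Arr C" "Dom C ?f2 = Dom C ?y2" "Cod C ?y2 = Io ?A" "Cod C ?f2 = B"
    using pq2 yf B by simp_all
  obtain w where w: "w \<in> hom C ?A (Dom C ?y2)" "?y2 \<cdot> w = \<eta> ?A" "?f2 \<cdot> w = f"
    by (rule is_pullback_factor[OF pb2, of "\<eta> ?A" ?A f])
      (use yf B unit_naturality[of f B] in \<open>simp_all add: in_hom_iff\<close>)
  have H_simps: "FO (H_at \<Gamma> B) h = snd (pb C h (\<eta> B))"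
    "FA (H_at \<Gamma> B) (h, t, h') = FA (pullback_fctr C (\<eta> B)) (h, t, h')" for h t h'
    by (simp_all add: H_at_def slice_fctr_def pullback_fctr_simps(1))
  have objs: "g \<in> Obj (fib_slice_X \<Gamma> (Io B))" "I f \<in> Obj (fib_slice_X \<Gamma> (Io B))"
    using g If gF_arr B by (auto simp: fib_slice_X_def)
  have "(f, w, ?f2) \<in> hom (fib_slice \<Gamma> B) (FO (H_at \<Gamma> B) g) (FO (H_at \<Gamma> B) (I f))"
    using yf yf2 w f_fib f2_fib by (simp add: in_hom_iff H_simps fib_slice_def flip: f_def)
  then obtain \<psi> where \<psi>: "\<psi> \<in> hom (fib_slice_X \<Gamma> (Io B)) g (I f)" "FA (H_at \<Gamma> B) \<psi> = (f, w, ?f2)"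
    using admissible objs B unfolding admissible_def full_functor_def by (metis gC)
  obtain t where \<psi>_eq: "\<psi> = (g, t, I f)" and t: "t \<in> Arr C" "Dom C t = ?Y" "Cod C t = Io ?A" "I f \<cdot> t = g"
    using \<psi>(1) yf by (cases \<psi>) (auto simp: in_hom_iff fib_slice_X_def)
  have Ifty: "I f \<cdot> (t \<cdot> y) = \<eta> B \<cdot> f" using comp_eq_extend[OF t(4), of y] t yf by simp
  obtain l where l: "l \<in> hom C ?A (Dom C ?y2)" "?y2 \<cdot> l = t \<cdot> y" "?f2 \<cdot> l = f"
    by (rule is_pullback_factor[OF pb2, of "t \<cdot> y" ?A f])
      (use yf t B Ifty in \<open>simp_all add: in_hom_iff\<close>)
  have "FA (H_at \<Gamma> B) \<psi> = (snd (pb C g (\<eta> B)), l, ?f2)"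
    unfolding \<psi>_eq H_simps
    by (rule pullback_fctr_FA_eq[OF category_axioms pb2])
      (use l yf yf2 in \<open>simp_all flip: f_def y_def\<close>)
  then have "l = w" using \<psi>(2) by simp
  then have ty: "t \<cdot> y = \<eta> ?A" using w(2) l(2) by simp
  have tv: "t \<cdot> v = Id C (Io ?A)"
    by (rule reflect_unique[of _ _ ?A "Io ?A"]) (use t v yf ty in simp_all)
  have gvt: "g \<cdot> (v \<cdot> t) = g" using comp_eq_extend[OF gv, of t] v t g gX' yf by simp
  have vty: "v \<cdot> (t \<cdot> y) = y" unfolding ty by (rule v(4))
  have "FA (H_at \<Gamma> B) (g, v \<cdot> t, g) = (snd (pb C g (\<eta> B)), Id C ?A, snd (pb C g (\<eta> B)))"
    unfolding H_simps
    by (rule pullback_fctr_FA_eq[OF category_axioms pbg[unfolded f_def y_def]])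
      (use yf v t vty in \<open>simp_all add: in_hom_iff flip: f_def y_def\<close>)
  moreover have "FA (H_at \<Gamma> B) (g, Id C ?Y, g) = (snd (pb C g (\<eta> B)), Id C ?A, snd (pb C g (\<eta> B)))"
    unfolding H_simps
    by (rule pullback_fctr_FA_eq[OF category_axioms pbg[unfolded f_def y_def]])
      (use yf gX' in \<open>simp_all add: in_hom_iff flip: f_def y_def\<close>)
  moreover have "(g, v \<cdot> t, g) \<in> hom (fib_slice_X \<Gamma> (Io B)) g g" "(g, Id C ?Y, g) \<in> hom (fib_slice_X \<Gamma> (Io B)) g g"
    using g gF_arr[OF g(1)] gX' v t gvt by (simp_all add: fib_slice_X_def in_hom_iff)
  moreover have "inj_on (FA (H_at \<Gamma> B)) (hom (fib_slice_X \<Gamma> (Io B)) g g)"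
    using admissible objs(1) B unfolding admissible_def faithful_functor_def by (metis gC)
  ultimately have "(g, v \<cdot> t, g) = (g, Id C ?Y, g)" by (metis inj_onD)
  then have vt: "v \<cdot> t = Id C ?Y" by simp
  show ?thesis
  proof (rule is_pullbackI)
    show "I f \<cdot> \<eta> (Dom C f) = \<eta> B \<cdot> f" using yf unit_naturality[of f B] by simp
    show "\<exists>x. x \<in> hom C T (Dom C (\<eta> (Dom C f))) \<and> \<eta> (Dom C f) \<cdot> x = r \<and> f \<cdot> x = e"
      if re: "r \<in> hom C T (Dom C (I f))" "e \<in> hom C T (Dom C (\<eta> B))" "I f \<cdot> r = \<eta> B \<cdot> e" for T r e
    proof -
      have r: "r \<in> Arr C" "Dom C r = T" "Cod C r = Io ?A" using re(1) yf by (simp_all add: in_hom_iff)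
      obtain x where x: "x \<in> hom C T ?A" "y \<cdot> x = v \<cdot> r" "f \<cdot> x = e"
        by (rule is_pullback_factor[OF pbg, of "v \<cdot> r" T e])
          (use r re v yf gX' comp_eq_extend[OF gv, of r] in \<open>simp_all add: in_hom_iff\<close>)
      have x': "x \<in> Arr C" "Dom C x = T" "Cod C x = ?A" using x by (simp_all add: in_hom_iff)
      have "\<eta> ?A \<cdot> x = t \<cdot> (v \<cdot> r)" using comp_eq_extend[OF ty, of x] t yf x' x(2) by simp
      also have "\<dots> = r" using comp_eq_extend[OF tv, of r] t v r by simp
      finally show ?thesis using x yf by auto
    qed
    show "x = x'" if xx: "x \<in> hom C T (Dom C (\<eta> (Dom C f)))" "x' \<in> hom C T (Dom C (\<eta> (Dom C f)))"
      "\<eta> (Dom C f) \<cdot> x = \<eta> (Dom C f) \<cdot> x'" "f \<cdot> x = f \<cdot> x'" for T x x'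
    proof (rule is_pullback_jointly_monic[OF pbg, of x T x'])
      have "y \<cdot> z = v \<cdot> (\<eta> ?A \<cdot> z)" if "z \<in> Arr C" "Cod C z = ?A" for z
        using comp_eq_extend[OF v(4), of z] v(1-3) yf that by simp
      then show "y \<cdot> x = y \<cdot> x'" using yf xx by (simp add: in_hom_iff)
    qed (use xx yf in \<open>simp_all add: in_hom_iff\<close>)
  qed (use yf B in simp_all)
qed

text \<open>The given pullback, pasted with the naturality square of \<open>f\<close>, is a pullback of \<open>I f\<close> along \<open>\<eta> b = I b \<eta>\<close>. It therefore
  factors through the pullback \<open>g\<close> of \<open>I f\<close> along \<open>I b\<close>, formed in \<open>X\<close>, and exhibits \<open>f'\<close> as the pullback of \<open>g\<close> along the unit.\<close>

lemma trivial_covering_stable: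
  assumes f: "trivial_covering \<Gamma> f" and pb: "is_pullback C f b a f'"
  shows "trivial_covering \<Gamma> f'"
proof -
  have f_fib: "f \<in> gE \<Gamma>" and f_sq: "is_pullback C (I f) (\<eta> (Cod C f)) (\<eta> (Dom C f)) f"
    using f by (simp_all add: trivial_covering_def)
  have f'_fib: "f' \<in> gE \<Gamma>" by (rule pullback_stable_closed[OF fibration_stable f_fib pb])
  note P = is_pullbackD[OF pb]
  let ?B = "Cod C f'" and ?A = "Dom C f'"
  have ar: "f \<in> Arr C" "b \<in> Arr C" "a \<in> Arr C" "f' \<in> Arr C" "Dom C a = ?A" "Cod C a = Dom C f" "Dom C b = ?B"
    "Cod C b = Cod C f" "f \<cdot> a = b \<cdot> f'" "?A \<in> Obj C" "?B \<in> Obj C"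
    using P dom_obj[of f'] by simp_all
  define g where "g = snd (pb X (I f) (I b))"
  define q where "q = fst (pb X (I f) (I b))"
  have "is_pullback X (I f) (I b) q g" and g_F: "g \<in> gF \<Gamma>"
    unfolding g_def q_def using pullback_stable_pb[OF gF_stable I_gF[OF f_fib], of "I b"] ar by simp_all
  then have pbX: "is_pullback C (I f) (I b) q g" by (intro pullback_X_to_C)
  note Q = is_pullbackD[OF pbX]
  have gq: "g \<in> Arr C" "q \<in> Arr C" "Dom C q = Dom C g" "Cod C q = Io (Dom C f)" "Cod C g = Io ?B"
    "I f \<cdot> q = I b \<cdot> g"
    using Q ar by simp_all
  have "I f \<cdot> (\<eta> (Dom C f) \<cdot> a) = I b \<cdot> (\<eta> ?B \<cdot> f')"
    using ar unit_naturality_comp[of f "Cod C f" a] unit_naturality_comp[of b "Cod C b" f'] by simp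
  then obtain y where y: "y \<in> hom C ?A (Dom C q)" "q \<cdot> y = \<eta> (Dom C f) \<cdot> a" "g \<cdot> y = \<eta> ?B \<cdot> f'"
    using is_pullback_factor[OF pbX, of "\<eta> (Dom C f) \<cdot> a" ?A "\<eta> ?B \<cdot> f'"] ar by (auto simp: in_hom_iff)
  have y': "y \<in> Arr C" "Dom C y = ?A" "Cod C y = Dom C g" using y(1) gq by (simp_all add: in_hom_iff)
  have left: "is_pullback C g (\<eta> ?B) y f'"
  proof (rule is_pullbackI)
    show "\<exists>x. x \<in> hom C T (Dom C y) \<and> y \<cdot> x = r \<and> f' \<cdot> x = e"
      if re: "r \<in> hom C T (Dom C g)" "e \<in> hom C T (Dom C (\<eta> ?B))" "g \<cdot> r = \<eta> ?B \<cdot> e" for T r e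
    proof -
      have r: "r \<in> Arr C" "Dom C r = T" "Cod C r = Dom C g" "e \<in> Arr C" "Dom C e = T" "Cod C e = ?B"
        using re ar by (simp_all add: in_hom_iff)
      have "I f \<cdot> (q \<cdot> r) = I b \<cdot> (g \<cdot> r)" using comp_eq_extend[OF gq(6), of r] ar gq(1-5) r by simp
      also have "\<dots> = \<eta> (Cod C f) \<cdot> (b \<cdot> e)"
        unfolding re(3) using ar r unit_naturality_comp[of b "Cod C b" e] by simp
      finally obtain x0 where x0: "x0 \<in> hom C T (Dom C f)" "\<eta> (Dom C f) \<cdot> x0 = q \<cdot> r" "f \<cdot> x0 = b \<cdot> e"
        using is_pullback_factor[OF f_sq, of "q \<cdot> r" T "b \<cdot> e"] ar gq(1-5) r by (auto simp: in_hom_iff)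
      obtain x where x: "x \<in> hom C T (Dom C a)" "a \<cdot> x = x0" "f' \<cdot> x = e"
        by (rule is_pullback_factor[OF pb x0(1), of e]) (use x0 r ar in \<open>simp_all add: in_hom_iff\<close>)
      have x': "x \<in> Arr C" "Dom C x = T" "Cod C x = ?A" using x ar by (simp_all add: in_hom_iff)
      have "y \<cdot> x = r"
      proof (rule is_pullback_jointly_monic[OF pbX, of _ T])
        show "q \<cdot> (y \<cdot> x) = q \<cdot> r" using comp_eq_extend[OF y(2), of x] gq(1-5) y' x' x x0 ar by simp
        show "g \<cdot> (y \<cdot> x) = g \<cdot> r" using comp_eq_extend[OF y(3), of x] gq(1-5) y' x' x re(3) ar by simp
      qed (use x' y' r gq(1-5) in \<open>simp_all add: in_hom_iff\<close>)
      then show ?thesis using x x' y' by (intro exI[of _ x]) (simp add: in_hom_iff)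
    qed
    show "x = x'" if xx: "x \<in> hom C T (Dom C y)" "x' \<in> hom C T (Dom C y)" "y \<cdot> x = y \<cdot> x'" "f' \<cdot> x = f' \<cdot> x'" for T x x'
    proof (rule is_pullback_jointly_monic[OF pb, of x T x'])
      have x: "x \<in> Arr C" "Dom C x = T" "Cod C x = ?A" "x' \<in> Arr C" "Dom C x' = T" "Cod C x' = ?A"
        using xx y' by (simp_all add: in_hom_iff)
      have \<eta>a: "\<eta> (Dom C f) \<cdot> (a \<cdot> z) = q \<cdot> (y \<cdot> z)" if "z \<in> Arr C" "Cod C z = ?A" for z
        using comp_eq_extend[OF y(2), of z] that y' gq(1-5) ar(1-8,10,11) by simp
      show "a \<cdot> x = a \<cdot> x'"
        by (rule is_pullback_jointly_monic[OF f_sq, of _ T])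
          (use x xx(3,4) ar(1-8,10,11) \<eta>a comp_eq_extend[OF ar(9)]
            in \<open>simp_all add: in_hom_iff\<close>)
    qed (use xx y' ar in \<open>simp_all add: in_hom_iff\<close>)
  qed (use ar gq y y' in simp_all)
  let ?y0 = "fst (pb C g (\<eta> ?B))" and ?f0 = "snd (pb C g (\<eta> ?B))"
  have f0_sq: "is_pullback C (I ?f0) (\<eta> ?B) (\<eta> (Dom C ?f0)) ?f0"
    by (rule pullback_along_unit_trivial) (use ar gq g_F in simp_all)
  have pb0: "is_pullback C g (\<eta> ?B) ?y0 ?f0"
    by (rule pb_is_pullback) (use left in blast)
  note R = is_pullbackD[OF pb0]
  have R': "?y0 \<in> Arr C" "?f0 \<in> Arr C" "Dom C ?f0 = Dom C ?y0" "Cod C ?y0 = Dom C g" "Cod C ?f0 = ?B" "g \<cdot> ?y0 = \<eta> ?B \<cdot> ?f0"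
    using R ar by simp_all
  obtain \<theta> where \<theta>: "\<theta> \<in> hom C ?A (Dom C ?y0)" "?y0 \<cdot> \<theta> = y" "?f0 \<cdot> \<theta> = f'"
    by (rule is_pullback_factor[OF pb0, of y ?A f']) (use ar y y' in \<open>simp_all add: in_hom_iff\<close>)
  obtain \<theta>' where \<theta>': "\<theta>' \<in> hom C (Dom C ?y0) (Dom C y)" "y \<cdot> \<theta>' = ?y0" "f' \<cdot> \<theta>' = ?f0"
    by (rule is_pullback_factor[OF left, of ?y0 "Dom C ?y0" ?f0]) (use ar R' in \<open>simp_all add: in_hom_iff\<close>)
  have \<theta>s: "\<theta> \<in> Arr C" "\<theta>' \<in> Arr C" "Dom C \<theta> = ?A" "Cod C \<theta> = Dom C ?y0" "Dom C \<theta>' = Dom C ?y0" "Cod C \<theta>' = ?A"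
    using \<theta>(1) \<theta>'(1) y' by (simp_all add: in_hom_iff)
  have "\<theta>' \<cdot> \<theta> = Id C ?A"
    by (rule is_pullback_jointly_monic[OF left, of _ ?A])
      (use \<theta>s \<theta>(2,3) y' ar comp_eq_extend[OF \<theta>'(2), of \<theta>] comp_eq_extend[OF \<theta>'(3), of \<theta>] in \<open>simp_all add: in_hom_iff\<close>)
  moreover have "\<theta> \<cdot> \<theta>' = Id C (Dom C ?y0)"
    by (rule is_pullback_jointly_monic[OF pb0, of _ "Dom C ?y0"])
      (use \<theta>s \<theta>'(2,3) R'(1-5) comp_eq_extend[OF \<theta>(2), of \<theta>'] comp_eq_extend[OF \<theta>(3), of \<theta>'] in \<open>simp_all add: in_hom_iff\<close>)
  ultimately have "is_pullback C (I f') (\<eta> ?B) (\<eta> ?A) f'"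
    using unit_square_iso[of ?f0 \<theta> \<theta>'] f0_sq \<theta>s \<theta>(3) R'(3,5) by simp
  then show ?thesis using f'_fib by (simp add: trivial_covering_def)
qed

text \<open>A projection of the kernel pair of a pullback of \<open>p\<close> is a pullback of a projection of the kernel pair
  of \<open>p\<close>.\<close>

lemma normal_extension_stable:
  assumes p: "normal_extension \<Gamma> p" and pb: "is_pullback C p b a q"
  shows "normal_extension \<Gamma> q"
proof -
  interpret P: normal_ext C \<Gamma> S p using p by unfold_locales
  note D = is_pullbackD[OF pb]
  have ar: "b \<in> Arr C" "a \<in> Arr C" "q \<in> Arr C" "Dom C a = Dom C q" "Cod C a = P.E" "Cod C q = Dom C b"
    "Cod C b = Cod C p" "p \<cdot> a = b \<cdot> q"
    using D by simp_all
  have pa: "p \<cdot> (a \<cdot> x) = b \<cdot> (q \<cdot> x)" if "x \<in> Arr C" "Cod C x = Dom C q" for x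
    using comp_eq_extend[OF ar(8), of x] ar that by simp
  let ?d = "fst (pb C q q)" and ?c = "snd (pb C q q)"
  have kp: "is_pullback C q q ?d ?c"
    by (rule pb_is_pullback, rule finitely_complete_pullback[OF complete]) (use ar in simp_all)
  note K = is_pullbackD[OF kp]
  have dc: "?d \<in> Arr C" "?c \<in> Arr C" "Dom C ?c = Dom C ?d" "Cod C ?d = Dom C q" "Cod C ?c = Dom C q" "q \<cdot> ?d = q \<cdot> ?c"
    using K by simp_all
  have qd: "q \<cdot> (?d \<cdot> x) = q \<cdot> (?c \<cdot> x)" if "x \<in> Arr C" "Cod C x = Dom C ?d" for x
    using comp_eq_extend[OF dc(6), of x] ar(3) dc(1-5) that by simp
  obtain h where h: "h \<in> Arr C" "Dom C h = Dom C ?d" "Cod C h = P.Q" "P.d \<cdot> h = a \<cdot> ?d" "P.c \<cdot> h = a \<cdot> ?c"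
    by (rule P.pair_exists[of "a \<cdot> ?d" "a \<cdot> ?c"]) (use ar(1-7) dc pa in simp_all)
  have dh: "P.d \<cdot> (h \<cdot> x) = a \<cdot> (?d \<cdot> x)" "P.c \<cdot> (h \<cdot> x) = a \<cdot> (?c \<cdot> x)" if "x \<in> Arr C" "Cod C x = Dom C ?d" for x
    using comp_eq_extend[OF h(4), of x] comp_eq_extend[OF h(5), of x] h(1-3) ar(1-7) dc(1-5) that by simp_all
  have "is_pullback C P.c a h ?c"
  proof (rule is_pullbackI)
    show "\<exists>x. x \<in> hom C T (Dom C h) \<and> h \<cdot> x = r \<and> ?c \<cdot> x = e"
      if re: "r \<in> hom C T (Dom C P.c)" "e \<in> hom C T (Dom C a)" "P.c \<cdot> r = a \<cdot> e" for T r e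
    proof -
      have r: "r \<in> Arr C" "Dom C r = T" "Cod C r = P.Q" "e \<in> Arr C" "Dom C e = T" "Cod C e = Dom C q"
        using re(1,2) ar(1-7) by (simp_all add: in_hom_iff)
      have "p \<cdot> (P.d \<cdot> r) = p \<cdot> (P.c \<cdot> r)" using r by simp
      also have "\<dots> = b \<cdot> (q \<cdot> e)" unfolding re(3) using pa r by simp
      finally obtain y where y: "y \<in> hom C T (Dom C a)" "a \<cdot> y = P.d \<cdot> r" "q \<cdot> y = q \<cdot> e"
        using is_pullback_factor[OF pb, of "P.d \<cdot> r" T "q \<cdot> e"] r ar(1-7) by (auto simp: in_hom_iff)
      then have y': "y \<in> Arr C" "Dom C y = T" "Cod C y = Dom C q" using ar(1-7) by (simp_all add: in_hom_iff)
      obtain x where x: "x \<in> hom C T (Dom C ?d)" "?d \<cdot> x = y" "?c \<cdot> x = e"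
        by (rule is_pullback_factor[OF kp, of y T e]) (use y(3) y' r in \<open>simp_all add: in_hom_iff\<close>)
      have x': "x \<in> Arr C" "Dom C x = T" "Cod C x = Dom C ?d" using x(1) by (simp_all add: in_hom_iff)
      have "h \<cdot> x = r"
        by (rule P.pair_unique) (use h(1-3) x' x(2,3) r re(3) dh y(2) in simp_all)
      then show ?thesis using x h(2) by auto
    qed
    show "x = x'" if xx: "x \<in> hom C T (Dom C h)" "x' \<in> hom C T (Dom C h)" "h \<cdot> x = h \<cdot> x'" "?c \<cdot> x = ?c \<cdot> x'"
      for T x x'
    proof (rule is_pullback_jointly_monic[OF kp, of x T x'])
      have x: "x \<in> Arr C" "Dom C x = T" "Cod C x = Dom C ?d" "x' \<in> Arr C" "Dom C x' = T" "Cod C x' = Dom C ?d"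
        using xx(1,2) h(2) by (simp_all add: in_hom_iff)
      have "a \<cdot> (?d \<cdot> x) = a \<cdot> (?d \<cdot> x')" using dh(1)[of x] dh(1)[of x'] x xx(3) by simp
      then show "?d \<cdot> x = ?d \<cdot> x'"
        by - (rule is_pullback_jointly_monic[OF pb, of _ T],
          use x xx(4) ar(1-7) dc(1-5) qd in \<open>simp_all add: in_hom_iff\<close>)
    qed (use xx h(2) in \<open>simp_all add: in_hom_iff\<close>)
  qed (use h ar(1-7) dc(1-5) in simp_all)
  moreover have "trivial_covering \<Gamma> P.c"
    using p by (simp add: normal_extension_def pullback_fctr_simps(1) kp_snd_def)
  ultimately have "trivial_covering \<Gamma> ?c" using trivial_covering_stable by blast
  moreover have "monadic_extension \<Gamma> q"
    using pullback_stable_closed[OF monadic_stable _ pb] p by (simp add: normal_extension_def)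
  ultimately show ?thesis by (simp add: normal_extension_def pullback_fctr_simps(1))
qed

text \<open>The arrow \<open>Y \<rightarrow> 0\<close> is split by \<open>0 \<rightarrow> Y\<close>, hence monadic. Its kernel pair \<open>Y \<times> Y\<close> is a pullback of objects of \<open>X\<close>, so
  the units at \<open>Y\<close> and at \<open>Y \<times> Y\<close> are invertible and the naturality square of a projection is trivially a pullback.\<close>

lemma normal_extension_to_zero:
  assumes Y: "Y \<in> S" and Z: "is_zero_object C Z" "Z \<in> S" and F: "zero_arr C Y Z \<in> gF \<Gamma>"
  shows "normal_extension \<Gamma> (zero_arr C Y Z)"
proof -
  let ?t = "zero_arr C Y Z" and ?s = "zero_arr C Z Y"
  have obj: "Y \<in> Obj C" "Z \<in> Obj C" using Y Z by simp_all
  have fib: "?t \<in> gE \<Gamma>" by (rule gF_fibration[OF F])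
  have "Id C Z = zero_arr C Z Z" by (rule zero_arr_unique_to[OF Z(1)]) (use obj in \<open>simp add: in_hom_iff\<close>)
  then interpret split_fibration C "gE \<Gamma>" ?t ?s
    using galois_structure.E_class[OF galois] fib obj
    by unfold_locales (simp_all add: in_hom_iff)
  have "monadic_extension \<Gamma> ?t"
    using monadic_pullback_split fib obj by (simp add: monadic_extension_def fib_slice_def)
  moreover
  let ?c = "snd (pb C ?t ?t)" and ?d = "fst (pb C ?t ?t)"
  have kp: "is_pullback C ?t ?t ?d ?c" and c_fib: "?c \<in> gE \<Gamma>"
    using pullback_stable_pb[OF fibration_stable fib, of ?t] obj by simp_all
  have dc: "?d \<in> Arr C" "?c \<in> Arr C" "Dom C ?c = Dom C ?d" "Cod C ?c = Y"
    using is_pullbackD[OF kp] obj by simp_all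
  obtain r where r: "r \<in> Arr C" "Dom C r = Io (Dom C ?d)" "Cod C r = Dom C ?d"
    "r \<cdot> \<eta> (Dom C ?d) = Id C (Dom C ?d)" "\<eta> (Dom C ?d) \<cdot> r = Id C (Io (Dom C ?d))"
    by (rule unit_invertible_on_pullback[OF kp]) (use Y Z obj in simp_all)
  obtain v where v: "v \<in> Arr C" "Dom C v = Io Y" "Cod C v = Y" "v \<cdot> \<eta> Y = Id C Y"
    by (rule reflect[of "Id C Y" Y]) (use Y in auto)
  have Q: "Dom C ?d \<in> Obj C" using dc by simp
  have "is_pullback C (I ?c) (\<eta> Y) (\<eta> (Dom C ?d)) ?c"
  proof (rule is_pullbackI)
    show "I ?c \<cdot> \<eta> (Dom C ?d) = \<eta> Y \<cdot> ?c" using dc unit_naturality[of ?c Y] by simp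
    show "\<exists>x. x \<in> hom C T (Dom C (\<eta> (Dom C ?d))) \<and> \<eta> (Dom C ?d) \<cdot> x = a \<and> ?c \<cdot> x = e"
      if ae: "a \<in> hom C T (Dom C (I ?c))" "e \<in> hom C T (Dom C (\<eta> Y))" "I ?c \<cdot> a = \<eta> Y \<cdot> e" for T a e
    proof -
      have a: "a \<in> Arr C" "Dom C a = T" "Cod C a = Io (Dom C ?d)" "e \<in> Arr C" "Dom C e = T" "Cod C e = Y"
        using ae(1,2) dc Y by (simp_all add: in_hom_iff)
      have \<eta>r: "\<eta> (Dom C ?d) \<cdot> (r \<cdot> a) = a" using comp_eq_extend[OF r(5), of a] r(1-3) a Q by simp
      have "\<eta> Y \<cdot> (?c \<cdot> (r \<cdot> a)) = I ?c \<cdot> (\<eta> (Dom C ?d) \<cdot> (r \<cdot> a))"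
        using unit_naturality_comp[of ?c Y "r \<cdot> a"] dc r(1-3) a by simp
      then have "v \<cdot> (\<eta> Y \<cdot> (?c \<cdot> (r \<cdot> a))) = v \<cdot> (\<eta> Y \<cdot> e)" using \<eta>r ae(3) by simp
      then have "?c \<cdot> (r \<cdot> a) = e" using comp_eq_extend[OF v(4)] v(1-3) dc r(1-3) a obj by simp
      then show ?thesis using \<eta>r r(1-3) a Q by (intro exI[of _ "r \<cdot> a"]) (simp add: in_hom_iff)
    qed
    show "x = x'" if xx: "x \<in> hom C T (Dom C (\<eta> (Dom C ?d)))" "x' \<in> hom C T (Dom C (\<eta> (Dom C ?d)))"
      "\<eta> (Dom C ?d) \<cdot> x = \<eta> (Dom C ?d) \<cdot> x'" "?c \<cdot> x = ?c \<cdot> x'" for T x x'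
    proof -
      have "r \<cdot> (\<eta> (Dom C ?d) \<cdot> x) = r \<cdot> (\<eta> (Dom C ?d) \<cdot> x')" using xx(3) by simp
      then show ?thesis using comp_eq_extend[OF r(4)] r(1-3) xx(1,2) Q by (simp add: in_hom_iff)
    qed
  qed (use dc Y Q in simp_all)
  then have "trivial_covering \<Gamma> ?c" using c_fib dc by (simp add: trivial_covering_def)
  ultimately show ?thesis by (simp add: normal_extension_def pullback_fctr_simps(1))
qed

end

section \<open>The kernel and Galois group functors\<close>

context reflective_galois
begin

lemma normal_extension_arr: "normal_extension \<Gamma> p \<Longrightarrow> p \<in> Arr C"
  using galois_structure.E_class[OF galois]
  by (auto simp: normal_extension_def monadic_extension_def arrow_class_def)

lemma NExt_Obj [simp]: "p \<in> Obj (NExt \<Gamma>) \<longleftrightarrow> normal_extension \<Gamma> p"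
  using normal_extension_arr by (auto simp: NExt_def)

lemma NExt_Arr: "(p, (f, b), p') \<in> Arr (NExt \<Gamma>) \<longleftrightarrow> normal_extension \<Gamma> p \<and> normal_extension \<Gamma> p' \<and>
     f \<in> hom C (Dom C p) (Dom C p') \<and> b \<in> hom C (Cod C p) (Cod C p') \<and> p' \<cdot> f = b \<cdot> p"
  using normal_extension_arr by (auto simp: NExt_def)

lemma NExt_simps [simp]: "Dom (NExt \<Gamma>) = fst" "Cod (NExt \<Gamma>) = (\<lambda>x. snd (snd x))"
  "Id (NExt \<Gamma>) = (\<lambda>p. (p, (Id C (Dom C p), Id C (Cod C p)), p))"
  "(q, (g, c), q') \<cdot>\<^bsub>NExt \<Gamma>\<^esub> (p, (f, b), p') = (p, (g \<cdot> f, c \<cdot> b), q')"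
  by (simp_all add: NExt_def)

lemma Ext_Obj: "p \<in> Obj (Ext \<Gamma>) \<longleftrightarrow> p \<in> Arr C \<and> monadic_extension \<Gamma> p"
  by (auto simp: Ext_def)

lemma Ext_Arr: "(p, (f, b), p') \<in> Arr (Ext \<Gamma>) \<longleftrightarrow> p \<in> Obj (Ext \<Gamma>) \<and> p' \<in> Obj (Ext \<Gamma>) \<and>
     f \<in> hom C (Dom C p) (Dom C p') \<and> b \<in> hom C (Cod C p) (Cod C p') \<and> p' \<cdot> f = b \<cdot> p"
  by (auto simp: Ext_def)

lemma Ext_simps [simp]: "Dom (Ext \<Gamma>) = fst" "Cod (Ext \<Gamma>) = (\<lambda>x. snd (snd x))"
  "Id (Ext \<Gamma>) = (\<lambda>p. (p, (Id C (Dom C p), Id C (Cod C p)), p))"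
  "(q, (g, c), q') \<cdot>\<^bsub>Ext \<Gamma>\<^esub> (p, (f, b), p') = (p, (g \<cdot> f, c \<cdot> b), q')"
  by (simp_all add: Ext_def)

lemma NExt_Obj_Ext: "p \<in> Obj (NExt \<Gamma>) \<Longrightarrow> p \<in> Obj (Ext \<Gamma>)"
  using normal_extension_arr by (auto simp: Ext_Obj normal_extension_def)

abbreviation Ker_obj :: "'a \<Rightarrow> 'o" where "Ker_obj p \<equiv> Dom C (nker \<Gamma> p)"
abbreviation Gal_obj :: "'a \<Rightarrow> 'o" where "Gal_obj p \<equiv> Dom C (gal_incl \<Gamma> p)"
abbreviation Ker_arr :: "'a \<times> ('a \<times> 'a) \<times> 'a \<Rightarrow> 'a" where "Ker_arr \<equiv> FA (Ker_fctr \<Gamma>)"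
abbreviation Gal_arr :: "'a \<times> ('a \<times> 'a) \<times> 'a \<Rightarrow> 'a" where "Gal_arr \<equiv> FA (Gal_fctr \<Gamma>)"

lemma Ker_Gal_FO [simp]: "FO (Ker_fctr \<Gamma>) p = Ker_obj p" "FO (Gal_fctr \<Gamma>) p = Gal_obj p"
  by (simp_all add: Ker_fctr_def Gal_fctr_def)

lemma normal_ext_facts [simp]:
  assumes "normal_extension \<Gamma> p"
  shows "nker \<Gamma> p \<in> Arr C" "Cod C (nker \<Gamma> p) = Dom C p" "Ker_obj p \<in> S" "gal_iota \<Gamma> p \<in> Arr C"
    "Dom C (gal_iota \<Gamma> p) = Gal_obj p" "Cod C (gal_iota \<Gamma> p) = Ker_obj p" "Gal_obj p \<in> S"
    "p \<cdot> nker \<Gamma> p = zero_arr C (Ker_obj p) (Cod C p)"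
proof -
  interpret normal_ext C \<Gamma> S p using assms by unfold_locales
  show "nker \<Gamma> p \<in> Arr C" "Cod C (nker \<Gamma> p) = Dom C p" "Ker_obj p \<in> S" "gal_iota \<Gamma> p \<in> Arr C"
    "Dom C (gal_iota \<Gamma> p) = Gal_obj p" "Cod C (gal_iota \<Gamma> p) = Ker_obj p" "Gal_obj p \<in> S"
    "p \<cdot> nker \<Gamma> p = zero_arr C (Ker_obj p) (Cod C p)" by simp_all
qed

lemma nker_mono:
  assumes "normal_extension \<Gamma> p" "l \<in> Arr C" "l' \<in> Arr C" "Dom C l = Dom C l'" "Cod C l = Ker_obj p"
    "Cod C l' = Ker_obj p" "nker \<Gamma> p \<cdot> l = nker \<Gamma> p \<cdot> l'"
  shows "l = l'"
proof -
  interpret normal_ext C \<Gamma> S p using assms(1) by unfold_locales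
  show ?thesis
    by (rule is_kernel_mono[OF nker(1), of _ "Dom C l"]) (use assms(2-) in \<open>simp_all add: in_hom_iff\<close>)
qed

lemma iota_mono:
  assumes "normal_extension \<Gamma> p" "l \<in> Arr C" "l' \<in> Arr C" "Dom C l = Dom C l'" "Cod C l = Gal_obj p"
    "Cod C l' = Gal_obj p" "gal_iota \<Gamma> p \<cdot> l = gal_iota \<Gamma> p \<cdot> l'"
  shows "l = l'"
proof -
  interpret normal_ext C \<Gamma> S p using assms(1) by unfold_locales
  show ?thesis using gal_iota_mono assms(2-) by blast
qed

lemma iota_factor:
  assumes p: "normal_extension \<Gamma> p" and t: "t \<in> Arr C" "Cod C t = Ker_obj p"
    "\<eta> (Dom C p) \<cdot> (nker \<Gamma> p \<cdot> t) = zero_arr C (Dom C t) (Io (Dom C p))"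
  shows "\<exists>l. l \<in> hom C (Dom C t) (Gal_obj p) \<and> gal_iota \<Gamma> p \<cdot> l = t"
proof -
  interpret normal_ext C \<Gamma> S p using p by unfold_locales
  obtain l where l: "l \<in> hom C (Dom C t) G" "j \<cdot> l = k \<cdot> t"
    using j_factor[of "k \<cdot> t"] t comp_eq_extend[OF nker_arr(3), of t] by auto
  have l': "l \<in> Arr C" "Dom C l = Dom C t" "Cod C l = G" using l by (simp_all add: in_hom_iff)
  have "gal_iota \<Gamma> p \<cdot> l = t"
    by (rule nker_mono[OF p]) (use l' l(2) t comp_eq_extend[OF gal_iota(4), of l] in simp_all)
  then show ?thesis using l by blast
qed

lemma Ker_arr:
  assumes "(p, (f, b), p') \<in> Arr (NExt \<Gamma>)"
  shows "Ker_arr (p, (f, b), p') \<in> Arr C" "Dom C (Ker_arr (p, (f, b), p')) = Ker_obj p"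
    "Cod C (Ker_arr (p, (f, b), p')) = Ker_obj p'" "nker \<Gamma> p' \<cdot> Ker_arr (p, (f, b), p') = f \<cdot> nker \<Gamma> p"
proof -
  have a: "normal_extension \<Gamma> p" "normal_extension \<Gamma> p'" "p \<in> Arr C" "p' \<in> Arr C" "f \<in> Arr C" "b \<in> Arr C" "Dom C f = Dom C p"
    "Cod C f = Dom C p'" "Dom C b = Cod C p" "Cod C b = Cod C p'" "p' \<cdot> f = b \<cdot> p"
    using assms normal_extension_arr by (auto simp: NExt_Arr in_hom_iff)
  interpret P': normal_ext C \<Gamma> S p' using a(2) by unfold_locales
  have "p' \<cdot> (f \<cdot> nker \<Gamma> p) = zero_arr C (Ker_obj p) (Cod C p')"
    using comp_eq_extend[OF a(11), of "nker \<Gamma> p"] a(1-10) by simp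
  then obtain k where k: "k \<in> hom C (Ker_obj p) (Ker_obj p')" "nker \<Gamma> p' \<cdot> k = f \<cdot> nker \<Gamma> p"
    using is_kernel_factor[OF P'.nker(1), of "f \<cdot> nker \<Gamma> p" "Ker_obj p"] a(1-10) by (auto simp: in_hom_iff)
  have "Ker_arr (p, (f, b), p') = (THE k. k \<in> hom X (Ker_obj p) (Ker_obj p') \<and> nker \<Gamma> p' \<cdot> k = f \<cdot> nker \<Gamma> p)"
    by (simp add: Ker_fctr_def)
  also have "\<dots> = k"
  proof (rule the_equality)
    fix l assume "l \<in> hom X (Ker_obj p) (Ker_obj p') \<and> nker \<Gamma> p' \<cdot> l = f \<cdot> nker \<Gamma> p"
    then show "l = k" using k by - (rule nker_mono[OF a(2)], simp_all add: in_hom_iff)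
  qed (use k a(1,2) in \<open>simp add: in_hom_iff\<close>)
  finally show "Ker_arr (p, (f, b), p') \<in> Arr C" "Dom C (Ker_arr (p, (f, b), p')) = Ker_obj p"
    "Cod C (Ker_arr (p, (f, b), p')) = Ker_obj p'" "nker \<Gamma> p' \<cdot> Ker_arr (p, (f, b), p') = f \<cdot> nker \<Gamma> p"
    using k by (simp_all add: in_hom_iff)
qed

text \<open>A morphism \<open>(f, b)\<close> maps the lift \<open>(0, e)\<close> of an element to \<open>(0, f e)\<close>, so the arrow defined inside \<open>I (Eq p')\<close> is the
  restriction along \<open>\<iota>\<close> of the arrow between the kernels.\<close>

lemma Gal_arr:
  assumes "(p, (f, b), p') \<in> Arr (NExt \<Gamma>)"
  shows "Gal_arr (p, (f, b), p') \<in> Arr C" "Dom C (Gal_arr (p, (f, b), p')) = Gal_obj p"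
    "Cod C (Gal_arr (p, (f, b), p')) = Gal_obj p'"
    "gal_iota \<Gamma> p' \<cdot> Gal_arr (p, (f, b), p') = Ker_arr (p, (f, b), p') \<cdot> gal_iota \<Gamma> p"
proof -
  have a: "normal_extension \<Gamma> p" "normal_extension \<Gamma> p'" "p \<in> Arr C" "p' \<in> Arr C" "f \<in> Arr C" "b \<in> Arr C" "Dom C f = Dom C p"
    "Cod C f = Dom C p'" "Dom C b = Cod C p" "Cod C b = Cod C p'" "p' \<cdot> f = b \<cdot> p"
    using assms normal_extension_arr by (auto simp: NExt_Arr in_hom_iff)
  interpret P: normal_ext C \<Gamma> S p using a(1) by unfold_locales
  interpret P': normal_ext C \<Gamma> S p' using a(2) by unfold_locales
  have pf: "p' \<cdot> (f \<cdot> x) = b \<cdot> (p \<cdot> x)" if "x \<in> Arr C" "Cod C x = P.E" for x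
    using comp_eq_extend[OF a(11), of x] a(3-10) that by simp
  obtain e where e: "e \<in> Arr C" "Dom C e = P.Q" "Cod C e = P'.Q" "P'.d \<cdot> e = f \<cdot> P.d" "P'.c \<cdot> e = f \<cdot> P.c"
    by (rule P'.pair_exists[of "f \<cdot> P.d" "f \<cdot> P.c"]) (use a(3-10) pf in simp_all)
  have Eq: "Eq_arr \<Gamma> p f p' = e"
    unfolding Eq_arr_def gC
  proof (rule the_equality)
    fix e' assume "e' \<in> hom C P.Q P'.Q \<and> P'.d \<cdot> e' = f \<cdot> P.d \<and> P'.c \<cdot> e' = f \<cdot> P.c"
    then show "e' = e" by - (rule P'.pair_unique, use e in \<open>simp_all add: in_hom_iff\<close>)
  qed (use e in \<open>simp add: in_hom_iff\<close>)
  have Ie: "I P'.d \<cdot> I e = I f \<cdot> I P.d" "I P'.c \<cdot> I e = I f \<cdot> I P.c"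
    using e a(5,7,8) by (simp_all flip: I_comp)
  have "I P'.d \<cdot> (I e \<cdot> P.i) = zero_arr C P.G (Io P'.E)" "I P'.c \<cdot> (I e \<cdot> P.i) = zero_arr C P.G (Io P'.E)"
    using comp_eq_extend[OF Ie(1), of P.i] comp_eq_extend[OF Ie(2), of P.i] e(1-3) a(5-8) by simp_all
  then obtain g where g: "g \<in> hom C P.G P'.G" "P'.i \<cdot> g = I e \<cdot> P.i"
    using P'.gal_incl_factor[of "I e \<cdot> P.i"] e(1-3) by auto
  have g': "g \<in> Arr C" "Dom C g = P.G" "Cod C g = P'.G" using g by (simp_all add: in_hom_iff)
  have "Gal_arr (p, (f, b), p') = (THE g. g \<in> hom X P.G P'.G \<and> P'.i \<cdot> g = I e \<cdot> P.i)"
    by (simp add: Gal_fctr_def Eq)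
  also have "\<dots> = g"
  proof (rule the_equality)
    fix l assume "l \<in> hom X P.G P'.G \<and> P'.i \<cdot> l = I e \<cdot> P.i"
    then show "l = g" by - (rule P'.gal_incl_mono, use g g' in \<open>simp_all add: in_hom_iff\<close>)
  qed (use g g' in \<open>simp add: in_hom_iff\<close>)
  finally have Gal: "Gal_arr (p, (f, b), p') = g" .
  then show "Gal_arr (p, (f, b), p') \<in> Arr C" "Dom C (Gal_arr (p, (f, b), p')) = Gal_obj p"
    "Cod C (Gal_arr (p, (f, b), p')) = Gal_obj p'" using g' by simp_all
  have "e \<cdot> P.gal_lift = P'.gal_lift \<cdot> g"
  proof (rule P'.d_lift_unique)
    have "\<eta> P'.Q \<cdot> (e \<cdot> P.gal_lift) = I e \<cdot> P.i"
      using unit_naturality_comp[of e P'.Q P.gal_lift] e(1-3) by simp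
    then show "\<eta> P'.Q \<cdot> (e \<cdot> P.gal_lift) = \<eta> P'.Q \<cdot> (P'.gal_lift \<cdot> g)"
      using comp_eq_extend[OF P'.gal_lift(4), of g] g' g(2) by simp
    show "P'.d \<cdot> (e \<cdot> P.gal_lift) = P'.d \<cdot> (P'.gal_lift \<cdot> g)"
      using comp_eq_extend[OF e(4), of P.gal_lift] comp_eq_extend[OF P'.gal_lift(5), of g] e(1-3) g' a(3-10) by simp
  qed (use e(1-3) g' in simp_all)
  then have "P'.c \<cdot> (e \<cdot> P.gal_lift) = P'.c \<cdot> (P'.gal_lift \<cdot> g)" by simp
  then have jg: "P'.j \<cdot> g = f \<cdot> P.j"
    using comp_eq_extend[OF e(5), of P.gal_lift] e(1-3) g' a(3-10) by (simp add: P.j_def P'.j_def)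
  note K = Ker_arr[OF assms]
  show "gal_iota \<Gamma> p' \<cdot> Gal_arr (p, (f, b), p') = Ker_arr (p, (f, b), p') \<cdot> gal_iota \<Gamma> p"
  proof (unfold Gal, rule nker_mono[OF a(2)])
    show "nker \<Gamma> p' \<cdot> (gal_iota \<Gamma> p' \<cdot> g) = nker \<Gamma> p' \<cdot> (Ker_arr (p, (f, b), p') \<cdot> gal_iota \<Gamma> p)"
      using comp_eq_extend[OF P'.gal_iota(4), of g] comp_eq_extend[OF K(4), of "gal_iota \<Gamma> p"] K(1-3) g' jg a(3-10)
      by simp
  qed (use g' K(1-3) in simp_all)
qed

text \<open>Two morphisms \<open>(f, b)\<close> and \<open>(f', b)\<close> give \<open>\<langle>f, f'\<rangle> : E \<rightarrow> Eq p'\<close>. On the elements \<open>e\<close> of the Galois group, which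
  the unit kills, both \<open>\<langle>f e, f' e\<rangle>\<close> and \<open>\<langle>f' e, f' e\<rangle>\<close> are killed by the unit; having the same
  second component, they agree because the second projection is a trivial covering.\<close>

lemma Gal_arr_cod_only:
  assumes ar: "(p, (f, b), p') \<in> Arr (NExt \<Gamma>)" "(p, (f', b), p') \<in> Arr (NExt \<Gamma>)"
  shows "Gal_arr (p, (f, b), p') = Gal_arr (p, (f', b), p')"
proof -
  have a: "normal_extension \<Gamma> p" "normal_extension \<Gamma> p'" "p \<in> Arr C" "p' \<in> Arr C" "f \<in> Arr C" "f' \<in> Arr C" "Dom C f = Dom C p"
    "Dom C f' = Dom C p" "Cod C f = Dom C p'" "Cod C f' = Dom C p'" "p' \<cdot> f = p' \<cdot> f'"
    using ar normal_extension_arr by (auto simp: NExt_Arr in_hom_iff)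
  interpret P: normal_ext C \<Gamma> S p using a(1) by unfold_locales
  interpret P': normal_ext C \<Gamma> S p' using a(2) by unfold_locales
  obtain h where h: "h \<in> Arr C" "Dom C h = P.E" "Cod C h = P'.Q" "P'.d \<cdot> h = f" "P'.c \<cdot> h = f'"
    by (rule P'.pair_exists[of f f']) (use a in simp_all)
  obtain h' where h': "h' \<in> Arr C" "Dom C h' = P.E" "Cod C h' = P'.Q" "P'.d \<cdot> h' = f'" "P'.c \<cdot> h' = f'"
    by (rule P'.pair_exists[of f' f']) (use a in simp_all)
  have "h \<cdot> P.j = h' \<cdot> P.j"
    by (rule P'.c_lift_unique)
      (use h h' unit_naturality_comp[of h P'.Q P.j] unit_naturality_comp[of h' P'.Q P.j]
        comp_eq_extend[OF h(5), of P.j] comp_eq_extend[OF h'(5), of P.j] in simp_all)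
  then have "P'.d \<cdot> (h \<cdot> P.j) = P'.d \<cdot> (h' \<cdot> P.j)" by simp
  then have fj: "f \<cdot> P.j = f' \<cdot> P.j"
    using comp_eq_extend[OF h(4), of P.j] comp_eq_extend[OF h'(4), of P.j] h(1-3) h'(1-3) by simp
  note K = Ker_arr[OF ar(1)] and K' = Ker_arr[OF ar(2)]
  have "Ker_arr (p, (f, b), p') \<cdot> gal_iota \<Gamma> p = Ker_arr (p, (f', b), p') \<cdot> gal_iota \<Gamma> p"
    by (rule nker_mono[OF a(2)])
      (use K(1-3) K'(1-3) comp_eq_extend[OF K(4), of "gal_iota \<Gamma> p"] comp_eq_extend[OF K'(4), of "gal_iota \<Gamma> p"] fj a(5-10)
        in simp_all)
  then show ?thesis
    by - (rule iota_mono[OF a(2)], use Gal_arr[OF ar(1)] Gal_arr[OF ar(2)] in simp_all)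
qed

lemma category_NExt: "category (NExt \<Gamma>)"
  unfolding NExt_def using category.category_full_sub[OF category_arrow_cat] by simp

lemma NExt_comp:
  assumes "(p, (f, b), q) \<in> Arr (NExt \<Gamma>)" "(q, (g, c), r) \<in> Arr (NExt \<Gamma>)"
  shows "(p, (g \<cdot> f, c \<cdot> b), r) \<in> Arr (NExt \<Gamma>)"
  using category.comp_arr[OF category_NExt assms] by simp

lemma Ker_arr_comp:
  assumes ar: "(p, (f, b), q) \<in> Arr (NExt \<Gamma>)" "(q, (g, c), r) \<in> Arr (NExt \<Gamma>)"
  shows "Ker_arr (p, (g \<cdot> f, c \<cdot> b), r) = Ker_arr (q, (g, c), r) \<cdot> Ker_arr (p, (f, b), q)"
proof -
  note K = Ker_arr[OF ar(1)] and L = Ker_arr[OF ar(2)] and KL = Ker_arr[OF NExt_comp[OF ar]]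
  have a: "normal_extension \<Gamma> p" "normal_extension \<Gamma> q" "normal_extension \<Gamma> r" "p \<in> Arr C" "q \<in> Arr C" "r \<in> Arr C"
    "f \<in> Arr C" "Dom C f = Dom C p" "Cod C f = Dom C q" "g \<in> Arr C" "Dom C g = Dom C q" "Cod C g = Dom C r"
    using ar normal_extension_arr by (auto simp: NExt_Arr in_hom_iff)
  show ?thesis
  proof (rule nker_mono[OF a(3)])
    show "nker \<Gamma> r \<cdot> Ker_arr (p, (g \<cdot> f, c \<cdot> b), r) = nker \<Gamma> r \<cdot> (Ker_arr (q, (g, c), r) \<cdot> Ker_arr (p, (f, b), q))"
      using comp_eq_extend[OF L(4), of "Ker_arr (p, (f, b), q)"] K L(1-3) KL(4) a by simp
  qed (use K(1-3) L(1-3) KL(1-3) in simp_all)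
qed

lemma Gal_arr_comp:
  assumes ar: "(p, (f, b), q) \<in> Arr (NExt \<Gamma>)" "(q, (g, c), r) \<in> Arr (NExt \<Gamma>)"
  shows "Gal_arr (p, (g \<cdot> f, c \<cdot> b), r) = Gal_arr (q, (g, c), r) \<cdot> Gal_arr (p, (f, b), q)"
proof -
  note K = Gal_arr[OF ar(1)] and L = Gal_arr[OF ar(2)] and KL = Gal_arr[OF NExt_comp[OF ar]]
  note k = Ker_arr(1-3)[OF ar(1)] and l = Ker_arr(1-3)[OF ar(2)]
  have a: "normal_extension \<Gamma> p" "normal_extension \<Gamma> q" "normal_extension \<Gamma> r"
    using ar by (auto simp: NExt_Arr in_hom_iff)
  show ?thesis
  proof (rule iota_mono[OF a(3)])
    show "gal_iota \<Gamma> r \<cdot> Gal_arr (p, (g \<cdot> f, c \<cdot> b), r) = gal_iota \<Gamma> r \<cdot> (Gal_arr (q, (g, c), r) \<cdot> Gal_arr (p, (f, b), q))"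
      using comp_eq_extend[OF L(4), of "Gal_arr (p, (f, b), q)"] K L(1-3) KL(4) k l a by (simp add: Ker_arr_comp[OF ar])
  qed (use K(1-3) L(1-3) KL(1-3) in simp_all)
qed

lemma NExt_Id: "normal_extension \<Gamma> p \<Longrightarrow> (p, (Id C (Dom C p), Id C (Cod C p)), p) \<in> Arr (NExt \<Gamma>)"
  using normal_extension_arr[of p] by (simp add: NExt_Arr in_hom_iff)

lemma Ker_arr_Id: "normal_extension \<Gamma> p \<Longrightarrow> Ker_arr (p, (Id C (Dom C p), Id C (Cod C p)), p) = Id C (Ker_obj p)"
  by (rule nker_mono[of p]) (use Ker_arr[OF NExt_Id[of p]] normal_extension_arr[of p] in simp_all)

lemma Gal_arr_Id: "normal_extension \<Gamma> p \<Longrightarrow> Gal_arr (p, (Id C (Dom C p), Id C (Cod C p)), p) = Id C (Gal_obj p)"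
  by (rule iota_mono[of p]) (use Gal_arr[OF NExt_Id[of p]] Ker_arr_Id[of p] in simp_all)

lemma cat_functor_Ker: "cat_functor (NExt \<Gamma>) X (Ker_fctr \<Gamma>)"
proof (rule cat_functor.intro)
  show "category (NExt \<Gamma>)" by (rule category_NExt)
  show "category X" by (rule category_full_sub)
  fix x y z \<phi> \<psi>
  show "FO (Ker_fctr \<Gamma>) x \<in> Obj X" if "x \<in> Obj (NExt \<Gamma>)" using that by simp
  show "FA (Ker_fctr \<Gamma>) (Id (NExt \<Gamma>) x) = Id X (FO (Ker_fctr \<Gamma>) x)" if "x \<in> Obj (NExt \<Gamma>)"
    using that Ker_arr_Id by simp
  assume "\<phi> \<in> hom (NExt \<Gamma>) x y"
  then obtain f b where f: "\<phi> = (x, (f, b), y)" "(x, (f, b), y) \<in> Arr (NExt \<Gamma>)"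
    by (cases \<phi>) (auto simp: in_hom_iff)
  then show "FA (Ker_fctr \<Gamma>) \<phi> \<in> hom X (FO (Ker_fctr \<Gamma>) x) (FO (Ker_fctr \<Gamma>) y)"
    using Ker_arr[OF f(2)] by (auto simp: in_hom_iff NExt_Arr)
  assume "\<psi> \<in> hom (NExt \<Gamma>) y z"
  then obtain g c where g: "\<psi> = (y, (g, c), z)" "(y, (g, c), z) \<in> Arr (NExt \<Gamma>)"
    by (cases \<psi>) (auto simp: in_hom_iff)
  show "FA (Ker_fctr \<Gamma>) (\<psi> \<cdot>\<^bsub>NExt \<Gamma>\<^esub> \<phi>) = FA (Ker_fctr \<Gamma>) \<psi> \<cdot>\<^bsub>X\<^esub> FA (Ker_fctr \<Gamma>) \<phi>"
    unfolding f(1) g(1) using Ker_arr_comp[OF f(2) g(2)] by simp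
qed

lemma cat_functor_cod:
  "cat_functor (Ext \<Gamma>) C (cod_fctr C)"
proof (rule cat_functor.intro)
  show "category (Ext \<Gamma>)" unfolding Ext_def using category.category_full_sub[OF category_arrow_cat] by simp
  show "category C" by (rule category_axioms)
qed (auto simp: in_hom_iff Ext_Arr Ext_Obj cod_fctr_def)

end

section \<open>The fundamental group as a Kan extension\<close>

locale fundamental_group = admissible_galois C \<Gamma> S
  for C :: "('o, 'a) cat" (structure) and \<Gamma> :: "('o, 'a, 'o, 'a) galois" and S :: "'o set" +
  fixes u :: "'o \<Rightarrow> 'a"
  assumes weakly_universal: "B \<in> Obj C \<Longrightarrow> weakly_universal \<Gamma> B (u B)"
    and to_zero: "\<lbrakk>A \<in> Obj C; is_zero_object X Z; t \<in> hom X (Io A) Z\<rbrakk> \<Longrightarrow> t \<in> gF \<Gamma>"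
begin

lemma u_normal [simp]: "B \<in> Obj C \<Longrightarrow> normal_extension \<Gamma> (u B)"
  and cod_u [simp]: "B \<in> Obj C \<Longrightarrow> Cod C (u B) = B"
  using weakly_universal[of B] by (simp_all add: weakly_universal_def)

lemma u_arr [simp]: "B \<in> Obj C \<Longrightarrow> u B \<in> Arr C"
  by (simp add: normal_extension_arr)

text \<open>A weakly universal extension maps to every normal extension over any arrow of the base, because it maps to the
  pullback along that arrow, which is normal.\<close>

lemma u_lift:
  assumes q: "normal_extension \<Gamma> q" and b: "b \<in> Arr C" "Cod C b = Cod C q"
  shows "\<exists>g. (u (Dom C b), (g, b), q) \<in> Arr (NExt \<Gamma>)"
proof -
  have q_arr: "q \<in> Arr C" by (rule normal_extension_arr[OF q])
  let ?A = "Dom C b"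
  obtain a r where pb: "is_pullback C q b a r"
    using finitely_complete_pullback[OF complete q_arr b(1)] b(2) by auto
  note D = is_pullbackD[OF pb]
  have "normal_extension \<Gamma> r" by (rule normal_extension_stable[OF q pb])
  then obtain e where e: "e \<in> hom C (Dom C (u ?A)) (Dom C r)" "r \<cdot> e = u ?A"
    using weakly_universal[of ?A] b D(8) unfolding weakly_universal_def by auto
  have e': "e \<in> Arr C" "Dom C e = Dom C (u ?A)" "Cod C e = Dom C r" using e(1) by (simp_all add: in_hom_iff)
  have "q \<cdot> (a \<cdot> e) = b \<cdot> u ?A"
    using comp_eq_extend[OF D(9), of e] D(1-8) e' e(2) by simp
  then have "(u ?A, (a \<cdot> e, b), q) \<in> Arr (NExt \<Gamma>)"
    using q b D(1-8) e' by (simp add: NExt_Arr in_hom_iff)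
  then show ?thesis by blast
qed

abbreviation pi1_arr :: "'a \<Rightarrow> 'a" where "pi1_arr \<equiv> FA (pi1 \<Gamma> u)"

lemma pi1_FO [simp]: "FO (pi1 \<Gamma> u) B = Gal_obj (u B)"
  by (simp add: pi1_def)

lemma pi1_arr_eq:
  assumes "(u A, (g, f), u B) \<in> Arr (NExt \<Gamma>)" "f \<in> Arr C" "Dom C f = A" "Cod C f = B"
  shows "pi1_arr f = Gal_arr (u A, (g, f), u B)"
proof -
  have "(u A, (SOME g. (u A, (g, f), u B) \<in> Arr (NExt \<Gamma>), f), u B) \<in> Arr (NExt \<Gamma>)"
    using assms(1) by (rule someI)
  from Gal_arr_cod_only[OF this assms(1)] show ?thesis using assms(3,4) by (simp add: pi1_def Let_def)
qed

lemma pi1_lift: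
  assumes f: "f \<in> Arr C"
  obtains g where "(u (Dom C f), (g, f), u (Cod C f)) \<in> Arr (NExt \<Gamma>)"
    "pi1_arr f = Gal_arr (u (Dom C f), (g, f), u (Cod C f))"
  using u_lift[of "u (Cod C f)" f] pi1_arr_eq f by auto

lemma kappa_eq:
  assumes "(u (Cod C p), (h, Id C (Cod C p)), p) \<in> Arr (NExt \<Gamma>)"
  shows "kappa \<Gamma> u p = Gal_arr (u (Cod C p), (h, Id C (Cod C p)), p)"
proof -
  let ?B = "Cod C p"
  have "(u ?B, (SOME h. (u ?B, (h, Id C ?B), p) \<in> Arr (NExt \<Gamma>), Id C ?B), p) \<in> Arr (NExt \<Gamma>)"
    using assms by (rule someI)
  from Gal_arr_cod_only[OF this assms] show ?thesis by (simp add: kappa_def Let_def)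
qed

lemma kappa_lift:
  assumes p: "normal_extension \<Gamma> p"
  obtains h where "(u (Cod C p), (h, Id C (Cod C p)), p) \<in> Arr (NExt \<Gamma>)"
    "kappa \<Gamma> u p = Gal_arr (u (Cod C p), (h, Id C (Cod C p)), p)"
  using u_lift[of p "Id C (Cod C p)"] kappa_eq p normal_extension_arr[of p] by auto

lemma cat_functor_pi1: "cat_functor C X (pi1 \<Gamma> u)"
proof (rule cat_functor.intro)
  show "category C" by (rule category_axioms)
  show "category X" by (rule category_full_sub)
  fix A B D f g
  show "FO (pi1 \<Gamma> u) A \<in> Obj X" if "A \<in> Obj C" using that by simp
  show "pi1_arr (Id C A) = Id X (FO (pi1 \<Gamma> u) A)" if A: "A \<in> Obj C"
    using pi1_arr_eq[of A "Id C (Dom C (u A))" "Id C A" A] NExt_Id[of "u A"] Gal_arr_Id[of "u A"] A by simp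
  assume f: "f \<in> hom C A B"
  then have f': "f \<in> Arr C" "Dom C f = A" "Cod C f = B" "A \<in> Obj C" "B \<in> Obj C" by (auto simp: in_hom_iff)
  obtain f1 where f1: "(u A, (f1, f), u B) \<in> Arr (NExt \<Gamma>)" "pi1_arr f = Gal_arr (u A, (f1, f), u B)"
    using pi1_lift[of f] f' by blast
  then show "pi1_arr f \<in> hom X (FO (pi1 \<Gamma> u) A) (FO (pi1 \<Gamma> u) B)"
    using Gal_arr[OF f1(1)] f' by (simp add: in_hom_iff)
  assume g: "g \<in> hom C B D"
  then have g': "g \<in> Arr C" "Dom C g = B" "Cod C g = D" by (auto simp: in_hom_iff)
  obtain g1 where g1: "(u B, (g1, g), u D) \<in> Arr (NExt \<Gamma>)" "pi1_arr g = Gal_arr (u B, (g1, g), u D)"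
    using pi1_lift[of g] g' by blast
  show "pi1_arr (g \<cdot> f) = pi1_arr g \<cdot>\<^bsub>X\<^esub> pi1_arr f"
    using pi1_arr_eq[OF NExt_comp[OF f1(1) g1(1)]] Gal_arr_comp[OF f1(1) g1(1)] f1(2) g1(2) f' g' by simp
qed

abbreviation \<delta> :: "'a \<Rightarrow> 'a" where "\<delta> \<equiv> delta \<Gamma> u"

lemma delta_arr:
  assumes p: "normal_extension \<Gamma> p"
  shows "\<delta> p \<in> Arr C" "Dom C (\<delta> p) = Gal_obj (u (Cod C p))" "Cod C (\<delta> p) = Ker_obj p"
proof -
  obtain h where h: "(u (Cod C p), (h, Id C (Cod C p)), p) \<in> Arr (NExt \<Gamma>)"
    "kappa \<Gamma> u p = Gal_arr (u (Cod C p), (h, Id C (Cod C p)), p)" by (rule kappa_lift[OF p])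
  then show "\<delta> p \<in> Arr C" "Dom C (\<delta> p) = Gal_obj (u (Cod C p))" "Cod C (\<delta> p) = Ker_obj p"
    using Gal_arr(1-3)[OF h(1)] p by (simp_all add: delta_def)
qed

text \<open>Both sides are \<open>\<iota>\<close> after the map of Galois groups induced by a morphism \<open>u (Cod p) \<rightarrow> q\<close> over \<open>b\<close>, and there is only one
  such map.\<close>

lemma delta_natural:
  assumes a: "(p, (f, b), q) \<in> Arr (NExt \<Gamma>)"
  shows "Ker_arr (p, (f, b), q) \<cdot> \<delta> p = \<delta> q \<cdot> pi1_arr b"
proof -
  have n: "normal_extension \<Gamma> p" "normal_extension \<Gamma> q" "p \<in> Arr C" "q \<in> Arr C" "b \<in> Arr C" "Dom C b = Cod C p" "Cod C b = Cod C q"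
    using a normal_extension_arr by (auto simp: NExt_Arr in_hom_iff)
  obtain h where h: "(u (Cod C p), (h, Id C (Cod C p)), p) \<in> Arr (NExt \<Gamma>)"
    "kappa \<Gamma> u p = Gal_arr (u (Cod C p), (h, Id C (Cod C p)), p)" by (rule kappa_lift[OF n(1)])
  obtain k where k: "(u (Cod C q), (k, Id C (Cod C q)), q) \<in> Arr (NExt \<Gamma>)"
    "kappa \<Gamma> u q = Gal_arr (u (Cod C q), (k, Id C (Cod C q)), q)" by (rule kappa_lift[OF n(2)])
  obtain g where g: "(u (Cod C p), (g, b), u (Cod C q)) \<in> Arr (NExt \<Gamma>)"
    "pi1_arr b = Gal_arr (u (Cod C p), (g, b), u (Cod C q))" using pi1_lift[OF n(5)] n(6,7) by auto
  have "Gal_arr (p, (f, b), q) \<cdot> kappa \<Gamma> u p = kappa \<Gamma> u q \<cdot> pi1_arr b"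
  proof -
    have "(u (Cod C p), (k \<cdot> g, b), q) \<in> Arr (NExt \<Gamma>)" "(u (Cod C p), (f \<cdot> h, b), q) \<in> Arr (NExt \<Gamma>)"
      using NExt_comp[OF h(1) a] NExt_comp[OF g(1) k(1)] n by simp_all
    from Gal_arr_cod_only[OF this] show ?thesis
      unfolding h(2) k(2) g(2) Gal_arr_comp[OF h(1) a, symmetric] Gal_arr_comp[OF g(1) k(1), symmetric]
      using n by simp
  qed
  then show ?thesis
    using Gal_arr[OF a] Gal_arr(1-3)[OF h(1)] Gal_arr(1-3)[OF k(1)] Gal_arr(1-3)[OF g(1)] Ker_arr(1-3)[OF a] n
      comp_eq_extend[OF Gal_arr(4)[OF a], of "kappa \<Gamma> u p"]
    by (simp add: delta_def h(2) k(2) g(2))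
qed

lemma delta_u:
  assumes B: "B \<in> Obj C" shows "\<delta> (u B) = gal_iota \<Gamma> (u B)"
proof -
  have "kappa \<Gamma> u (u B) = Id C (Gal_obj (u B))"
    using kappa_eq[of "u B" "Id C (Dom C (u B))"] NExt_Id[of "u B"] Gal_arr_Id[of "u B"] B by simp
  then show ?thesis using B by (simp add: delta_def)
qed

text \<open>The endomorphism \<open>(0, 1)\<close> of \<open>A \<rightarrow> 0\<close> induces zero on the kernel and the identity on \<open>F 0\<close>, so naturality forces the
  component to vanish.\<close>

lemma component_at_zero_base:
  assumes F: "cat_functor C X F"
    and comp: "\<And>p. normal_extension \<Gamma> p \<Longrightarrow> \<gamma> p \<in> hom X (FO F (Cod C p)) (Ker_obj p)"
    and nat: "\<And>p f b q. (p, (f, b), q) \<in> Arr (NExt \<Gamma>) \<Longrightarrow> Ker_arr (p, (f, b), q) \<cdot> \<gamma> p = \<gamma> q \<cdot> FA F b"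
    and Z: "is_zero_object C Z" "Z \<in> S" and A: "A \<in> S" and t: "normal_extension \<Gamma> (zero_arr C A Z)"
  shows "nker \<Gamma> (zero_arr C A Z) \<cdot> \<gamma> (zero_arr C A Z) = zero_arr C (FO F Z) A"
proof -
  let ?t = "zero_arr C A Z"
  have obj: "A \<in> Obj C" "Z \<in> Obj C" using A Z by simp_all
  interpret F: cat_functor C X F by (rule F)
  have FZ: "FO F Z \<in> S" using F.FO_obj[of Z] obj by simp
  have \<gamma>: "\<gamma> ?t \<in> Arr C" "Dom C (\<gamma> ?t) = FO F Z" "Cod C (\<gamma> ?t) = Ker_obj ?t"
    using comp[OF t] obj by (simp_all add: in_hom_iff)
  have e: "(?t, (zero_arr C A A, Id C Z), ?t) \<in> Arr (NExt \<Gamma>)"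
    using t obj by (simp add: NExt_Arr in_hom_iff)
  note k = Ker_arr[OF e]
  have "Ker_arr (?t, (zero_arr C A A, Id C Z), ?t) \<cdot> \<gamma> ?t = \<gamma> ?t"
    using nat[OF e] F.FA_id[of Z] \<gamma> obj by simp
  then have "nker \<Gamma> ?t \<cdot> \<gamma> ?t = nker \<Gamma> ?t \<cdot> (Ker_arr (?t, (zero_arr C A A, Id C Z), ?t) \<cdot> \<gamma> ?t)" by simp
  also have "\<dots> = (zero_arr C A A \<cdot> nker \<Gamma> ?t) \<cdot> \<gamma> ?t"
    unfolding k(4)[symmetric] using k(1-3) \<gamma> t obj by simp
  finally show ?thesis using \<gamma> t obj FZ by simp
qed

text \<open>The square from \<open>u B\<close> to \<open>I U \<rightarrow> 0\<close> with top \<open>\<eta>\<^sub>U\<close> shows that \<open>\<eta>\<^sub>U\<close> kills the component at \<open>u B\<close>, which therefore factors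
  through the Galois group of \<open>u B\<close>.\<close>

lemma component_factors:
  assumes F: "cat_functor C X F"
    and comp: "\<And>p. normal_extension \<Gamma> p \<Longrightarrow> \<gamma> p \<in> hom X (FO F (Cod C p)) (Ker_obj p)"
    and nat: "\<And>p f b q. (p, (f, b), q) \<in> Arr (NExt \<Gamma>) \<Longrightarrow> Ker_arr (p, (f, b), q) \<cdot> \<gamma> p = \<gamma> q \<cdot> FA F b"
    and B: "B \<in> Obj C"
  shows "\<exists>l. l \<in> hom C (FO F B) (Gal_obj (u B)) \<and> gal_iota \<Gamma> (u B) \<cdot> l = \<gamma> (u B)"
proof -
  interpret F: cat_functor C X F by (rule F)
  obtain Z where Z: "is_zero_object C Z" "is_zero_object X Z" "Z \<in> S" by (rule zero_object_in_S)
  let ?U = "Dom C (u B)" and ?t = "zero_arr C (Io (Dom C (u B))) Z" and ?z = "zero_arr C B Z"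
  have obj: "?U \<in> Obj C" "Io ?U \<in> S" "Z \<in> Obj C" "Io ?U \<in> Obj C" using B Z by simp_all
  have FB: "FO F B \<in> S" "FO F Z \<in> S" using F.FO_obj[of B] F.FO_obj[of Z] B obj by simp_all
  have "?t \<in> gF \<Gamma>" by (rule to_zero[OF obj(1) Z(2)]) (use obj Z in \<open>simp add: in_hom_iff\<close>)
  then have t: "normal_extension \<Gamma> ?t" by (intro normal_extension_to_zero) (use obj Z in auto)
  have s: "(u B, (\<eta> ?U, ?z), ?t) \<in> Arr (NExt \<Gamma>)"
    using B obj t by (simp add: NExt_Arr in_hom_iff)
  note k = Ker_arr[OF s]
  have \<gamma>: "\<gamma> (u B) \<in> Arr C" "Dom C (\<gamma> (u B)) = FO F B" "Cod C (\<gamma> (u B)) = Ker_obj (u B)"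
    using comp[of "u B"] B by (simp_all add: in_hom_iff)
  have \<gamma>t: "\<gamma> ?t \<in> Arr C" "Dom C (\<gamma> ?t) = FO F Z" "Cod C (\<gamma> ?t) = Ker_obj ?t"
    using comp[OF t] obj by (simp_all add: in_hom_iff)
  have Fz: "FA F ?z \<in> Arr C" "Dom C (FA F ?z) = FO F B" "Cod C (FA F ?z) = FO F Z"
    using F.FA_arr[of ?z] F.dom_FA[of ?z] F.cod_FA[of ?z] B obj by simp_all
  have "\<eta> ?U \<cdot> (nker \<Gamma> (u B) \<cdot> \<gamma> (u B)) = nker \<Gamma> ?t \<cdot> (Ker_arr (u B, (\<eta> ?U, ?z), ?t) \<cdot> \<gamma> (u B))"
    using comp_eq_extend[OF k(4), of "\<gamma> (u B)"] k(1-3) \<gamma> t B obj by simp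
  also have "\<dots> = nker \<Gamma> ?t \<cdot> (\<gamma> ?t \<cdot> FA F ?z)" using nat[OF s] by simp
  also have "\<dots> = zero_arr C (FO F B) (Io ?U)"
    using comp_eq_extend[OF component_at_zero_base[OF F comp nat Z(1,3) obj(2) t], of "FA F ?z"] \<gamma>t Fz t FB obj
    by simp
  finally show ?thesis using iota_factor[of "u B" "\<gamma> (u B)"] \<gamma> B by simp
qed

text \<open>The components at the weakly universal extensions, factored through their Galois groups, form \<open>\<alpha>\<close>. Since \<open>\<iota>\<close> is monic,
  naturality of \<open>\<alpha>\<close> can be tested after \<open>\<iota>\<close>, where it is naturality of \<open>\<gamma>\<close>; and the component at \<open>p\<close> arises
  from the one at the weakly universal extension along any morphism over the identity.\<close>

lemma kan_existence_normal:
  assumes F: "cat_functor C X F"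
    and comp: "\<And>p. normal_extension \<Gamma> p \<Longrightarrow> \<gamma> p \<in> hom X (FO F (Cod C p)) (Ker_obj p)"
    and nat: "\<And>p f b q. (p, (f, b), q) \<in> Arr (NExt \<Gamma>) \<Longrightarrow> Ker_arr (p, (f, b), q) \<cdot> \<gamma> p = \<gamma> q \<cdot> FA F b"
  shows "\<exists>\<alpha>. nat_trans C X F (pi1 \<Gamma> u) \<alpha> \<and> \<alpha> \<in> extensional (Obj C) \<and>
    (\<forall>p. normal_extension \<Gamma> p \<longrightarrow> \<delta> p \<cdot> \<alpha> (Cod C p) = \<gamma> p)"
proof -
  interpret F: cat_functor C X F by (rule F)
  define \<alpha> where "\<alpha> = (\<lambda>B \<in> Obj C. SOME l. l \<in> hom C (FO F B) (Gal_obj (u B)) \<and> gal_iota \<Gamma> (u B) \<cdot> l = \<gamma> (u B))"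
  have "\<alpha> B \<in> hom C (FO F B) (Gal_obj (u B)) \<and> gal_iota \<Gamma> (u B) \<cdot> \<alpha> B = \<gamma> (u B)" if B: "B \<in> Obj C" for B
    unfolding \<alpha>_def restrict_apply'[OF B] by (rule someI_ex) (rule component_factors[OF F comp nat B])
  then have \<alpha>: "\<alpha> B \<in> Arr C" "Dom C (\<alpha> B) = FO F B" "Cod C (\<alpha> B) = Gal_obj (u B)"
    "gal_iota \<Gamma> (u B) \<cdot> \<alpha> B = \<gamma> (u B)" if "B \<in> Obj C" for B
    using that by (simp_all add: in_hom_iff)
  have FS: "FO F B \<in> S" if "B \<in> Obj C" for B using F.FO_obj[OF that] by simp
  have nt: "nat_trans C X F (pi1 \<Gamma> u) \<alpha>"
  proof (rule nat_trans.intro)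
    show "cat_functor C X F" by (rule F)
    show "cat_functor C X (pi1 \<Gamma> u)" by (rule cat_functor_pi1)
    show "\<alpha> B \<in> hom X (FO F B) (FO (pi1 \<Gamma> u) B)" if "B \<in> Obj C" for B
      using that \<alpha> FS by (simp add: in_hom_iff)
    fix f A B assume "f \<in> hom C A B"
    then have f: "f \<in> Arr C" "Dom C f = A" "Cod C f = B" "A \<in> Obj C" "B \<in> Obj C" by (auto simp: in_hom_iff)
    have Ff: "FA F f \<in> Arr C" "Dom C (FA F f) = FO F A" "Cod C (FA F f) = FO F B"
      using F.FA_arr[OF f(1)] F.dom_FA[OF f(1)] F.cod_FA[OF f(1)] f by simp_all
    obtain g where g: "(u A, (g, f), u B) \<in> Arr (NExt \<Gamma>)" "pi1_arr f = Gal_arr (u A, (g, f), u B)"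
      using pi1_lift[of f] f by blast
    note G = Gal_arr[OF g(1)] and K = Ker_arr[OF g(1)]
    have "pi1_arr f \<cdot> \<alpha> A = \<alpha> B \<cdot> FA F f"
    proof (rule iota_mono[of "u B"])
      show "gal_iota \<Gamma> (u B) \<cdot> (pi1_arr f \<cdot> \<alpha> A) = gal_iota \<Gamma> (u B) \<cdot> (\<alpha> B \<cdot> FA F f)"
        using comp_eq_extend[OF G(4), of "\<alpha> A"] comp_eq_extend[OF \<alpha>(4)[OF f(5)], of "FA F f"]
          nat[OF g(1)] \<alpha>[OF f(4)] \<alpha>(1-3)[OF f(5)] G(1-3) K(1-3) f Ff by (simp add: g(2))
    qed (use f \<alpha> G(1-3) Ff in \<open>simp_all add: g(2)\<close>)
    then show "pi1_arr f \<cdot>\<^bsub>X\<^esub> \<alpha> A = \<alpha> B \<cdot>\<^bsub>X\<^esub> FA F f" by simp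
  qed
  moreover have "\<delta> p \<cdot> \<alpha> (Cod C p) = \<gamma> p" if p: "normal_extension \<Gamma> p" for p
  proof -
    let ?B = "Cod C p"
    have p_arr: "p \<in> Arr C" by (rule normal_extension_arr[OF p])
    then have B: "?B \<in> Obj C" by simp
    obtain h where h: "(u ?B, (h, Id C ?B), p) \<in> Arr (NExt \<Gamma>)" "kappa \<Gamma> u p = Gal_arr (u ?B, (h, Id C ?B), p)"
      by (rule kappa_lift[OF p])
    note G = Gal_arr[OF h(1)] and K = Ker_arr[OF h(1)]
    have "\<delta> p \<cdot> \<alpha> ?B = Ker_arr (u ?B, (h, Id C ?B), p) \<cdot> \<gamma> (u ?B)"
      using comp_eq_extend[OF G(4), of "\<alpha> ?B"] G(1-3) K(1-3) \<alpha>[OF B] p B by (simp add: delta_def h(2))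
    also have "\<dots> = \<gamma> p \<cdot> FA F (Id C ?B)" by (rule nat[OF h(1)])
    also have "\<dots> = \<gamma> p" using F.FA_id[OF B] comp[OF p] by (auto simp: in_hom_iff)
    finally show ?thesis .
  qed
  moreover have "\<alpha> \<in> extensional (Obj C)" by (simp add: \<alpha>_def)
  ultimately show ?thesis by blast
qed

end

locale normalised_fundamental_group = fundamental_group C \<Gamma> S u
  for C :: "('o, 'a) cat" (structure) and \<Gamma> :: "('o, 'a, 'o, 'a) galois" and S :: "'o set" and u :: "'o \<Rightarrow> 'a" +
  fixes I1 :: "('a, 'a \<times> ('a \<times> 'a) \<times> 'a, 'a, 'a \<times> ('a \<times> 'a) \<times> 'a) fctr"
    and \<eta>1 \<epsilon>1 :: "'a \<Rightarrow> 'a \<times> ('a \<times> 'a) \<times> 'a"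
  assumes normalisation: "adjunction (Ext \<Gamma>) (NExt \<Gamma>) I1 id_fctr \<eta>1 \<epsilon>1"
    and unit_cod: "p \<in> Obj (Ext \<Gamma>) \<Longrightarrow> \<exists>e. \<eta>1 p = (p, (e, Id C (Cod C p)), FO I1 p)"
begin

sublocale I1: cat_functor "Ext \<Gamma>" "NExt \<Gamma>" I1
  using normalisation by (rule adjunction.left_functor)
sublocale \<eta>1: nat_trans "Ext \<Gamma>" "Ext \<Gamma>" id_fctr "id_fctr \<circ>\<^sub>F I1" \<eta>1
  using normalisation by (rule adjunction.unit_natural)
sublocale \<epsilon>1: nat_trans "NExt \<Gamma>" "NExt \<Gamma>" "I1 \<circ>\<^sub>F id_fctr" id_fctr \<epsilon>1
  using normalisation by (rule adjunction.counit_natural)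

lemma I1_normal [simp]: "p \<in> Obj (Ext \<Gamma>) \<Longrightarrow> normal_extension \<Gamma> (FO I1 p)"
  using I1.FO_obj by simp

lemma unit_form:
  assumes "p \<in> Obj (Ext \<Gamma>)"
  obtains e where "\<eta>1 p = (p, (e, Id C (Cod C p)), FO I1 p)" "(p, (e, Id C (Cod C p)), FO I1 p) \<in> Arr (Ext \<Gamma>)"
    "e \<in> Arr C" "Cod C (FO I1 p) = Cod C p"
proof -
  obtain e where e: "\<eta>1 p = (p, (e, Id C (Cod C p)), FO I1 p)" using unit_cod[OF assms] by blast
  have "(p, (e, Id C (Cod C p)), FO I1 p) \<in> Arr (Ext \<Gamma>)" using \<eta>1.component_arr[OF assms] e by simp
  moreover from this have "e \<in> Arr C" "Cod C (FO I1 p) = Cod C p" using assms by (auto simp: Ext_Arr in_hom_iff Ext_Obj)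
  ultimately show thesis using that e by blast
qed

lemma cod_I1 [simp]: "p \<in> Obj (Ext \<Gamma>) \<Longrightarrow> Cod C (FO I1 p) = Cod C p"
  using unit_form by blast

text \<open>As the unit lies over identities, so does the counit, by the triangle identities, and \<open>I\<^sub>1\<close> preserves the codomain component
  of morphisms, by naturality of the unit.\<close>

lemma counit_form:
  assumes p: "normal_extension \<Gamma> p"
  obtains e where "\<epsilon>1 p = (FO I1 p, (e, Id C (Cod C p)), p)" "(FO I1 p, (e, Id C (Cod C p)), p) \<in> Arr (NExt \<Gamma>)"
proof -
  have pO: "p \<in> Obj (NExt \<Gamma>)" "p \<in> Obj (Ext \<Gamma>)" using p NExt_Obj_Ext by simp_all
  obtain e where e: "\<eta>1 p = (p, (e, Id C (Cod C p)), FO I1 p)" by (rule unit_form[OF pO(2)])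
  obtain f b where fb: "\<epsilon>1 p = (FO I1 p, (f, b), p)"
    using \<epsilon>1.dom_component[OF pO(1)] \<epsilon>1.cod_component[OF pO(1)] by (cases "\<epsilon>1 p") auto
  have ar: "(FO I1 p, (f, b), p) \<in> Arr (NExt \<Gamma>)" using \<epsilon>1.component_arr[OF pO(1)] fb by simp
  have "b \<cdot> Id C (Cod C p) = Id C (Cod C p)"
    using adjunction.triangle_right[OF normalisation pO(1)] e fb by simp
  then have "b = Id C (Cod C p)" using ar pO by (auto simp: NExt_Arr in_hom_iff)
  then show thesis using that fb ar by simp
qed

lemma I1_form:
  assumes a: "(p, (f, b), q) \<in> Arr (Ext \<Gamma>)"
  obtains f' where "FA I1 (p, (f, b), q) = (FO I1 p, (f', b), FO I1 q)" "(FO I1 p, (f', b), FO I1 q) \<in> Arr (NExt \<Gamma>)"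
proof -
  have pq: "p \<in> Obj (Ext \<Gamma>)" "q \<in> Obj (Ext \<Gamma>)" "b \<in> Arr C" "Dom C b = Cod C p" "Cod C b = Cod C q"
    using a by (simp_all add: Ext_Arr in_hom_iff)
  obtain e where e: "\<eta>1 p = (p, (e, Id C (Cod C p)), FO I1 p)" by (rule unit_form[OF pq(1)])
  obtain e' where e': "\<eta>1 q = (q, (e', Id C (Cod C q)), FO I1 q)" by (rule unit_form[OF pq(2)])
  obtain f' b' where fb: "FA I1 (p, (f, b), q) = (FO I1 p, (f', b'), FO I1 q)"
    using I1.dom_FA[OF a] I1.cod_FA[OF a] by (cases "FA I1 (p, (f, b), q)") auto
  have ar: "(FO I1 p, (f', b'), FO I1 q) \<in> Arr (NExt \<Gamma>)" using I1.FA_arr[OF a] fb by simp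
  have "b' \<cdot> Id C (Cod C p) = Id C (Cod C q) \<cdot> b"
    using \<eta>1.naturality_arr[OF a] e e' fb by simp
  then have "b' = b" using ar pq by (auto simp: NExt_Arr in_hom_iff)
  then show thesis using that fb ar by simp
qed

text \<open>For existence, \<open>\<gamma>\<close> is restricted to normal extensions, where \<open>\<alpha>\<close> is available. For uniqueness, the condition at
  \<open>u B\<close> prescribes \<open>\<iota> \<alpha>\<^sub>B\<close>.\<close>

theorem kan_extension:
  "right_kan_extension (Ext \<Gamma>) C X (cod_fctr C) (Ker_fctr \<Gamma> \<circ>\<^sub>F I1) (pi1 \<Gamma> u) (\<lambda>p. \<delta> (FO I1 p))"
  unfolding right_kan_extension_def
proof (intro conjI allI impI)
  have cod [simp]: "FO (cod_fctr C) p = Cod C p" "FA (cod_fctr C) (p, (f, b), q) = b" for p q f b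
    by (simp_all add: cod_fctr_def)
  show "cat_functor (Ext \<Gamma>) C (cod_fctr C)" by (rule cat_functor_cod)
  show KI: "cat_functor (Ext \<Gamma>) X (Ker_fctr \<Gamma> \<circ>\<^sub>F I1)"
    by (rule cat_functor_comp[OF I1.cat_functor_axioms cat_functor_Ker])
  show "cat_functor C X (pi1 \<Gamma> u)" by (rule cat_functor_pi1)
  show "nat_trans (Ext \<Gamma>) X (pi1 \<Gamma> u \<circ>\<^sub>F cod_fctr C) (Ker_fctr \<Gamma> \<circ>\<^sub>F I1) (\<lambda>p. \<delta> (FO I1 p))"
  proof (rule nat_trans.intro)
    show "cat_functor (Ext \<Gamma>) X (pi1 \<Gamma> u \<circ>\<^sub>F cod_fctr C)"
      by (rule cat_functor_comp[OF cat_functor_cod cat_functor_pi1])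
    show "cat_functor (Ext \<Gamma>) X (Ker_fctr \<Gamma> \<circ>\<^sub>F I1)" by (rule KI)
    show "\<delta> (FO I1 p) \<in> hom X (FO (pi1 \<Gamma> u \<circ>\<^sub>F cod_fctr C) p) (FO (Ker_fctr \<Gamma> \<circ>\<^sub>F I1) p)" if "p \<in> Obj (Ext \<Gamma>)" for p
      using delta_arr[OF I1_normal[OF that]] that by (simp add: in_hom_iff Ext_Obj)
    fix p q \<phi> assume \<phi>: "\<phi> \<in> hom (Ext \<Gamma>) p q"
    then obtain f b where fb: "\<phi> = (p, (f, b), q)" "(p, (f, b), q) \<in> Arr (Ext \<Gamma>)" by (cases \<phi>) (auto simp: in_hom_iff)
    obtain f' where f': "FA I1 (p, (f, b), q) = (FO I1 p, (f', b), FO I1 q)"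
      "(FO I1 p, (f', b), FO I1 q) \<in> Arr (NExt \<Gamma>)" by (rule I1_form[OF fb(2)])
    show "FA (Ker_fctr \<Gamma> \<circ>\<^sub>F I1) \<phi> \<cdot>\<^bsub>X\<^esub> \<delta> (FO I1 p) = \<delta> (FO I1 q) \<cdot>\<^bsub>X\<^esub> FA (pi1 \<Gamma> u \<circ>\<^sub>F cod_fctr C) \<phi>"
      using delta_natural[OF f'(2)] f'(1) fb(1) by simp
  qed
  fix F \<gamma>
  assume "cat_functor C X F \<and> nat_trans (Ext \<Gamma>) X (F \<circ>\<^sub>F cod_fctr C) (Ker_fctr \<Gamma> \<circ>\<^sub>F I1) \<gamma>"
  then have F: "cat_functor C X F" and \<gamma>_nt: "nat_trans (Ext \<Gamma>) X (F \<circ>\<^sub>F cod_fctr C) (Ker_fctr \<Gamma> \<circ>\<^sub>F I1) \<gamma>" by auto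
  interpret F: cat_functor C X F by (rule F)
  interpret \<gamma>: nat_trans "Ext \<Gamma>" X "F \<circ>\<^sub>F cod_fctr C" "Ker_fctr \<Gamma> \<circ>\<^sub>F I1" \<gamma> by (rule \<gamma>_nt)
  have \<gamma>_arr: "\<gamma> p \<in> Arr C" "Dom C (\<gamma> p) = FO F (Cod C p)" "Cod C (\<gamma> p) = Ker_obj (FO I1 p)" if "p \<in> Obj (Ext \<Gamma>)" for p
    using \<gamma>.component[OF that] by (simp_all add: in_hom_iff)
  have \<gamma>_nat: "Ker_arr (FO I1 p, (f', b), FO I1 q) \<cdot> \<gamma> p = \<gamma> q \<cdot> FA F b"
    if "(p, (f, b), q) \<in> Arr (Ext \<Gamma>)" "FA I1 (p, (f, b), q) = (FO I1 p, (f', b), FO I1 q)" for p q f b f'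
    using \<gamma>.naturality_arr[OF that(1)] that(2) by simp
  have F_arr: "FA F b \<in> Arr C" "Dom C (FA F b) = FO F (Dom C b)" "Cod C (FA F b) = FO F (Cod C b)" if "b \<in> Arr C" for b
    using F.FA_arr[OF that] F.dom_FA[OF that] F.cod_FA[OF that] by simp_all
  \<comment> \<open>the restriction of \<open>\<gamma>\<close> to normal extensions, along the counit\<close>
  define \<gamma>' where "\<gamma>' p = Ker_arr (\<epsilon>1 p) \<cdot> \<gamma> p" for p
  have FS: "FO F B \<in> S" if "B \<in> Obj C" for B using F.FO_obj[OF that] by simp
  have \<gamma>'_arr: "\<gamma>' p \<in> hom X (FO F (Cod C p)) (Ker_obj p)" if p: "normal_extension \<Gamma> p" for p
  proof -
    have pO: "p \<in> Obj (Ext \<Gamma>)" using p NExt_Obj_Ext by simp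
    obtain e where e: "\<epsilon>1 p = (FO I1 p, (e, Id C (Cod C p)), p)" "(FO I1 p, (e, Id C (Cod C p)), p) \<in> Arr (NExt \<Gamma>)"
      by (rule counit_form[OF p])
    show ?thesis using \<gamma>_arr[OF pO] Ker_arr(1-3)[OF e(2)] p FS[of "Cod C p"] normal_extension_arr[OF p]
      by (simp add: \<gamma>'_def e(1) in_hom_iff)
  qed
  have \<gamma>'_nat: "Ker_arr (p, (f, b), q) \<cdot> \<gamma>' p = \<gamma>' q \<cdot> FA F b" if a: "(p, (f, b), q) \<in> Arr (NExt \<Gamma>)" for p q f b
  proof -
    have pq: "normal_extension \<Gamma> p" "normal_extension \<Gamma> q" "b \<in> Arr C" "Dom C b = Cod C p" "Cod C b = Cod C q"
      using a by (simp_all add: NExt_Arr in_hom_iff)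
    have pO: "p \<in> Obj (Ext \<Gamma>)" "q \<in> Obj (Ext \<Gamma>)" using pq NExt_Obj_Ext by simp_all
    have aE: "(p, (f, b), q) \<in> Arr (Ext \<Gamma>)" using a pO by (simp add: Ext_Arr NExt_Arr)
    obtain e where e: "\<epsilon>1 p = (FO I1 p, (e, Id C (Cod C p)), p)" "(FO I1 p, (e, Id C (Cod C p)), p) \<in> Arr (NExt \<Gamma>)"
      by (rule counit_form[OF pq(1)])
    obtain e' where e': "\<epsilon>1 q = (FO I1 q, (e', Id C (Cod C q)), q)" "(FO I1 q, (e', Id C (Cod C q)), q) \<in> Arr (NExt \<Gamma>)"
      by (rule counit_form[OF pq(2)])
    obtain f' where f': "FA I1 (p, (f, b), q) = (FO I1 p, (f', b), FO I1 q)"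
      "(FO I1 p, (f', b), FO I1 q) \<in> Arr (NExt \<Gamma>)" by (rule I1_form[OF aE])
    have "(p, (f, b), q) \<cdot>\<^bsub>NExt \<Gamma>\<^esub> \<epsilon>1 p = \<epsilon>1 q \<cdot>\<^bsub>NExt \<Gamma>\<^esub> FA I1 (p, (f, b), q)"
      using \<epsilon>1.naturality_arr[OF a] by simp
    then have sq: "Ker_arr (p, (f, b), q) \<cdot> Ker_arr (\<epsilon>1 p) = Ker_arr (\<epsilon>1 q) \<cdot> Ker_arr (FO I1 p, (f', b), FO I1 q)"
      using Ker_arr_comp[OF e(2) a] Ker_arr_comp[OF f'(2) e'(2)] e(1) e'(1) f'(1) by simp
    note K = Ker_arr(1-3)[OF a] Ker_arr(1-3)[OF e(2)] Ker_arr(1-3)[OF e'(2)] Ker_arr(1-3)[OF f'(2)]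
    have "Ker_arr (p, (f, b), q) \<cdot> \<gamma>' p = Ker_arr (\<epsilon>1 q) \<cdot> (Ker_arr (FO I1 p, (f', b), FO I1 q) \<cdot> \<gamma> p)"
      using comp_eq_extend[OF sq, of "\<gamma> p"] K \<gamma>_arr[OF pO(1)] by (simp add: \<gamma>'_def e(1) e'(1))
    also have "\<dots> = \<gamma>' q \<cdot> FA F b"
      unfolding \<gamma>_nat[OF aE f'(1)] using K \<gamma>_arr[OF pO(2)] F_arr[OF pq(3)] pq by (simp add: \<gamma>'_def e'(1))
    finally show ?thesis .
  qed
  \<comment> \<open>for \<open>p\<close> an extension, the value at \<open>I\<^sub>1 p\<close> is \<open>\<gamma>\<close> at \<open>p\<close>: naturality at the unit and a triangle identity\<close>
  have \<gamma>'_I1: "\<gamma>' (FO I1 p) = \<gamma> p" if p: "p \<in> Obj (Ext \<Gamma>)" for p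
  proof -
    have pO: "FO I1 p \<in> Obj (Ext \<Gamma>)" "Cod C p \<in> Obj C" using p NExt_Obj_Ext by (simp_all add: Ext_Obj)
    obtain e where e: "\<eta>1 p = (p, (e, Id C (Cod C p)), FO I1 p)" "(p, (e, Id C (Cod C p)), FO I1 p) \<in> Arr (Ext \<Gamma>)"
      by (rule unit_form[OF p])
    obtain f' where f': "FA I1 (\<eta>1 p) = (FO I1 p, (f', Id C (Cod C p)), FO I1 (FO I1 p))"
      "(FO I1 p, (f', Id C (Cod C p)), FO I1 (FO I1 p)) \<in> Arr (NExt \<Gamma>)" unfolding e(1) by (rule I1_form[OF e(2)])
    obtain k where k: "\<epsilon>1 (FO I1 p) = (FO I1 (FO I1 p), (k, Id C (Cod C p)), FO I1 p)"
      "(FO I1 (FO I1 p), (k, Id C (Cod C p)), FO I1 p) \<in> Arr (NExt \<Gamma>)"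
      using counit_form[OF I1_normal[OF p]] p by auto
    have "\<epsilon>1 (FO I1 p) \<cdot>\<^bsub>NExt \<Gamma>\<^esub> FA I1 (\<eta>1 p) = Id (NExt \<Gamma>) (FO I1 p)"
      by (rule adjunction.triangle_left[OF normalisation p])
    then have tri: "Ker_arr (\<epsilon>1 (FO I1 p)) \<cdot> Ker_arr (FA I1 (\<eta>1 p)) = Id C (Ker_obj (FO I1 p))"
      using Ker_arr_comp[OF f'(2) k(2)] Ker_arr_Id[OF I1_normal[OF p]] f'(1) k(1) by simp
    have "\<gamma> (FO I1 p) = \<gamma> (FO I1 p) \<cdot> FA F (Id C (Cod C p))"
      using F.FA_id[OF pO(2)] \<gamma>_arr[OF pO(1)] p by simp
    also have "\<dots> = Ker_arr (FA I1 (\<eta>1 p)) \<cdot> \<gamma> p"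
      using \<gamma>_nat[OF e(2)] f'(1) e(1) by simp
    finally have "\<gamma>' (FO I1 p) = Ker_arr (\<epsilon>1 (FO I1 p)) \<cdot> (Ker_arr (FA I1 (\<eta>1 p)) \<cdot> \<gamma> p)" by (simp add: \<gamma>'_def)
    also have "\<dots> = \<gamma> p"
      using comp_eq_extend[OF tri, of "\<gamma> p"] Ker_arr(1-3)[OF f'(2)] Ker_arr(1-3)[OF k(2)] \<gamma>_arr[OF p]
      by (simp add: f'(1) k(1))
    finally show ?thesis .
  qed
  show "\<exists>!\<alpha>. \<alpha> \<in> extensional (Obj C) \<and> nat_trans C X F (pi1 \<Gamma> u) \<alpha> \<and>
    (\<forall>p \<in> Obj (Ext \<Gamma>). \<delta> (FO I1 p) \<cdot>\<^bsub>X\<^esub> \<alpha> (FO (cod_fctr C) p) = \<gamma> p)"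
  proof (rule ex_ex1I)
    obtain \<alpha> where \<alpha>: "nat_trans C X F (pi1 \<Gamma> u) \<alpha>" "\<alpha> \<in> extensional (Obj C)"
      "\<And>p. normal_extension \<Gamma> p \<Longrightarrow> \<delta> p \<cdot> \<alpha> (Cod C p) = \<gamma>' p"
      using kan_existence_normal[OF F \<gamma>'_arr \<gamma>'_nat] by blast
    have "\<delta> (FO I1 p) \<cdot>\<^bsub>X\<^esub> \<alpha> (FO (cod_fctr C) p) = \<gamma> p" if "p \<in> Obj (Ext \<Gamma>)" for p
      using \<alpha>(3)[OF I1_normal[OF that]] \<gamma>'_I1[OF that] that by simp
    then show "\<exists>\<alpha>. \<alpha> \<in> extensional (Obj C) \<and> nat_trans C X F (pi1 \<Gamma> u) \<alpha> \<and>
      (\<forall>p \<in> Obj (Ext \<Gamma>). \<delta> (FO I1 p) \<cdot>\<^bsub>X\<^esub> \<alpha> (FO (cod_fctr C) p) = \<gamma> p)"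
      using \<alpha>(1,2) by blast
  next
    fix \<alpha> \<beta>
    assume \<alpha>: "\<alpha> \<in> extensional (Obj C) \<and> nat_trans C X F (pi1 \<Gamma> u) \<alpha> \<and>
        (\<forall>p \<in> Obj (Ext \<Gamma>). \<delta> (FO I1 p) \<cdot>\<^bsub>X\<^esub> \<alpha> (FO (cod_fctr C) p) = \<gamma> p)"
      and \<beta>: "\<beta> \<in> extensional (Obj C) \<and> nat_trans C X F (pi1 \<Gamma> u) \<beta> \<and>
        (\<forall>p \<in> Obj (Ext \<Gamma>). \<delta> (FO I1 p) \<cdot>\<^bsub>X\<^esub> \<beta> (FO (cod_fctr C) p) = \<gamma> p)"
    \<comment> \<open>naturality of \<open>\<delta>\<close> at the counit carries \<open>\<delta>\<close> at \<open>I\<^sub>1 (u B)\<close> to \<open>\<delta>\<close> at \<open>u B\<close>, which is the monomorphism \<open>\<iota>\<close>\<close>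
    have det: "gal_iota \<Gamma> (u B) \<cdot> \<tau> B = \<gamma>' (u B)"
      if B: "B \<in> Obj C" and nt: "nat_trans C X F (pi1 \<Gamma> u) \<tau>"
        and \<tau>: "\<forall>p \<in> Obj (Ext \<Gamma>). \<delta> (FO I1 p) \<cdot>\<^bsub>X\<^esub> \<tau> (FO (cod_fctr C) p) = \<gamma> p" for B \<tau>
    proof -
      interpret \<tau>: nat_trans C X F "pi1 \<Gamma> u" \<tau> by (rule nt)
      have uO: "u B \<in> Obj (Ext \<Gamma>)" using B NExt_Obj_Ext by simp
      obtain e where e: "\<epsilon>1 (u B) = (FO I1 (u B), (e, Id C B), u B)" "(FO I1 (u B), (e, Id C B), u B) \<in> Arr (NExt \<Gamma>)"
        using counit_form[of "u B"] B by auto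
      have \<tau>B: "\<tau> B \<in> Arr C" "Dom C (\<tau> B) = FO F B" "Cod C (\<tau> B) = Gal_obj (u B)"
        using \<tau>.component[OF B] by (simp_all add: in_hom_iff)
      have "pi1_arr (Id C B) = Id C (Gal_obj (u B))"
        using cat_functor.FA_id[OF cat_functor_pi1 B] by simp
      then have "Ker_arr (\<epsilon>1 (u B)) \<cdot> \<delta> (FO I1 (u B)) = gal_iota \<Gamma> (u B)"
        using delta_natural[OF e(2)] delta_u[OF B] B by (simp add: e(1))
      moreover have "\<delta> (FO I1 (u B)) \<cdot> \<tau> B = \<gamma> (u B)" using bspec[OF \<tau> uO] B by simp
      ultimately show ?thesis
        using comp_eq_extend[of "Ker_arr (\<epsilon>1 (u B))" "\<delta> (FO I1 (u B))" _ "\<tau> B"] uO Ker_arr(1-3)[OF e(2)] delta_arr[OF I1_normal[OF uO]] \<tau>B B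
        by (simp add: \<gamma>'_def e(1))
    qed
    have "\<alpha> B = \<beta> B" if B: "B \<in> Obj C" for B
    proof (rule iota_mono[of "u B"])
      interpret \<alpha>: nat_trans C X F "pi1 \<Gamma> u" \<alpha> using \<alpha> by simp
      interpret \<beta>: nat_trans C X F "pi1 \<Gamma> u" \<beta> using \<beta> by simp
      show "\<alpha> B \<in> Arr C" "\<beta> B \<in> Arr C" "Dom C (\<alpha> B) = Dom C (\<beta> B)" "Cod C (\<alpha> B) = Gal_obj (u B)"
        "Cod C (\<beta> B) = Gal_obj (u B)"
        using \<alpha>.component[OF B] \<beta>.component[OF B] by (simp_all add: in_hom_iff)
      show "gal_iota \<Gamma> (u B) \<cdot> \<alpha> B = gal_iota \<Gamma> (u B) \<cdot> \<beta> B"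
        using det[OF B, of \<alpha>] det[OF B, of \<beta>] \<alpha> \<beta> by simp
    qed (use B in simp)
    then show "\<alpha> = \<beta>" using \<alpha> \<beta> by - (rule extensionalityI[of \<alpha> "Obj C" \<beta>], auto)
  qed
qed

end

theorem corollary7p2:
  fixes \<Gamma> :: "('o, 'a, 'o, 'a) galois"
    and S :: "'o set"
    and u :: "'o \<Rightarrow> 'a"
    and I1 :: "('a, 'a \<times> ('a \<times> 'a) \<times> 'a, 'a, 'a \<times> ('a \<times> 'a) \<times> 'a) fctr"
    and \<eta>1 \<epsilon>1 :: "'a \<Rightarrow> 'a \<times> ('a \<times> 'a) \<times> 'a"
  assumes "galois_structure \<Gamma>"
    and "admissible \<Gamma>"
    and "finitely_complete (gC \<Gamma>)"
    and "pointed (gC \<Gamma>)"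
    and "S \<subseteq> Obj (gC \<Gamma>)" and "gX \<Gamma> = full_sub (gC \<Gamma>) S" and "gH \<Gamma> = id_fctr"
    and "pullback_stable (gC \<Gamma>) {p. monadic_extension \<Gamma> p}"
    and "\<And>B. B \<in> Obj (gC \<Gamma>) \<Longrightarrow> weakly_universal \<Gamma> B (u B)"
    and "\<And>E Z t. \<lbrakk>E \<in> Obj (gC \<Gamma>); is_zero_object (gX \<Gamma>) Z; t \<in> hom (gX \<Gamma>) (FO (gI \<Gamma>) E) Z\<rbrakk>
           \<Longrightarrow> t \<in> gF \<Gamma>"
    and "adjunction (Ext \<Gamma>) (NExt \<Gamma>) I1 id_fctr \<eta>1 \<epsilon>1"
    and "\<And>p. p \<in> Obj (Ext \<Gamma>) \<Longrightarrow> \<exists>e. \<eta>1 p = (p, (e, Id (gC \<Gamma>) (Cod (gC \<Gamma>) p)), FO I1 p)"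
  shows "right_kan_extension (Ext \<Gamma>) (gC \<Gamma>) (gX \<Gamma>)
           (cod_fctr (gC \<Gamma>)) (Ker_fctr \<Gamma> \<circ>\<^sub>F I1)
           (pi1 \<Gamma> u) (\<lambda>p. delta \<Gamma> u (FO I1 p))"
proof -
  have "category (gC \<Gamma>)"
    using galois_structure.adj[OF assms(1)] adjunction.left_functor cat_functor.cat_source by blast
  then have pointed: "pointed_category (gC \<Gamma>)"
    using assms(4) by (simp add: pointed_category_def pointed_category_axioms_def)
  have reflective: "reflective_galois (gC \<Gamma>) \<Gamma> S"
    by (rule reflective_galois.intro[OF pointed], rule reflective_galois_axioms.intro) (rule refl assms)+
  have admissible: "admissible_galois (gC \<Gamma>) \<Gamma> S"
    by (rule admissible_galois.intro[OF reflective], rule admissible_galois_axioms.intro) (fact assms)+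
  have fundamental: "fundamental_group (gC \<Gamma>) \<Gamma> S u"
  proof (rule fundamental_group.intro[OF admissible], rule fundamental_group_axioms.intro)
    show "weakly_universal \<Gamma> B (u B)" if "B \<in> Obj (gC \<Gamma>)" for B using assms(9) that .
    show "t \<in> gF \<Gamma>" if "A \<in> Obj (gC \<Gamma>)" "is_zero_object (full_sub (gC \<Gamma>) S) Z"
      "t \<in> hom (full_sub (gC \<Gamma>) S) (FO (gI \<Gamma>) A) Z" for A Z t
      using assms(10)[of A Z t] that unfolding assms(6) by blast
  qed
  have "normalised_fundamental_group (gC \<Gamma>) \<Gamma> S u I1 \<eta>1 \<epsilon>1"
    by (rule normalised_fundamental_group.intro[OF fundamental], rule normalised_fundamental_group_axioms.intro) (fact assms)+
  from normalised_fundamental_group.kan_extension[OF this] show ?thesis unfolding assms(6) .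
qed

end
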